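(* Suppose that $Y_\alpha=C^{1/2}(X_\alpha)\mathcal E_\alpha$ for all $\alpha\in\{1,\dots,n\}\cup\{01,\dots,0n\}$, where $\mathcal E_\alpha=(\varepsilon_{\alpha1},\dots,\varepsilon_{\alpha p})^\top$ is independent of $\mathcal F_{\mathcal X}$ and the $\varepsilon_{\alpha j}$ are i.i.d. in both $\alpha$ and $j$ with $\mathrm E(\varepsilon_{\alpha j})=0$, $\mathrm E(\varepsilon_{\alpha j}^2)=1$, $\mathrm E(\varepsilon_{\alpha j}^4)=\mu^{(4)}$, $\mathrm E|\varepsilon_{\alpha j}|^{4+\eta_1}<\infty$ for some $\eta_1>0$. Let $\mathrm{ErrF}$, $\mathrm{ErrR}$, $\mathrm{ErrS}$ be the expected test errors under the Fixed-$X$, Random-$X$ and Same-$X$ settings. (i) Under the Fixed-$X$ setting, $\mathrm{ErrF}=n^{-1}\sum_{i=1}^n\nu^2(x_i)+\mathcal B_{\rm ErrF}+\mathcal V_{\rm ErrF}$, where $$\mathcal B_{\rm ErrF}=\frac1n\sum_{i=1}^n\big\|\mathrm E\,\hat{\widetilde{\mathbf C}}(x_i)-\widetilde{\mathbf C}(x_i)\big\|_2^2,\qquad\mathcal V_{\rm ErrF}=\frac1n\sum_{i=1}^n\mathrm{tr}\{\mathrm{Cov}(\hat{\widetilde{\mathbf C}}(x_i))\}.$$ (ii) Under the Random-$X$ setting, $\mathrm{ErrR}=\mathrm E\{\nu^2(X_1)\}+\mathcal B_{\rm ErrR}+\mathcal V_{\rm ErrR}$, where $$\mathcal B_{\rm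 ErrR}=\mathrm E\big\|\mathrm E[\hat{\widetilde{\mathbf C}}(X_{01})|\mathbb X,X_{01}]-\widetilde{\mathbf C}(X_{01})\big\|_2^2,\qquad\mathcal V_{\rm ErrR}=\mathrm E\,\mathrm{tr}\{\mathrm{Cov}[\hat{\widetilde{\mathbf C}}(X_{01})|\mathbb X,X_{01}]\}.$$ (iii) Under the Same-$X$ setting, $\mathrm{ErrS}=\mathrm E\{\nu^2(X_1)\}+\mathcal B_{\rm ErrS}+\mathcal V_{\rm ErrS}$, where $$\mathcal B_{\rm ErrS}=\mathrm E\big\|\mathrm E[\hat{\widetilde{\mathbf C}}(X_1)|\mathbb X]-\widetilde{\mathbf C}(X_1)\big\|_2^2,\qquad\mathcal V_{\rm ErrS}=\mathrm E\,\mathrm{tr}\{\mathrm{Cov}[\hat{\widetilde{\mathbf C}}(X_1)|\mathbb X]\}.$$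
   Context: **Data.** Training data $(\mathbb X,\mathbb Y)=\{(X_i,Y_i):i=1,\dots,n\}$ and test data $(\mathbb X_0,\mathbb Y_0)=\{(X_{0i},Y_{0i}):i=1,\dots,m\}$ with $m=n$; $Y_\alpha\in\mathbb R^p$, $X_\alpha$ an explanatory variable (vector, matrix or tensor), $\alpha\in\{1,\dots,n\}\cup\{01,\dots,0n\}$. Let $\mathcal F_{\mathcal X}$ be the $\sigma$-algebra generated by all $X_\alpha$. The true model is $\mathrm{Cov}[Y_\alpha|\mathcal F_{\mathcal X}]=C(X_\alpha)$, with $C(\cdot)$ taking positive definite $p\times p$ values. **Data-generating assumption.** $Y_\alpha=C^{1/2}(X_\alpha)\mathcal E_\alpha$ for all $\alpha$, where $\mathcal E_\alpha=(\varepsilon_{\alpha1},\dots,\varepsilon_{\alpha p})^\top$ is independent of $\mathcal F_{\mathcal X}$ and the $\varepsilon_{\alpha j}$ are i.i.d. in both $\alpha$ and $j$ with $\mathrm E(\varepsilon_{\alpha j})=0$, $\mathrm E(\varepsilon_{\alpha j}^2)=1$, $\mathrm E(\varepsilon_{\alpha j}^4)=\mu^{(4)}$, $\mathrm E|\varepsilon_{\alpha j}|^{4+\eta_1}<\infty$ for some $\eta_1>0$. **Fitted model.** A parametric model $C_\beta(\cdot)$ (positive definite $p\times p$ valued, $\beta\in\mathbb R^K$), not necessarily containing $C(\cdot)$, is fitted on the training data. Let $\mathbf Y_\alpha=\mathrm{vec}(Y_\alpha Y_\alpha^\top)$, $\mathbf C_\beta(\cdot)=\mathrm{vec}\,C_\beta(\cdot)$,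 $\mathbf C(\cdot)=\mathrm{vec}\,C(\cdot)$, and let $\mathbf W(\cdot)$ be a given positive semidefinite $p^2\times p^2$ weight matrix function. $\hat\beta$, a function of $(\mathbb X,\mathbb Y)$ only, is either the quasi-maximum likelihood estimator, maximizing $-\frac{np}2\log(2\pi)-\frac12\sum_{i=1}^n\log\det C_\beta(X_i)-\frac12\sum_{i=1}^nY_i^\top C_\beta^{-1}(X_i)Y_i$, or the weighted least squares estimator, minimizing $\frac1n\sum_{i=1}^n\{\mathbf Y_i-\mathbf C_\beta(X_i)\}^\top\mathbf W(X_i)\{\mathbf Y_i-\mathbf C_\beta(X_i)\}$. Put $\hat{\mathbf C}(\cdot)=\mathbf C_{\hat\beta}(\cdot)$, $\widetilde{\mathbf C}(X_\alpha)=\mathbf W^{1/2}(X_\alpha)\mathbf C(X_\alpha)$, $\hat{\widetilde{\mathbf C}}(X_\alpha)=\mathbf W^{1/2}(X_\alpha)\hat{\mathbf C}(X_\alpha)$. **Test error.** $\mathrm{Te}(\mathbb X_0,\mathbb Y_0,\mathbb X,\mathbb Y)=\frac1m\sum_{i=1}^m\{\mathbf Y_{0i}-\hat{\mathbf C}(X_{0i})\}^\top\mathbf W(X_{0i})\{\mathbf Y_{0i}-\hat{\mathbf C}(X_{0i})\}$ and $\mathrm{Err}=\mathrm E\{\mathrm{Te}(\mathbb X_0,\mathbb Y_0,\mathbb X,\mathbb Y)\}$; it is denoted $\mathrm{ErrF},\mathrm{ErrR},\mathrm{ErrS}$ under the respective settings below. Also $\mathbf V(X_\alpha)=\mathrm{Cov}[\mathbf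 Y_\alpha|X_\alpha]$ and $\nu^2(X_\alpha)=\mathrm{tr}\{\mathbf W(X_\alpha)\mathbf V(X_\alpha)\}$. All expectations and (conditional) covariances appearing are understood to exist and be finite. **Settings.** *Fixed-$X$*: $X_1=x_1,\dots,X_n=x_n$ are nonrandom and $X_{0i}=x_i$, $i=1,\dots,n$. *Random-$X$*: $(X_1,Y_1),\dots,(X_n,Y_n),(X_{01},Y_{01}),\dots,(X_{0m},Y_{0m})$ are i.i.d. *Same-$X$*: $(X_1,Y_1),\dots,(X_n,Y_n)$ are i.i.d., $X_{0i}=X_i$ for $i=1,\dots,n$, and the $Y_{0i}$ are independently distributed according to the conditional distribution of $Y_i|X_i$.
   Formalization: In (iii) the estimator is additionally assumed to be almost surely unchanged when the training pairs are renumbered (automatic if the optimum is a.s. unique); with ties broken according to the numbering, (iii) as stated can fail. *)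

theory Defs
  imports "HOL-Probability.Probability"
begin

section \<open>Matrices\<close>

definition posdef_matrix :: "real^'n^'n \<Rightarrow> bool" where
  "posdef_matrix A \<longleftrightarrow> transpose A = A \<and> (\<forall>x. x \<noteq> 0 \<longrightarrow> 0 < x \<bullet> (A *v x))"

definition possemidef_matrix :: "real^'n^'n \<Rightarrow> bool" where
  "possemidef_matrix A \<longleftrightarrow> transpose A = A \<and> (\<forall>x. 0 \<le> x \<bullet> (A *v x))"

text \<open>The exponent 1/2 denotes the symmetric square root, which exists and is unique for every
  positive semidefinite matrix; for other matrices the value is unspecified.\<close>

definition matrix_sqrt :: "real^'n^'n \<Rightarrow> real^'n^'n" where
  "matrix_sqrt A = (THE B. possemidef_matrix B \<and> B ** B = A)"

text \<open>Vectorization: the coordinates of a vector of length \<open>p\<^sup>2\<close> are indexed by pairs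
  (row, column). The order in which vec stacks the entries plays no role.\<close>

definition vec_mat :: "real^'n^'n \<Rightarrow> real^('n \<times> 'n)" where
  "vec_mat A = (\<chi> k. A $ fst k $ snd k)"

definition outer :: "real^'n \<Rightarrow> real^'n^'n" where
  "outer y = (\<chi> i j. y $ i * y $ j)"

section \<open>Means and covariances of random vectors\<close>

definition covariance_matrix :: "'a measure \<Rightarrow> ('a \<Rightarrow> real^'d) \<Rightarrow> real^'d^'d" where
  "covariance_matrix M Z =
     (\<chi> i j. \<integral>\<omega>. (Z \<omega> $ i - (\<integral>\<omega>'. Z \<omega>' $ i \<partial>M)) * (Z \<omega> $ j - (\<integral>\<omega>'. Z \<omega>' $ j \<partial>M)) \<partial>M)"

definition covariance_finite :: "'a measure \<Rightarrow> ('a \<Rightarrow> real^'d) \<Rightarrow> bool" where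
  "covariance_finite M Z \<longleftrightarrow>
     (\<forall>i. integrable M (\<lambda>\<omega>. Z \<omega> $ i)) \<and>
     (\<forall>i j. integrable M (\<lambda>\<omega>. (Z \<omega> $ i - (\<integral>\<omega>'. Z \<omega>' $ i \<partial>M)) * (Z \<omega> $ j - (\<integral>\<omega>'. Z \<omega>' $ j \<partial>M))))"

definition cond_mean :: "'a measure \<Rightarrow> 'a measure \<Rightarrow> ('a \<Rightarrow> real^'d) \<Rightarrow> 'a \<Rightarrow> real^'d" where
  "cond_mean M F Z \<omega> = (\<chi> i. real_cond_exp M F (\<lambda>\<omega>'. Z \<omega>' $ i) \<omega>)"

definition cond_cov :: "'a measure \<Rightarrow> 'a measure \<Rightarrow> ('a \<Rightarrow> real^'d) \<Rightarrow> 'a \<Rightarrow> real^'d^'d" where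
  "cond_cov M F Z \<omega> = (\<chi> i j. real_cond_exp M F
     (\<lambda>\<omega>'. (Z \<omega>' $ i - cond_mean M F Z \<omega>' $ i) * (Z \<omega>' $ j - cond_mean M F Z \<omega>' $ j)) \<omega>)"

text \<open>\<open>real_cond_exp\<close> is the difference of the conditional expectations of the positive and the
  negative part, so it has its intended meaning as soon as the conditional expectation of the
  absolute value is almost surely finite; integrability is not needed.\<close>

definition cond_exp_finite :: "'a measure \<Rightarrow> 'a measure \<Rightarrow> ('a \<Rightarrow> real) \<Rightarrow> bool" where
  "cond_exp_finite M F f \<longleftrightarrow> f \<in> borel_measurable M \<and>
     (AE \<omega> in M. nn_cond_exp M F (\<lambda>\<omega>'. ennreal \<bar>f \<omega>'\<bar>) \<omega> < \<infinity>)"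

definition cond_cov_finite :: "'a measure \<Rightarrow> 'a measure \<Rightarrow> ('a \<Rightarrow> real^'d) \<Rightarrow> bool" where
  "cond_cov_finite M F Z \<longleftrightarrow>
     (\<forall>i. cond_exp_finite M F (\<lambda>\<omega>. Z \<omega> $ i)) \<and>
     (\<forall>i j. cond_exp_finite M F
        (\<lambda>\<omega>. (Z \<omega> $ i - cond_mean M F Z \<omega> $ i) * (Z \<omega> $ j - cond_mean M F Z \<omega> $ j)))"

text \<open>The \<open>\<sigma>\<close>-algebra generated by the random variables \<open>Z \<alpha>\<close>, \<open>\<alpha> \<in> I\<close>.\<close>

definition generated :: "'a measure \<Rightarrow> 'i set \<Rightarrow> ('i \<Rightarrow> 'a \<Rightarrow> 'b::topological_space) \<Rightarrow> 'a measure" where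
  "generated M I Z = vimage_algebra (space M) (\<lambda>\<omega>. \<lambda>\<alpha>\<in>I. Z \<alpha> \<omega>) (Pi\<^sub>M I (\<lambda>_. borel))"

definition iid :: "'a measure \<Rightarrow> 'i set \<Rightarrow> ('i \<Rightarrow> 'a \<Rightarrow> 'b::topological_space) \<Rightarrow> bool" where
  "iid M I Z \<longleftrightarrow> prob_space.indep_vars M (\<lambda>_. borel) Z I \<and>
     (\<forall>i\<in>I. \<forall>j\<in>I. distr M borel (Z i) = distr M borel (Z j))"

section \<open>Data\<close>

text \<open>Observation labels: \<open>Train i\<close> stands for the index \<open>i\<close>, \<open>Test i\<close> for the index \<open>0i\<close>.\<close>

datatype obs = Train nat | Test nat

definition obs_set :: "nat \<Rightarrow> obs set" where
  "obs_set n = Train ` {1..n} \<union> Test ` {1..n}"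

definition train_data ::
  "nat \<Rightarrow> (obs \<Rightarrow> 'a \<Rightarrow> 'x) \<Rightarrow> (obs \<Rightarrow> 'a \<Rightarrow> real^'p) \<Rightarrow> 'a \<Rightarrow> nat \<Rightarrow> 'x \<times> (real^'p)" where
  "train_data n X Y \<omega> = (\<lambda>i\<in>{1..n}. (X (Train i) \<omega>, Y (Train i) \<omega>))"

definition test_data ::
  "nat \<Rightarrow> (obs \<Rightarrow> 'a \<Rightarrow> 'x) \<Rightarrow> (obs \<Rightarrow> 'a \<Rightarrow> real^'p) \<Rightarrow> 'a \<Rightarrow> nat \<Rightarrow> 'x \<times> (real^'p)" where
  "test_data n X Y \<omega> = (\<lambda>i\<in>{1..n}. (X (Test i) \<omega>, Y (Test i) \<omega>))"

definition true_model ::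
  "'a measure \<Rightarrow> nat \<Rightarrow> ('x::euclidean_space \<Rightarrow> real^'p^'p) \<Rightarrow> (obs \<Rightarrow> 'a \<Rightarrow> 'x) \<Rightarrow>
   (obs \<Rightarrow> 'a \<Rightarrow> real^'p) \<Rightarrow> bool" where
  "true_model M n C X Y \<longleftrightarrow>
     C \<in> borel_measurable borel \<and> (\<forall>x. posdef_matrix (C x)) \<and>
     (\<forall>\<alpha>\<in>obs_set n. X \<alpha> \<in> borel_measurable M \<and> Y \<alpha> \<in> borel_measurable M \<and>
        (AE \<omega> in M. cond_cov M (generated M (obs_set n) X) (Y \<alpha>) \<omega> = C (X \<alpha> \<omega>)))"

definition data_generating ::
  "'a measure \<Rightarrow> nat \<Rightarrow> ('x::euclidean_space \<Rightarrow> real^'p^'p) \<Rightarrow> (obs \<Rightarrow> 'a \<Rightarrow> 'x) \<Rightarrow>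
   (obs \<Rightarrow> 'a \<Rightarrow> real^'p) \<Rightarrow> (obs \<Rightarrow> 'a \<Rightarrow> real^'p) \<Rightarrow> real \<Rightarrow> bool" where
  "data_generating M n C X Y \<E> \<mu>4 \<longleftrightarrow>
     (\<forall>\<alpha>\<in>obs_set n. \<forall>\<omega>\<in>space M. Y \<alpha> \<omega> = matrix_sqrt (C (X \<alpha> \<omega>)) *v \<E> \<alpha> \<omega>) \<and>
     (\<forall>\<alpha>\<in>obs_set n. prob_space.indep_set M
        (sets (generated M {\<alpha>} \<E>)) (sets (generated M (obs_set n) X))) \<and>
     iid M (obs_set n \<times> UNIV) (\<lambda>(\<alpha>, j) \<omega>. \<E> \<alpha> \<omega> $ j) \<and>
     (\<forall>\<alpha>\<in>obs_set n. \<forall>j.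
        (\<integral>\<omega>. \<E> \<alpha> \<omega> $ j \<partial>M) = 0 \<and>
        (\<integral>\<omega>. (\<E> \<alpha> \<omega> $ j)^2 \<partial>M) = 1 \<and>
        (\<integral>\<omega>. (\<E> \<alpha> \<omega> $ j)^4 \<partial>M) = \<mu>4) \<and>
     (\<exists>\<eta>>0. \<forall>\<alpha>\<in>obs_set n. \<forall>j. integrable M (\<lambda>\<omega>. \<bar>\<E> \<alpha> \<omega> $ j\<bar> powr (4 + \<eta>)))"

section \<open>Settings\<close>

definition fixed_X :: "'a measure \<Rightarrow> nat \<Rightarrow> (nat \<Rightarrow> 'x) \<Rightarrow> (obs \<Rightarrow> 'a \<Rightarrow> 'x) \<Rightarrow> bool" where
  "fixed_X M n x X \<longleftrightarrow>
     (\<forall>i\<in>{1..n}. \<forall>\<omega>\<in>space M. X (Train i) \<omega> = x i \<and> X (Test i) \<omega> = x i)"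

definition random_X ::
  "'a measure \<Rightarrow> nat \<Rightarrow> (obs \<Rightarrow> 'a \<Rightarrow> 'x::euclidean_space) \<Rightarrow> (obs \<Rightarrow> 'a \<Rightarrow> real^'p) \<Rightarrow> bool" where
  "random_X M n X Y \<longleftrightarrow> iid M (obs_set n) (\<lambda>\<alpha> \<omega>. (X \<alpha> \<omega>, Y \<alpha> \<omega>))"

text \<open>In the last clause, conditionally on the training data the \<open>Y (Test i)\<close> are independent and
  \<open>Y (Test i)\<close> has the conditional distribution of \<open>Y (Train i)\<close> given \<open>X (Train i)\<close>.\<close>

definition same_X ::
  "'a measure \<Rightarrow> nat \<Rightarrow> (obs \<Rightarrow> 'a \<Rightarrow> 'x::euclidean_space) \<Rightarrow> (obs \<Rightarrow> 'a \<Rightarrow> real^'p) \<Rightarrow> bool" where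
  "same_X M n X Y \<longleftrightarrow>
     iid M (Train ` {1..n}) (\<lambda>\<alpha> \<omega>. (X \<alpha> \<omega>, Y \<alpha> \<omega>)) \<and>
     (\<forall>i\<in>{1..n}. \<forall>\<omega>\<in>space M. X (Test i) \<omega> = X (Train i) \<omega>) \<and>
     (\<forall>A. (\<forall>i\<in>{1..n}. A i \<in> sets borel) \<longrightarrow>
       (AE \<omega> in M.
          real_cond_exp M (generated M (Train ` {1..n}) (\<lambda>\<alpha> \<omega>. (X \<alpha> \<omega>, Y \<alpha> \<omega>)))
            (\<lambda>\<omega>'. \<Prod>i=1..n. indicator (A i) (Y (Test i) \<omega>')) \<omega> =
          (\<Prod>i=1..n. real_cond_exp M (generated M {Train i} X)
            (\<lambda>\<omega>'. indicator (A i) (Y (Train i) \<omega>')) \<omega>)))"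

section \<open>Fitted model\<close>

definition quasi_loglik ::
  "nat \<Rightarrow> (real^'k \<Rightarrow> 'x \<Rightarrow> real^'p^'p) \<Rightarrow> (nat \<Rightarrow> 'x \<times> (real^'p)) \<Rightarrow> real^'k \<Rightarrow> real" where
  "quasi_loglik n Cm d \<beta> =
     - (real n * real CARD('p) / 2) * ln (2 * pi)
     - 1/2 * (\<Sum>i=1..n. ln (det (Cm \<beta> (fst (d i)))))
     - 1/2 * (\<Sum>i=1..n. snd (d i) \<bullet> (matrix_inv (Cm \<beta> (fst (d i))) *v snd (d i)))"

definition wls_criterion ::
  "nat \<Rightarrow> ('x \<Rightarrow> real^('p \<times> 'p)^('p \<times> 'p)) \<Rightarrow> (real^'k \<Rightarrow> 'x \<Rightarrow> real^'p^'p) \<Rightarrow>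
   (nat \<Rightarrow> 'x \<times> (real^'p)) \<Rightarrow> real^'k \<Rightarrow> real" where
  "wls_criterion n W Cm d \<beta> = 1 / real n * (\<Sum>i=1..n.
     let r = vec_mat (outer (snd (d i))) - vec_mat (Cm \<beta> (fst (d i)))
     in r \<bullet> (W (fst (d i)) *v r))"

definition fitted_model ::
  "'a measure \<Rightarrow> nat \<Rightarrow> ('x::euclidean_space \<Rightarrow> real^('p \<times> 'p)^('p \<times> 'p)) \<Rightarrow>
   (real^'k \<Rightarrow> 'x \<Rightarrow> real^'p^'p) \<Rightarrow> ((nat \<Rightarrow> 'x \<times> (real^'p)) \<Rightarrow> real^'k) \<Rightarrow>
   (obs \<Rightarrow> 'a \<Rightarrow> 'x) \<Rightarrow> (obs \<Rightarrow> 'a \<Rightarrow> real^'p) \<Rightarrow> bool" where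
  "fitted_model M n W Cm bhat X Y \<longleftrightarrow>
     W \<in> borel_measurable borel \<and> (\<forall>x. possemidef_matrix (W x)) \<and>
     (\<lambda>(\<beta>, x). Cm \<beta> x) \<in> borel_measurable (borel \<Otimes>\<^sub>M borel) \<and> (\<forall>\<beta> x. posdef_matrix (Cm \<beta> x)) \<and>
     bhat \<in> borel_measurable (Pi\<^sub>M {1..n} (\<lambda>_. borel)) \<and>
     ((AE \<omega> in M. is_arg_max (quasi_loglik n Cm (train_data n X Y \<omega>)) (\<lambda>_. True)
                     (bhat (train_data n X Y \<omega>))) \<or>
      (AE \<omega> in M. is_arg_min (wls_criterion n W Cm (train_data n X Y \<omega>)) (\<lambda>_. True)
                     (bhat (train_data n X Y \<omega>))))"

text \<open>The value of the estimator does not depend on how the training sample is numbered. Both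
  criteria are invariant under renumbering, so this only restricts the choice among several
  optimal parameters.\<close>

definition numbering_invariant ::
  "'a measure \<Rightarrow> nat \<Rightarrow> ((nat \<Rightarrow> 'x \<times> (real^'p)) \<Rightarrow> real^'k) \<Rightarrow>
   (obs \<Rightarrow> 'a \<Rightarrow> 'x) \<Rightarrow> (obs \<Rightarrow> 'a \<Rightarrow> real^'p) \<Rightarrow> bool" where
  "numbering_invariant M n bhat X Y \<longleftrightarrow> (AE \<omega> in M. \<forall>\<pi>. \<pi> permutes {1..n} \<longrightarrow>
     bhat (\<lambda>i\<in>{1..n}. train_data n X Y \<omega> (\<pi> i)) = bhat (train_data n X Y \<omega>))"

definition C_weighted ::
  "('x \<Rightarrow> real^('p \<times> 'p)^('p \<times> 'p)) \<Rightarrow> ('x \<Rightarrow> real^'p^'p) \<Rightarrow> 'x \<Rightarrow> real^('p \<times> 'p)" where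
  "C_weighted W C x = matrix_sqrt (W x) *v vec_mat (C x)"

definition C_hat_weighted ::
  "nat \<Rightarrow> ('x \<Rightarrow> real^('p \<times> 'p)^('p \<times> 'p)) \<Rightarrow> (real^'k \<Rightarrow> 'x \<Rightarrow> real^'p^'p) \<Rightarrow>
   ((nat \<Rightarrow> 'x \<times> (real^'p)) \<Rightarrow> real^'k) \<Rightarrow> (obs \<Rightarrow> 'a \<Rightarrow> 'x) \<Rightarrow> (obs \<Rightarrow> 'a \<Rightarrow> real^'p) \<Rightarrow>
   'a \<Rightarrow> 'x \<Rightarrow> real^('p \<times> 'p)" where
  "C_hat_weighted n W Cm bhat X Y \<omega> x =
     matrix_sqrt (W x) *v vec_mat (Cm (bhat (train_data n X Y \<omega>)) x)"

section \<open>Test error\<close>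

definition test_error ::
  "nat \<Rightarrow> ('x \<Rightarrow> real^('p \<times> 'p)^('p \<times> 'p)) \<Rightarrow> (real^'k \<Rightarrow> 'x \<Rightarrow> real^'p^'p) \<Rightarrow>
   ((nat \<Rightarrow> 'x \<times> (real^'p)) \<Rightarrow> real^'k) \<Rightarrow>
   (nat \<Rightarrow> 'x \<times> (real^'p)) \<Rightarrow> (nat \<Rightarrow> 'x \<times> (real^'p)) \<Rightarrow> real" where
  "test_error n W Cm bhat d0 d = 1 / real n * (\<Sum>i=1..n.
     let r = vec_mat (outer (snd (d0 i))) - vec_mat (Cm (bhat d) (fst (d0 i)))
     in r \<bullet> (W (fst (d0 i)) *v r))"

definition Te ::
  "nat \<Rightarrow> ('x \<Rightarrow> real^('p \<times> 'p)^('p \<times> 'p)) \<Rightarrow> (real^'k \<Rightarrow> 'x \<Rightarrow> real^'p^'p) \<Rightarrow>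
   ((nat \<Rightarrow> 'x \<times> (real^'p)) \<Rightarrow> real^'k) \<Rightarrow> (obs \<Rightarrow> 'a \<Rightarrow> 'x) \<Rightarrow> (obs \<Rightarrow> 'a \<Rightarrow> real^'p) \<Rightarrow>
   'a \<Rightarrow> real" where
  "Te n W Cm bhat X Y \<omega> = test_error n W Cm bhat (test_data n X Y \<omega>) (train_data n X Y \<omega>)"

definition Err ::
  "'a measure \<Rightarrow> nat \<Rightarrow> ('x \<Rightarrow> real^('p \<times> 'p)^('p \<times> 'p)) \<Rightarrow> (real^'k \<Rightarrow> 'x \<Rightarrow> real^'p^'p) \<Rightarrow>
   ((nat \<Rightarrow> 'x \<times> (real^'p)) \<Rightarrow> real^'k) \<Rightarrow> (obs \<Rightarrow> 'a \<Rightarrow> 'x) \<Rightarrow> (obs \<Rightarrow> 'a \<Rightarrow> real^'p) \<Rightarrow> real" where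
  "Err M n W Cm bhat X Y = (\<integral>\<omega>. Te n W Cm bhat X Y \<omega> \<partial>M)"

text \<open>\<open>V\<close> is a function of the explanatory variable with \<open>V(X\<^sub>\<alpha>) = Cov[vec (Y\<^sub>\<alpha> Y\<^sub>\<alpha>\<^sup>T) | X\<^sub>\<alpha>]\<close> for all
  \<open>\<alpha>\<close>. If \<open>X\<^sub>\<alpha>\<close> is constant, the conditioning \<open>\<sigma>\<close>-algebra is trivial and the right-hand side is the
  ordinary covariance matrix.\<close>

definition cond_cov_function ::
  "'a measure \<Rightarrow> nat \<Rightarrow> (obs \<Rightarrow> 'a \<Rightarrow> 'x::euclidean_space) \<Rightarrow> (obs \<Rightarrow> 'a \<Rightarrow> real^'p) \<Rightarrow>
   ('x \<Rightarrow> real^('p \<times> 'p)^('p \<times> 'p)) \<Rightarrow> bool" where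
  "cond_cov_function M n X Y V \<longleftrightarrow> V \<in> borel_measurable borel \<and>
     (\<forall>\<alpha>\<in>obs_set n.
        cond_cov_finite M (generated M {\<alpha>} X) (\<lambda>\<omega>. vec_mat (outer (Y \<alpha> \<omega>))) \<and>
        (AE \<omega> in M. V (X \<alpha> \<omega>) =
           cond_cov M (generated M {\<alpha>} X) (\<lambda>\<omega>'. vec_mat (outer (Y \<alpha> \<omega>'))) \<omega>))"

definition nu2 ::
  "('x \<Rightarrow> real^('p::finite \<times> 'p)^('p \<times> 'p)) \<Rightarrow> ('x \<Rightarrow> real^('p \<times> 'p)^('p \<times> 'p)) \<Rightarrow> 'x \<Rightarrow> real" where
  "nu2 W V x = trace (W x ** V x)"

end

theory Submission
  imports Defs
begin

text \<open>
  Write \<open>R = W\<^sup>1\<^sup>/\<^sup>2\<close> and \<open>S = C\<^sup>1\<^sup>/\<^sup>2\<close>, and fix a test label \<open>0i\<close>. Its contribution to the test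
  error is \<open>\<parallel>R vec(Y\<^sub>0\<^sub>i Y\<^sub>0\<^sub>i\<^sup>T) - R vec(C\<^sub>\<beta>)\<parallel>\<^sup>2\<close> at \<open>X\<^sub>0\<^sub>i\<close>, where \<open>\<beta>\<close> is the estimate. Each of the three
  settings is used through a single consequence: given the training data and \<open>X\<^sub>0\<^sub>i\<close>, the response
  \<open>Y\<^sub>0\<^sub>i\<close> is distributed like \<open>S(X\<^sub>0\<^sub>i) e\<close> with a fresh noise vector \<open>e\<close> (\<open>resampled_test\<close>). With
  training data and \<open>X\<^sub>0\<^sub>i\<close> held fixed, the residual splits into \<open>R (vec(S e e\<^sup>T S) - vec C)\<close>, which is a
  centred function of \<open>e\<close>, and \<open>R vec C - R vec(C\<^sub>\<beta>)\<close>, which does not depend on \<open>e\<close>. Pythagoras gives the sum of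
  the two squared lengths (\<open>noise_pythagoras\<close>), and integration over the training data and \<open>X\<^sub>0\<^sub>i\<close> gives
  \<open>E (noise part) + E (squared error of the fit)\<close>, an identity between integrals of nonnegative functions,
  so that integrability of the test error makes both parts finite (\<open>pred_error_decomposition\<close>).

  The noise part is \<open>\<nu>\<^sup>2\<close>: since \<open>X\<close> and the noise are independent, conditioning on \<open>X\<close> amounts to
  integrating out \<open>e\<close> for fixed \<open>X\<close>, which computes the conditional covariance of \<open>vec(Y Y\<^sup>T)\<close> and hence
  \<open>tr(W V)\<close> (\<open>nu2_eq_noise_var\<close>). The squared error of the fit is a mean square distance from a random
  vector \<open>Z\<close> to a vector known given the conditioning \<open>\<sigma>\<close>-algebra, and splits into squared conditional
  bias and the trace of the conditional covariance (\<open>bias_variance_given_subalgebra\<close>). Here \<open>Z\<close> itself may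
  fail to be integrable; only its distance to the known vector is square integrable.

  For random covariates the labels must finally be shown to contribute equally. In the Random-\<open>X\<close> setting
  \<open>X\<^sub>0\<^sub>i\<close> is independent of the training data with a law that is the same for all \<open>i\<close>. In the Same-\<open>X\<close>
  setting \<open>X\<^sub>0\<^sub>i = X\<^sub>i\<close> is part of the training data; exchanging the observations \<open>1\<close> and \<open>i\<close> preserves
  the law of the training sample and the estimate.
\<close>

section \<open>Square roots of positive semidefinite matrices\<close>

text \<open>A maximizer \<open>v\<close> of the Rayleigh quotient on the unit sphere of \<open>S\<close> is an eigenvector: the quadratic
  form \<open>l \<parallel>x\<parallel>\<^sup>2 - x \<bullet> f x\<close>, with \<open>l\<close> the maximum, is nonnegative on \<open>S\<close> and vanishes at \<open>v\<close>, so its derivative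
  at \<open>v\<close> in the direction \<open>u = l v - f v\<close> is zero, and this derivative is \<open>2 \<parallel>u\<parallel>\<^sup>2\<close>.\<close>

lemma self_adjoint_has_eigenvector:
  fixes f :: "'a::euclidean_space \<Rightarrow> 'a"
  assumes lin: "linear f" and sym: "\<And>x y. f x \<bullet> y = x \<bullet> f y"
    and S: "subspace S" "S \<noteq> {0}" and inv: "\<And>x. x \<in> S \<Longrightarrow> f x \<in> S"
  obtains v l where "v \<in> S" "norm v = 1" "f v = l *\<^sub>R v"
proof -
  interpret linear f by fact
  let ?K = "S \<inter> sphere 0 1"
  obtain w where w: "w \<in> S" "w \<noteq> 0"
    using S subspace_0 by blast
  then have "w /\<^sub>R norm w \<in> ?K"
    using S(1) by (auto simp: subspace_scale)
  then have ne: "?K \<noteq> {}" by blast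
  have comp: "compact ?K"
    by (intro closed_Int_compact closed_subspace S compact_sphere)
  have cont: "continuous_on ?K (\<lambda>x. x \<bullet> f x)"
    by (intro continuous_intros linear_continuous_on linear_conv_bounded_linear[THEN iffD1] lin)
  obtain v where v: "v \<in> S" "norm v = 1" and max: "\<And>y. y \<in> S \<Longrightarrow> norm y = 1 \<Longrightarrow> y \<bullet> f y \<le> v \<bullet> f v"
    using continuous_attains_sup[OF comp ne cont] by auto
  define l where "l = v \<bullet> f v"
  define g where "g x = l * (x \<bullet> x) - x \<bullet> f x" for x
  have g_nonneg: "0 \<le> g x" if "x \<in> S" for x
  proof (cases "x = 0")
    case False
    then have "(x /\<^sub>R norm x) \<bullet> f (x /\<^sub>R norm x) \<le> l"
      unfolding l_def using that S(1) by (intro max) (auto simp: subspace_scale)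
    then have "(x \<bullet> f x) / (norm x)^2 \<le> l"
      by (simp add: scale power2_eq_square divide_simps)
    with False show ?thesis
      by (simp add: g_def field_simps power2_norm_eq_inner)
  qed (simp add: g_def)
  define u where "u = l *\<^sub>R v - f v"
  have u: "u \<in> S"
    using v(1) S(1) inv by (simp add: u_def subspace_diff subspace_scale)
  have expand: "g (v + t *\<^sub>R u) = 2 * t * (u \<bullet> u) + t^2 * g u" for t
  proof -
    have "v \<bullet> v = 1" using v(2) by (simp add: dot_square_norm)
    moreover have "v \<bullet> f u = u \<bullet> f v" by (metis inner_commute sym)
    ultimately show ?thesis
      unfolding g_def u_def[symmetric] add scale
      by (simp add: inner_add_left inner_add_right l_def[symmetric] algebra_simps power2_eq_square)
        (simp add: u_def inner_diff_left inner_diff_right algebra_simps inner_commute)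
  qed
  have "u \<bullet> u = 0"
  proof (rule ccontr)
    assume "u \<bullet> u \<noteq> 0"
    then have pos: "0 < u \<bullet> u" by simp
    \<comment> \<open>A small step against the direction \<open>u\<close>; the denominator exceeds \<open>g u\<close>, which keeps the linear term dominant.\<close>
    define t where "t = - (u \<bullet> u) / (1 + g u)"
    have gu: "0 \<le> g u" using g_nonneg u .
    then have t: "t < 0" using pos by (simp add: t_def field_simps)
    have "0 \<le> g (v + t *\<^sub>R u)"
      using g_nonneg S(1) u v(1) by (simp add: subspace_add subspace_scale)
    then have "0 \<le> t * (2 * (u \<bullet> u) + t * g u)"
      by (simp add: expand power2_eq_square algebra_simps)
    moreover have "t * g u \<ge> - (u \<bullet> u)"
      using gu pos by (simp add: t_def field_simps)
    ultimately show False
      using t pos by (simp add: zero_le_mult_iff)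
  qed
  then have "f v = l *\<^sub>R v" by (simp add: u_def)
  with v that show thesis by blast
qed

text \<open>The spectral theorem, by induction on the dimension: self-adjointness makes the orthogonal complement
  of an eigenvector invariant.\<close>

lemma self_adjoint_eigenbasis:
  fixes f :: "'a::euclidean_space \<Rightarrow> 'a"
  assumes lin: "linear f" and sym: "\<And>x y. f x \<bullet> y = x \<bullet> f y"
    and S: "subspace S" and inv: "\<And>x. x \<in> S \<Longrightarrow> f x \<in> S"
  shows "\<exists>B. finite B \<and> pairwise orthogonal B \<and> (\<forall>b\<in>B. norm b = 1 \<and> (\<exists>l. f b = l *\<^sub>R b)) \<and> span B = S"
  using S inv
proof (induction "dim S" arbitrary: S rule: less_induct)
  case less
  show ?case
  proof (cases "S = {0}")
    case True
    then show ?thesis by (intro exI[of _ "{}"]) auto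
  next
    case False
    obtain v l where v: "v \<in> S" "norm v = 1" "f v = l *\<^sub>R v"
      using self_adjoint_has_eigenvector[OF lin sym less.prems(1) False less.prems(2)] by blast
    define S' where "S' = {x \<in> S. x \<bullet> v = 0}"
    have vv: "v \<bullet> v = 1" using v by (simp add: dot_square_norm)
    have S': "subspace S'"
      using less.prems(1) unfolding S'_def subspace_def by (auto simp: inner_add_left)
    have "v \<notin> S'" using vv by (simp add: S'_def)
    then have "S' \<subset> S" using v S'_def by blast
    then have "dim S' < dim S"
      by (intro dim_psubset) (use S' less.prems(1) in \<open>simp add: span_eq_iff[THEN iffD2]\<close>)
    moreover have "f x \<in> S'" if "x \<in> S'" for x
      using that less.prems(2) by (auto simp: S'_def sym v)
    ultimately obtain B where B: "finite B" "pairwise orthogonal B"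
        "\<forall>b\<in>B. norm b = 1 \<and> (\<exists>l. f b = l *\<^sub>R b)" "span B = S'"
      using less.hyps S' by blast
    have BS: "B \<subseteq> S'" using B(4) span_superset by blast
    have "span (insert v B) = S"
    proof
      have "insert v B \<subseteq> S" using BS v(1) S'_def by auto
      then show "span (insert v B) \<subseteq> S" by (rule span_minimal) (rule less.prems(1))
      show "S \<subseteq> span (insert v B)"
      proof
        fix x assume "x \<in> S"
        then have "x - (x \<bullet> v) *\<^sub>R v \<in> S'"
          using v less.prems(1) vv
          by (auto simp: S'_def subspace_diff subspace_scale inner_diff_left)
        then show "x \<in> span (insert v B)"
          unfolding span_insert B(4) by blast
      qed
    qed
    moreover have "pairwise orthogonal (insert v B)"
      using B(2) BS by (auto simp: pairwise_insert orthogonal_def S'_def inner_commute)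
    ultimately show ?thesis
      using B v by (intro exI[of _ "insert v B"]) auto
  qed
qed

lemma symmetric_matrix_iff:
  fixes A :: "real^'n^'n"
  shows "transpose A = A \<longleftrightarrow> (\<forall>x y. (A *v x) \<bullet> y = x \<bullet> (A *v y))"
proof
  assume "transpose A = A"
  then show "\<forall>x y. (A *v x) \<bullet> y = x \<bullet> (A *v y)"
    by (metis dot_lmul_matrix transpose_matrix_vector)
next
  assume *: "\<forall>x y. (A *v x) \<bullet> y = x \<bullet> (A *v y)"
  have "A $ i $ j = A $ j $ i" for i j
    using *[rule_format, of "axis j 1" "axis i 1"]
    by (simp add: matrix_vector_mul_component inner_axis inner_axis' matrix_vector_mult_basis column_def)
  then show "transpose A = A" by (simp add: transpose_def vec_eq_iff)
qed

lemma possemidef_eigenbasis: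
  fixes A :: "real^'n^'n"
  assumes "possemidef_matrix A"
  shows "\<exists>B l. finite B \<and> pairwise orthogonal B \<and> span B = UNIV \<and>
    (\<forall>b\<in>B. norm b = 1 \<and> A *v b = l b *\<^sub>R b \<and> 0 \<le> l b)"
proof -
  obtain B where B: "finite B" "pairwise orthogonal B"
     "\<forall>b\<in>B. norm b = 1 \<and> (\<exists>l. A *v b = l *\<^sub>R b)" "span B = UNIV"
    using self_adjoint_eigenbasis[of "(*v) A" UNIV] assms
    by (auto simp: symmetric_matrix_iff possemidef_matrix_def)
  then obtain l where l: "\<And>b. b \<in> B \<Longrightarrow> A *v b = l b *\<^sub>R b" by metis
  have "0 \<le> l b" if "b \<in> B" for b
  proof -
    have "0 \<le> b \<bullet> (A *v b)" using assms by (simp add: possemidef_matrix_def)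
    then show ?thesis using B(3) that l by (simp add: dot_square_norm)
  qed
  with B l show ?thesis by blast
qed

text \<open>This pins down any positive semidefinite square root of a matrix on the eigenvectors of that matrix,
  which yields uniqueness. For \<open>l > 0\<close> the vector \<open>w = P v - sqrt l v\<close> satisfies \<open>P w = - sqrt l w\<close>, and a
  positive semidefinite \<open>P\<close> has no negative eigenvalue.\<close>

lemma possemidef_sqrt_eigenvector:
  fixes P :: "real^'n^'n"
  assumes P: "possemidef_matrix P" and v: "(P ** P) *v v = l *\<^sub>R v" and l: "0 \<le> l"
  shows "P *v v = sqrt l *\<^sub>R v"
proof (cases "l = 0")
  case True
  have "(P *v v) \<bullet> (P *v v) = v \<bullet> ((P ** P) *v v)"
    using P by (simp add: possemidef_matrix_def symmetric_matrix_iff matrix_vector_mul_assoc[symmetric])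
  then show ?thesis using True v by simp
next
  case False
  define w where "w = P *v v - sqrt l *\<^sub>R v"
  have "P *v w = - sqrt l *\<^sub>R w"
    using v l by (simp add: w_def matrix_vector_mult_diff_distrib matrix_vector_mul_assoc
        matrix_vector_mult_scaleR scaleR_diff_right)
  moreover have "0 \<le> w \<bullet> (P *v w)" using P by (simp add: possemidef_matrix_def)
  ultimately have "sqrt l * (w \<bullet> w) \<le> 0" by simp
  moreover have "0 < sqrt l" using False l by simp
  ultimately have "w \<bullet> w \<le> 0" by (simp add: mult_le_0_iff)
  then have "w = 0" by (metis inner_eq_zero_iff inner_ge_zero order_antisym)
  then show ?thesis by (simp add: w_def)
qed

lemma possemidef_sqrt_ex:
  fixes A :: "real^'n^'n"
  assumes "possemidef_matrix A"
  shows "\<exists>P. possemidef_matrix P \<and> P ** P = A"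
proof -
  obtain B l where B: "finite B" "pairwise orthogonal B" "span B = UNIV"
    and eig: "\<forall>b\<in>B. norm b = 1 \<and> A *v b = l b *\<^sub>R b \<and> 0 \<le> l b"
    using possemidef_eigenbasis[OF assms] by blast
  define g where "g x = (\<Sum>b\<in>B. (sqrt (l b) * (x \<bullet> b)) *\<^sub>R b)" for x
  have lin: "linear g"
    unfolding g_def by (rule linearI)
      (simp_all add: inner_add_left algebra_simps sum.distrib scaleR_sum_right)
  have gP: "matrix g *v x = g x" for x using lin by (simp add: matrix_works)
  have g_eig: "g b = sqrt (l b) *\<^sub>R b" if "b \<in> B" for b
  proof -
    have "g b = (\<Sum>c\<in>B. if c = b then sqrt (l b) *\<^sub>R b else 0)"
      unfolding g_def using B(2) eig that
      by (intro sum.cong) (auto simp: pairwise_def orthogonal_def dot_square_norm)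
    then show ?thesis using B(1) that by simp
  qed
  have "possemidef_matrix (matrix g)"
    unfolding possemidef_matrix_def symmetric_matrix_iff gP
  proof (intro conjI allI)
    show "g x \<bullet> y = x \<bullet> g y" for x y
      by (simp add: g_def inner_sum_left inner_sum_right inner_commute mult_ac)
    have "x \<bullet> g x = (\<Sum>b\<in>B. sqrt (l b) * (x \<bullet> b)^2)" for x
      by (simp add: g_def inner_sum_right power2_eq_square mult_ac)
    then show "0 \<le> x \<bullet> g x" for x using eig by (simp add: sum_nonneg)
  qed
  moreover have "matrix g ** matrix g = A"
  proof -
    have "(matrix g ** matrix g) *v x = A *v x" for x
    proof (rule linear_eq_on_span[where f = "(*v) (matrix g ** matrix g)" and g = "(*v) A" and B = B])
      show "(matrix g ** matrix g) *v b = A *v b" if "b \<in> B" for b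
        using that eig by (simp add: matrix_vector_mul_assoc[symmetric] gP g_eig linear_scale[OF lin])
    qed (use B(3) in auto)
    then show ?thesis by (simp add: matrix_eq)
  qed
  ultimately show ?thesis by blast
qed

lemma possemidef_sqrt_unique:
  fixes P Q :: "real^'n^'n"
  assumes P: "possemidef_matrix P" and Q: "possemidef_matrix Q"
    and A: "P ** P = A" "Q ** Q = A" "possemidef_matrix A"
  shows "P = Q"
proof -
  obtain B l where B: "span B = UNIV" and eig: "\<forall>b\<in>B. A *v b = l b *\<^sub>R b \<and> 0 \<le> l b"
    using possemidef_eigenbasis[OF A(3)] by blast
  have "P *v x = Q *v x" for x
  proof (rule linear_eq_on_span[where f = "(*v) P" and g = "(*v) Q" and B = B])
    show "P *v b = Q *v b" if "b \<in> B" for b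
      using possemidef_sqrt_eigenvector[OF P, of b "l b"] possemidef_sqrt_eigenvector[OF Q, of b "l b"]
        that A eig by simp
  qed (use B(1) in auto)
  then show ?thesis by (simp add: matrix_eq)
qed

lemma matrix_sqrt_eqI:
  fixes P :: "real^'n^'n"
  assumes "possemidef_matrix P" "P ** P = A" "possemidef_matrix A"
  shows "matrix_sqrt A = P"
  unfolding matrix_sqrt_def using assms possemidef_sqrt_unique by (intro the_equality) auto

lemma
  fixes A :: "real^'n^'n"
  assumes "possemidef_matrix A"
  shows possemidef_matrix_sqrt: "possemidef_matrix (matrix_sqrt A)"
    and matrix_sqrt_square: "matrix_sqrt A ** matrix_sqrt A = A"
  using possemidef_sqrt_ex[OF assms] matrix_sqrt_eqI[OF _ _ assms] by auto

lemma quadratic_form_eq_norm_matrix_sqrt: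
  fixes A :: "real^'n^'n"
  assumes "possemidef_matrix A"
  shows "x \<bullet> (A *v x) = (norm (matrix_sqrt A *v x))^2"
proof -
  have "x \<bullet> (A *v x) = x \<bullet> (matrix_sqrt A *v (matrix_sqrt A *v x))"
    using matrix_sqrt_square[OF assms] by (simp add: matrix_vector_mul_assoc)
  also have "\<dots> = (matrix_sqrt A *v x) \<bullet> (matrix_sqrt A *v x)"
    using possemidef_matrix_sqrt[OF assms] by (metis possemidef_matrix_def symmetric_matrix_iff)
  finally show ?thesis by (simp add: dot_square_norm)
qed

lemma posdef_imp_possemidef: "posdef_matrix A \<Longrightarrow> possemidef_matrix A"
  unfolding posdef_matrix_def possemidef_matrix_def by (metis inner_zero_left less_eq_real_def)

lemma closed_possemidef: "closed {A :: real^'n^'n. possemidef_matrix A}"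
proof -
  have 1: "continuous_on UNIV (\<lambda>A::real^'n^'n. transpose A)"
    by (intro linear_continuous_on linear_conv_bounded_linear[THEN iffD1] linearI)
      (simp_all add: transpose_def vec_eq_iff)
  have 2: "continuous_on UNIV (\<lambda>A::real^'n^'n. x \<bullet> (A *v x))" for x
    by (intro linear_continuous_on linear_conv_bounded_linear[THEN iffD1] linearI)
      (simp_all add: matrix_vector_mult_add_rdistrib inner_add_right scaleR_matrix_vector_assoc[symmetric])
  have "{A :: real^'n^'n. possemidef_matrix A} =
     {A. transpose A = A} \<inter> (\<Inter>x. {A. 0 \<le> x \<bullet> (A *v x)})"
    by (auto simp: possemidef_matrix_def)
  also have "closed \<dots>"
    by (intro closed_Int closed_INT ballI closed_Collect_eq closed_Collect_le 1 2 continuous_intros)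
  finally show ?thesis .
qed

lemma continuous_on_matrix_square: "continuous_on S (\<lambda>A :: real^'n^'n. A ** A)"
  unfolding matrix_matrix_mult_def by (intro continuous_intros continuous_on_vec_lambda)

text \<open>Squaring is a continuous injection on the compact set of positive semidefinite matrices of norm at
  most \<open>k\<close>, so the square root is continuous on the image of this set; the square root is the
  pointwise limit of these restrictions as \<open>k\<close> grows.\<close>

lemma matrix_sqrt_measurable:
  fixes f :: "'a \<Rightarrow> real^'n^'n"
  assumes f[measurable]: "f \<in> borel_measurable N" and psd: "\<And>x. possemidef_matrix (f x)"
  shows "(\<lambda>x. matrix_sqrt (f x)) \<in> borel_measurable N"
proof -
  define K where "K k = {A :: real^'n^'n. possemidef_matrix A} \<inter> cball 0 (real k)" for k
  define L where "L k = (\<lambda>A. A ** A) ` K k" for k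
  have K: "compact (K k)" for k
    unfolding K_def by (intro closed_Int_compact closed_possemidef compact_cball)
  have sq_psd: "possemidef_matrix (A ** A)" if "possemidef_matrix A" for A :: "real^'n^'n"
    using that unfolding possemidef_matrix_def symmetric_matrix_iff
    by (metis inner_ge_zero matrix_vector_mul_assoc)
  have cont: "continuous_on (L k) matrix_sqrt" for k
    unfolding L_def
    by (intro continuous_on_inv continuous_on_matrix_square K ballI matrix_sqrt_eqI)
      (auto simp: K_def sq_psd)
  have "closed (L k)" for k
    unfolding L_def by (intro compact_imp_closed compact_continuous_image continuous_on_matrix_square K)
  then have [measurable]: "L k \<in> sets borel" for k by auto
  define s where "s k A = (if A \<in> L k then matrix_sqrt A else 0)" for k A
  have [measurable]: "s k \<in> borel_measurable borel" for k
    unfolding s_def by (intro borel_measurable_continuous_on_if cont) auto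
  have "(\<lambda>k. s k (f x)) \<longlonglongrightarrow> matrix_sqrt (f x)" for x
  proof (rule tendsto_eventually)
    obtain k0 where k0: "norm (matrix_sqrt (f x)) \<le> real k0" using real_arch_simple by blast
    have "s k (f x) = matrix_sqrt (f x)" if "k0 \<le> k" for k
    proof -
      have "matrix_sqrt (f x) \<in> K k"
        using k0 that possemidef_matrix_sqrt[OF psd] by (auto simp: K_def)
      then have "f x \<in> L k"
        unfolding L_def by (rule image_eqI[rotated]) (simp add: matrix_sqrt_square[OF psd])
      then show ?thesis by (simp add: s_def)
    qed
    then show "\<forall>\<^sub>F k in sequentially. s k (f x) = matrix_sqrt (f x)"
      by (auto simp: eventually_sequentially)
  qed
  then show ?thesis
    by (rule borel_measurable_LIMSEQ_metric[rotated]) measurable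
qed

section \<open>Conditional expectations and the bias-variance identity\<close>

lemma subalgebra_generated:
  assumes "\<And>\<alpha>. \<alpha> \<in> I \<Longrightarrow> Z \<alpha> \<in> borel_measurable M"
  shows "subalgebra M (generated M I Z)"
  unfolding generated_def subalgebra_def
  using assms by (auto simp: in_vimage_algebra sets_vimage_algebra intro!: sets.sigma_sets_subset measurable_sets[of _ M "Pi\<^sub>M I (\<lambda>_. borel)"] measurable_restrict)

lemma measurable_generated:
  assumes "\<alpha> \<in> I"
  shows "Z \<alpha> \<in> borel_measurable (generated M I Z)"
proof -
  have "(\<lambda>\<omega>. (\<lambda>\<alpha>\<in>I. Z \<alpha> \<omega>) \<alpha>) \<in> borel_measurable (generated M I Z)"
    unfolding generated_def
    by (rule measurable_compose[OF measurable_vimage_algebra1 measurable_component_singleton])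
      (use assms in \<open>auto simp: space_PiM\<close>)
  then show ?thesis using assms by simp
qed

lemma space_generated [simp]: "space (generated M I Z) = space M"
  by (simp add: generated_def)

lemma sets_generated_singletonD:
  assumes "A \<in> sets (generated M {\<alpha>} Z)"
  obtains B where "B \<in> sets borel" "A = Z \<alpha> -` B \<inter> space M"
proof -
  have "(\<lambda>\<omega>. \<lambda>\<beta>\<in>{\<alpha>}. Z \<beta> \<omega>) \<in> space M \<rightarrow> space (Pi\<^sub>M {\<alpha>} (\<lambda>_. borel))"
    by (auto simp: space_PiM)
  then obtain P where P: "P \<in> sets (Pi\<^sub>M {\<alpha>} (\<lambda>_. borel))"
    "A = (\<lambda>\<omega>. \<lambda>\<beta>\<in>{\<alpha>}. Z \<beta> \<omega>) -` P \<inter> space M"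
    using assms unfolding generated_def by (auto simp: sets_vimage_algebra2)
  have "(\<lambda>z. \<lambda>\<beta>\<in>{\<alpha>}. z) \<in> borel \<rightarrow>\<^sub>M Pi\<^sub>M {\<alpha>} (\<lambda>_. borel)"
    by (intro measurable_restrict) auto
  from measurable_sets[OF this P(1)] have "(\<lambda>z. \<lambda>\<beta>\<in>{\<alpha>}. z) -` P \<in> sets borel" by simp
  moreover have "A = Z \<alpha> -` ((\<lambda>z. \<lambda>\<beta>\<in>{\<alpha>}. z) -` P) \<inter> space M"
  proof -
    have "(\<lambda>\<beta>\<in>{\<alpha>}. Z \<beta> \<omega>) = (\<lambda>\<beta>\<in>{\<alpha>}. Z \<alpha> \<omega>)" for \<omega> by (rule restrict_ext) simp
    then show ?thesis unfolding P(2) by auto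
  qed
  ultimately show thesis using that by blast
qed

lemma (in prob_space) sigma_finite_subalgebraI:
  assumes "subalgebra M F"
  shows "sigma_finite_subalgebra M F"
proof -
  interpret finite_measure_subalgebra M F by unfold_locales (rule assms)
  show ?thesis by (rule sigma_finite_subalgebra_axioms)
qed

text \<open>Independence of two random elements with values in possibly different types. Formulating it on
  rectangles makes its preservation under measurable maps immediate.\<close>

definition (in prob_space) indep_elements ::
  "'b measure \<Rightarrow> ('a \<Rightarrow> 'b) \<Rightarrow> 'c measure \<Rightarrow> ('a \<Rightarrow> 'c) \<Rightarrow> bool" where
  "indep_elements S X T Y \<longleftrightarrow> X \<in> M \<rightarrow>\<^sub>M S \<and> Y \<in> M \<rightarrow>\<^sub>M T \<and>
     (\<forall>A\<in>sets S. \<forall>B\<in>sets T. prob ((X -` A \<inter> space M) \<inter> (Y -` B \<inter> space M)) =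
        prob (X -` A \<inter> space M) * prob (Y -` B \<inter> space M))"

lemma (in prob_space) indep_elements_if_indep_var:
  assumes "indep_var S X T Y"
  shows "indep_elements S X T Y"
  unfolding indep_elements_def
proof (intro conjI ballI)
  show "X \<in> M \<rightarrow>\<^sub>M S" "Y \<in> M \<rightarrow>\<^sub>M T" using assms by (auto dest: indep_var_rv1 indep_var_rv2)
  fix A B assume "A \<in> sets S" "B \<in> sets T"
  moreover have "(\<lambda>x. (X x, Y x)) -` (A \<times> B) \<inter> space M = (X -` A \<inter> space M) \<inter> (Y -` B \<inter> space M)"
    by auto
  ultimately show "prob ((X -` A \<inter> space M) \<inter> (Y -` B \<inter> space M)) =
        prob (X -` A \<inter> space M) * prob (Y -` B \<inter> space M)"
    using indep_varD[OF assms, of A B] by simp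
qed

lemma (in prob_space) indep_elements_compose:
  assumes "indep_elements S X T Y" and f: "f \<in> S \<rightarrow>\<^sub>M S'" and g: "g \<in> T \<rightarrow>\<^sub>M T'"
  shows "indep_elements S' (\<lambda>\<omega>. f (X \<omega>)) T' (\<lambda>\<omega>. g (Y \<omega>))"
  unfolding indep_elements_def
proof (intro conjI ballI)
  have XY: "X \<in> M \<rightarrow>\<^sub>M S" "Y \<in> M \<rightarrow>\<^sub>M T" using assms(1) by (auto simp: indep_elements_def)
  show "(\<lambda>\<omega>. f (X \<omega>)) \<in> M \<rightarrow>\<^sub>M S'" "(\<lambda>\<omega>. g (Y \<omega>)) \<in> M \<rightarrow>\<^sub>M T'"
    using measurable_compose[OF XY(1) f] measurable_compose[OF XY(2) g] .
  fix A B assume "A \<in> sets S'" "B \<in> sets T'"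
  then have "f -` A \<inter> space S \<in> sets S" "g -` B \<inter> space T \<in> sets T"
    using measurable_sets[OF f] measurable_sets[OF g] by auto
  moreover have eq: "(\<lambda>\<omega>. f (X \<omega>)) -` A \<inter> space M = X -` (f -` A \<inter> space S) \<inter> space M"
    "(\<lambda>\<omega>. g (Y \<omega>)) -` B \<inter> space M = Y -` (g -` B \<inter> space T) \<inter> space M"
    using measurable_space[OF XY(1)] measurable_space[OF XY(2)] by auto
  ultimately show "prob (((\<lambda>\<omega>. f (X \<omega>)) -` A \<inter> space M) \<inter> ((\<lambda>\<omega>. g (Y \<omega>)) -` B \<inter> space M)) =
        prob ((\<lambda>\<omega>. f (X \<omega>)) -` A \<inter> space M) * prob ((\<lambda>\<omega>. g (Y \<omega>)) -` B \<inter> space M)"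
    using assms(1) unfolding indep_elements_def eq by blast
qed

lemma (in prob_space) distr_indep_elements:
  assumes "indep_elements S X T Y"
  shows "distr M S X \<Otimes>\<^sub>M distr M T Y = distr M (S \<Otimes>\<^sub>M T) (\<lambda>\<omega>. (X \<omega>, Y \<omega>))"
proof -
  have [measurable]: "X \<in> M \<rightarrow>\<^sub>M S" "Y \<in> M \<rightarrow>\<^sub>M T" using assms by (auto simp: indep_elements_def)
  interpret S: prob_space "distr M S X" by (rule prob_space_distr) simp
  interpret T: prob_space "distr M T Y" by (rule prob_space_distr) simp
  show ?thesis
  proof (rule pair_measure_eqI)
    fix A B assume "A \<in> sets (distr M S X)" "B \<in> sets (distr M T Y)"
    then have [measurable]: "A \<in> sets S" "B \<in> sets T" by auto
    have "emeasure (distr M (S \<Otimes>\<^sub>M T) (\<lambda>\<omega>. (X \<omega>, Y \<omega>))) (A \<times> B) =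
        emeasure M ((X -` A \<inter> space M) \<inter> (Y -` B \<inter> space M))"
      by (subst emeasure_distr) (auto intro!: arg_cong[where f = "emeasure M"])
    then show "emeasure (distr M S X) A * emeasure (distr M T Y) B =
        emeasure (distr M (S \<Otimes>\<^sub>M T) (\<lambda>\<omega>. (X \<omega>, Y \<omega>))) (A \<times> B)"
      using assms by (simp add: emeasure_distr emeasure_eq_measure indep_elements_def ennreal_mult)
  qed (auto intro: S.sigma_finite_measure_axioms T.sigma_finite_measure_axioms)
qed

lemma (in prob_space) indep_elements_nn_integral:
  assumes "indep_elements S X T Y" and [measurable]: "f \<in> borel_measurable (S \<Otimes>\<^sub>M T)"
  shows "(\<integral>\<^sup>+\<omega>. f (X \<omega>, Y \<omega>) \<partial>M) = (\<integral>\<^sup>+\<omega>. \<integral>\<^sup>+y. f (X \<omega>, y) \<partial>distr M T Y \<partial>M)"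
proof -
  have [measurable]: "X \<in> M \<rightarrow>\<^sub>M S" "Y \<in> M \<rightarrow>\<^sub>M T" using assms(1) by (auto simp: indep_elements_def)
  interpret T: prob_space "distr M T Y" by (rule prob_space_distr) simp
  have "(\<integral>\<^sup>+\<omega>. f (X \<omega>, Y \<omega>) \<partial>M) = (\<integral>\<^sup>+z. f z \<partial>distr M (S \<Otimes>\<^sub>M T) (\<lambda>x. (X x, Y x)))"
    by (subst nn_integral_distr) auto
  also have "\<dots> = (\<integral>\<^sup>+z. f z \<partial>(distr M S X \<Otimes>\<^sub>M distr M T Y))"
    by (simp add: distr_indep_elements[OF assms(1)])
  also have "\<dots> = (\<integral>\<^sup>+x. \<integral>\<^sup>+y. f (x, y) \<partial>distr M T Y \<partial>distr M S X)"
    by (subst T.nn_integral_fst[symmetric]) auto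
  also have "\<dots> = (\<integral>\<^sup>+\<omega>. \<integral>\<^sup>+y. f (X \<omega>, y) \<partial>distr M T Y \<partial>M)"
    by (subst nn_integral_distr) auto
  finally show ?thesis .
qed

text \<open>By Fubini for the product law of \<open>X \<alpha>\<close> and \<open>e\<close>: conditioning on \<open>X \<alpha>\<close> integrates out \<open>e\<close> with
  \<open>X \<alpha>\<close> held fixed. For nonnegative \<open>h\<close> this covers infinite values as well, so the real version below
  also applies when \<open>h (X \<alpha>, e)\<close> has infinite mean.\<close>

lemma (in prob_space) nn_cond_exp_generated_indep:
  assumes indep: "indep_elements borel (X \<alpha>) N e" and h[measurable]: "h \<in> borel_measurable (borel \<Otimes>\<^sub>M N)"
  shows "AE \<omega> in M. nn_cond_exp M (generated M {\<alpha>} X) (\<lambda>\<omega>. h (X \<alpha> \<omega>, e \<omega>)) \<omega> =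
    (\<integral>\<^sup>+y. h (X \<alpha> \<omega>, y) \<partial>distr M N e)"
proof -
  let ?F = "generated M {\<alpha>} X"
  have [measurable]: "X \<alpha> \<in> borel_measurable M" "e \<in> M \<rightarrow>\<^sub>M N"
    using indep by (auto simp: indep_elements_def)
  interpret sigma_finite_subalgebra M ?F
    by (intro sigma_finite_subalgebraI subalgebra_generated) simp
  interpret T: prob_space "distr M N e" by (rule prob_space_distr) simp
  have XF: "X \<alpha> \<in> borel_measurable ?F" by (rule measurable_generated) simp
  have "AE \<omega> in M. (\<integral>\<^sup>+y. h (X \<alpha> \<omega>, y) \<partial>distr M N e) = nn_cond_exp M ?F (\<lambda>\<omega>. h (X \<alpha> \<omega>, e \<omega>)) \<omega>"
  proof (rule nn_cond_exp_charact)
    fix A assume "A \<in> sets ?F"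
    then obtain B where B[measurable]: "B \<in> sets borel" and A: "A = X \<alpha> -` B \<inter> space M"
      by (rule sets_generated_singletonD)
    have "(\<integral>\<^sup>+\<omega>\<in>A. h (X \<alpha> \<omega>, e \<omega>) \<partial>M) = (\<integral>\<^sup>+\<omega>. (\<lambda>(x, y). indicator B x * h (x, y)) (X \<alpha> \<omega>, e \<omega>) \<partial>M)"
      by (intro nn_integral_cong) (auto simp: A split: split_indicator)
    also have "\<dots> = (\<integral>\<^sup>+\<omega>. \<integral>\<^sup>+y. (\<lambda>(x, y). indicator B x * h (x, y)) (X \<alpha> \<omega>, y) \<partial>distr M N e \<partial>M)"
      by (rule indep_elements_nn_integral[OF indep]) simp
    also have "\<dots> = (\<integral>\<^sup>+\<omega>. indicator B (X \<alpha> \<omega>) * (\<integral>\<^sup>+y. h (X \<alpha> \<omega>, y) \<partial>distr M N e) \<partial>M)"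
      by (simp add: nn_integral_cmult)
    also have "\<dots> = (\<integral>\<^sup>+\<omega>\<in>A. (\<integral>\<^sup>+y. h (X \<alpha> \<omega>, y) \<partial>distr M N e) \<partial>M)"
      by (intro nn_integral_cong) (auto simp: A split: split_indicator)
    finally show "(\<integral>\<^sup>+\<omega>\<in>A. h (X \<alpha> \<omega>, e \<omega>) \<partial>M) = (\<integral>\<^sup>+\<omega>\<in>A. (\<integral>\<^sup>+y. h (X \<alpha> \<omega>, y) \<partial>distr M N e) \<partial>M)" .
  next
    have "(\<lambda>x. \<integral>\<^sup>+y. h (x, y) \<partial>distr M N e) \<in> borel_measurable borel" by measurable
    from measurable_compose[OF XF this]
    show "(\<lambda>\<omega>. \<integral>\<^sup>+y. h (X \<alpha> \<omega>, y) \<partial>distr M N e) \<in> borel_measurable ?F" .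
  qed measurable
  then show ?thesis by auto
qed

lemma (in prob_space) real_cond_exp_generated_indep:
  fixes h :: "'x::topological_space \<times> 'b \<Rightarrow> real"
  assumes indep: "indep_elements borel (X \<alpha>) N e" and h[measurable]: "h \<in> borel_measurable (borel \<Otimes>\<^sub>M N)"
    and int: "\<And>x. integrable (distr M N e) (\<lambda>y. h (x, y))"
  shows "AE \<omega> in M. real_cond_exp M (generated M {\<alpha>} X) (\<lambda>\<omega>. h (X \<alpha> \<omega>, e \<omega>)) \<omega> =
    (\<integral>y. h (X \<alpha> \<omega>, y) \<partial>distr M N e)"
  using nn_cond_exp_generated_indep[where X = X and \<alpha> = \<alpha> and h = "\<lambda>z. ennreal (h z)", OF indep, simplified]
    nn_cond_exp_generated_indep[where X = X and \<alpha> = \<alpha> and h = "\<lambda>z. ennreal (- h z)", OF indep, simplified]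
  by eventually_elim (simp add: real_cond_exp_def real_lebesgue_integral_def[OF int])

text \<open>Even if \<open>Z\<close> and \<open>c\<close> have infinite mean, \<open>g = Z - c\<close> is integrable, and \<open>m = c + E[g | F]\<close> follows by
  restricting to the events \<open>\<bar>c\<bar> \<le> N\<close>, which belong to \<open>F\<close> and exhaust the space. What
  remains is that \<open>E[g | F]\<close> is the orthogonal projection of \<open>g\<close> in \<open>L\<^sup>2\<close>.\<close>

lemma (in prob_space) real_bias_variance:
  fixes Z c :: "'a \<Rightarrow> real"
  assumes F: "subalgebra M F" and c[measurable]: "c \<in> borel_measurable F"
    and Z[measurable]: "Z \<in> borel_measurable M"
    and int: "integrable M (\<lambda>\<omega>. (Z \<omega> - c \<omega>)^2)"
  defines "m \<equiv> real_cond_exp M F Z"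
  shows "integrable M (\<lambda>\<omega>. (m \<omega> - c \<omega>)^2)"
    and "integrable M (real_cond_exp M F (\<lambda>\<omega>. (Z \<omega> - m \<omega>) * (Z \<omega> - m \<omega>)))"
    and "(\<integral>\<omega>. (Z \<omega> - c \<omega>)^2 \<partial>M) = (\<integral>\<omega>. (m \<omega> - c \<omega>)^2 \<partial>M) +
           (\<integral>\<omega>. real_cond_exp M F (\<lambda>\<omega>. (Z \<omega> - m \<omega>) * (Z \<omega> - m \<omega>)) \<omega> \<partial>M)"
proof -
  interpret sigma_finite_subalgebra M F by (rule sigma_finite_subalgebraI[OF F])
  have [measurable]: "c \<in> borel_measurable M" using measurable_from_subalg[OF F c] .
  define g where "g \<omega> = Z \<omega> - c \<omega>" for \<omega>
  have [measurable]: "g \<in> borel_measurable M" unfolding g_def by measurable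
  have int_g2: "integrable M (\<lambda>\<omega>. (g \<omega>)^2)" using int by (simp add: g_def)
  have int_g: "integrable M g" by (rule square_integrable_imp_integrable[OF _ int_g2]) simp
  define d where "d = real_cond_exp M F g"
  have [measurable]: "d \<in> borel_measurable M" "d \<in> borel_measurable F" "m \<in> borel_measurable M"
    by (simp_all add: d_def m_def)
  have md: "AE \<omega> in M. m \<omega> = c \<omega> + d \<omega>"
  proof -
    have "AE \<omega> in M. indicator {x \<in> space F. \<bar>c x\<bar> \<le> real N} \<omega> * m \<omega> =
        indicator {x \<in> space F. \<bar>c x\<bar> \<le> real N} \<omega> * (c \<omega> + d \<omega>)" for N
    proof -
      let ?A = "{x \<in> space F. \<bar>c x\<bar> \<le> real N}"
      have AF[measurable]: "?A \<in> sets F" by measurable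
      then have AM[measurable]: "?A \<in> sets M" using F by (auto simp: subalgebra_def)
      have ic: "integrable M (\<lambda>\<omega>. indicator ?A \<omega> * c \<omega>)"
        by (rule integrable_const_bound[where B = N]) (auto split: split_indicator)
      have ig: "integrable M (\<lambda>\<omega>. indicator ?A \<omega> * g \<omega>)"
        using integrable_mult_indicator[OF AM int_g] by simp
      have eq: "(\<lambda>\<omega>. indicator ?A \<omega> * Z \<omega>) = (\<lambda>\<omega>. indicator ?A \<omega> * c \<omega> + indicator ?A \<omega> * g \<omega>)"
        by (auto simp: g_def algebra_simps)
      have iZ: "integrable M (\<lambda>\<omega>. indicator ?A \<omega> * Z \<omega>)"
        unfolding eq by (intro Bochner_Integration.integrable_add ic ig)
      have "AE \<omega> in M. real_cond_exp M F (\<lambda>\<omega>. indicator ?A \<omega> * Z \<omega>) \<omega> = indicator ?A \<omega> * m \<omega>"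
        unfolding m_def by (rule real_cond_exp_mult) (use iZ in auto)
      moreover have "AE \<omega> in M. real_cond_exp M F (\<lambda>\<omega>. indicator ?A \<omega> * g \<omega>) \<omega> = indicator ?A \<omega> * d \<omega>"
        unfolding d_def by (rule real_cond_exp_mult) (use ig in auto)
      moreover have "AE \<omega> in M. real_cond_exp M F (\<lambda>\<omega>. indicator ?A \<omega> * c \<omega>) \<omega> = indicator ?A \<omega> * c \<omega>"
        by (rule real_cond_exp_F_meas[OF ic]) measurable
      moreover have "AE \<omega> in M. real_cond_exp M F (\<lambda>\<omega>. indicator ?A \<omega> * c \<omega> + indicator ?A \<omega> * g \<omega>) \<omega>
          = real_cond_exp M F (\<lambda>\<omega>. indicator ?A \<omega> * c \<omega>) \<omega> + real_cond_exp M F (\<lambda>\<omega>. indicator ?A \<omega> * g \<omega>) \<omega>"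
        by (rule real_cond_exp_add[OF ic ig])
      ultimately show ?thesis
        unfolding eq by eventually_elim (simp add: algebra_simps)
    qed
    then have "AE \<omega> in M. \<forall>N. indicator {x \<in> space F. \<bar>c x\<bar> \<le> real N} \<omega> * m \<omega> =
        indicator {x \<in> space F. \<bar>c x\<bar> \<le> real N} \<omega> * (c \<omega> + d \<omega>)"
      unfolding AE_all_countable by blast
    with AE_space show ?thesis
    proof eventually_elim
      case (elim \<omega>)
      obtain N where "\<bar>c \<omega>\<bar> \<le> real N" using real_arch_simple by blast
      with elim F show ?case by (auto simp: subalgebra_def dest!: spec[of _ N])
    qed
  qed
  have int_d2: "integrable M (\<lambda>\<omega>. (d \<omega>)^2)"
    unfolding d_def
    by (rule integrable_convex_cond_exp[where I = UNIV])
      (use int_g int_g2 convex_power2 emeasure_space_1 in auto)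
  have int_dg: "integrable M (\<lambda>\<omega>. d \<omega> * g \<omega>)"
  proof (rule Bochner_Integration.integrable_bound[OF Bochner_Integration.integrable_add[OF int_d2 int_g2]])
    have "\<bar>x * y\<bar> \<le> x^2 + y^2" for x y :: real
    proof -
      have "0 \<le> (\<bar>x\<bar> - \<bar>y\<bar>)^2" by simp
      then have "2 * \<bar>x * y\<bar> \<le> x^2 + y^2" by (simp add: power2_diff abs_mult)
      then show ?thesis by simp
    qed
    then show "AE \<omega> in M. norm (d \<omega> * g \<omega>) \<le> norm ((d \<omega>)^2 + (g \<omega>)^2)" by simp
  qed measurable
  have dg: "(\<integral>\<omega>. d \<omega> * g \<omega> \<partial>M) = (\<integral>\<omega>. (d \<omega>)^2 \<partial>M)"
    using real_cond_exp_intg(2)[OF int_dg] by (simp add: d_def[symmetric] power2_eq_square)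
  have exp: "(g \<omega> - d \<omega>)^2 = (g \<omega>)^2 - 2 * (d \<omega> * g \<omega>) + (d \<omega>)^2" for \<omega>
    by (simp add: power2_eq_square algebra_simps)
  have int_gd: "integrable M (\<lambda>\<omega>. (g \<omega> - d \<omega>)^2)"
    unfolding exp using int_d2 int_g2 int_dg by auto
  have mc: "AE \<omega> in M. (m \<omega> - c \<omega>)^2 = (d \<omega>)^2" using md by auto
  have Zm: "AE \<omega> in M. (Z \<omega> - m \<omega>) * (Z \<omega> - m \<omega>) = (g \<omega> - d \<omega>)^2"
    using md by eventually_elim (auto simp: g_def power2_eq_square algebra_simps)
  show "integrable M (\<lambda>\<omega>. (m \<omega> - c \<omega>)^2)"
    using int_d2 by (subst integrable_cong_AE[OF _ _ mc]) auto
  have int_var: "integrable M (\<lambda>\<omega>. (Z \<omega> - m \<omega>) * (Z \<omega> - m \<omega>))"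
    using int_gd by (subst integrable_cong_AE[OF _ _ Zm]) auto
  then show "integrable M (real_cond_exp M F (\<lambda>\<omega>. (Z \<omega> - m \<omega>) * (Z \<omega> - m \<omega>)))"
    by (rule real_cond_exp_int)
  have "(\<integral>\<omega>. real_cond_exp M F (\<lambda>\<omega>. (Z \<omega> - m \<omega>) * (Z \<omega> - m \<omega>)) \<omega> \<partial>M) =
      (\<integral>\<omega>. (Z \<omega> - m \<omega>) * (Z \<omega> - m \<omega>) \<partial>M)"
    by (rule real_cond_exp_int(2)[OF int_var])
  also have "\<dots> = (\<integral>\<omega>. (g \<omega> - d \<omega>)^2 \<partial>M)"
    by (rule integral_cong_AE[OF _ _ Zm]) auto
  also have "\<dots> = (\<integral>\<omega>. (g \<omega>)^2 \<partial>M) - (\<integral>\<omega>. (d \<omega>)^2 \<partial>M)"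
    unfolding exp using int_d2 int_g2 int_dg dg by simp
  also have "(\<integral>\<omega>. (d \<omega>)^2 \<partial>M) = (\<integral>\<omega>. (m \<omega> - c \<omega>)^2 \<partial>M)"
    by (rule integral_cong_AE[symmetric, OF _ _ mc]) auto
  finally show "(\<integral>\<omega>. (Z \<omega> - c \<omega>)^2 \<partial>M) = (\<integral>\<omega>. (m \<omega> - c \<omega>)^2 \<partial>M) +
           (\<integral>\<omega>. real_cond_exp M F (\<lambda>\<omega>. (Z \<omega> - m \<omega>) * (Z \<omega> - m \<omega>)) \<omega> \<partial>M)"
    by (simp add: g_def)
qed

lemma norm_power2_vec: "(norm (v :: real^'d))^2 = (\<Sum>i\<in>UNIV. (v $ i)^2)"
  by (simp add: norm_vec_def L2_set_def sum_nonneg)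

lemma borel_measurable_vec_nth_compose [measurable (raw)]:
  fixes f :: "'a \<Rightarrow> 'b::real_normed_vector^'d"
  assumes "f \<in> borel_measurable N"
  shows "(\<lambda>\<omega>. f \<omega> $ i) \<in> borel_measurable N"
  using assms by (rule measurable_compose) (intro borel_measurable_continuous_onI continuous_intros)

lemma (in prob_space) bias_variance_given_subalgebra:
  fixes Z c :: "'a \<Rightarrow> real^'d"
  assumes F: "subalgebra M F" and c[measurable]: "c \<in> borel_measurable F"
    and Z[measurable]: "Z \<in> borel_measurable M"
    and int: "integrable M (\<lambda>\<omega>. (norm (Z \<omega> - c \<omega>))^2)"
  shows "(\<integral>\<omega>. (norm (Z \<omega> - c \<omega>))^2 \<partial>M) =
    (\<integral>\<omega>. (norm (cond_mean M F Z \<omega> - c \<omega>))^2 \<partial>M) + (\<integral>\<omega>. trace (cond_cov M F Z \<omega>) \<partial>M)"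
proof -
  have cF: "(\<lambda>\<omega>. c \<omega> $ i) \<in> borel_measurable F" for i by measurable
  have ZM: "(\<lambda>\<omega>. Z \<omega> $ i) \<in> borel_measurable M" for i by measurable
  have [measurable]: "c \<in> borel_measurable M" using measurable_from_subalg[OF F c] .
  have int_i: "integrable M (\<lambda>\<omega>. (Z \<omega> $ i - c \<omega> $ i)^2)" for i
  proof (rule Bochner_Integration.integrable_bound[OF int])
    show "AE \<omega> in M. norm ((Z \<omega> $ i - c \<omega> $ i)\<^sup>2) \<le> norm ((norm (Z \<omega> - c \<omega>))\<^sup>2)"
    proof (rule AE_I2)
      fix \<omega>
      have "\<bar>Z \<omega> $ i - c \<omega> $ i\<bar> \<le> norm (Z \<omega> - c \<omega>)"
        using component_le_norm_cart[of "Z \<omega> - c \<omega>" i] by simp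
      then have "\<bar>Z \<omega> $ i - c \<omega> $ i\<bar>^2 \<le> (norm (Z \<omega> - c \<omega>))^2"
        by (rule power_mono) simp
      then show "norm ((Z \<omega> $ i - c \<omega> $ i)\<^sup>2) \<le> norm ((norm (Z \<omega> - c \<omega>))\<^sup>2)"
        by simp
    qed
  qed measurable
  note bv = real_bias_variance[OF F cF ZM int_i]
  have "(\<integral>\<omega>. (norm (Z \<omega> - c \<omega>))^2 \<partial>M) = (\<Sum>i\<in>UNIV. \<integral>\<omega>. (Z \<omega> $ i - c \<omega> $ i)^2 \<partial>M)"
    by (simp add: norm_power2_vec int_i)
  also have "\<dots> = (\<Sum>i\<in>UNIV. \<integral>\<omega>. (cond_mean M F Z \<omega> $ i - c \<omega> $ i)^2 \<partial>M) +
      (\<Sum>i\<in>UNIV. \<integral>\<omega>. cond_cov M F Z \<omega> $ i $ i \<partial>M)"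
    by (simp add: sum.distrib[symmetric] cond_cov_def cond_mean_def bv(3))
  also have "(\<Sum>i\<in>UNIV. \<integral>\<omega>. (cond_mean M F Z \<omega> $ i - c \<omega> $ i)^2 \<partial>M) =
      (\<integral>\<omega>. (norm (cond_mean M F Z \<omega> - c \<omega>))^2 \<partial>M)"
    using bv(1) by (simp add: norm_power2_vec cond_mean_def)
  also have "(\<Sum>i\<in>UNIV. \<integral>\<omega>. cond_cov M F Z \<omega> $ i $ i \<partial>M) = (\<integral>\<omega>. trace (cond_cov M F Z \<omega>) \<partial>M)"
    using bv(2) by (simp add: trace_def cond_cov_def cond_mean_def)
  finally show ?thesis .
qed

lemma (in prob_space) bias_variance:
  fixes Z :: "'a \<Rightarrow> real^'d"
  assumes fin: "covariance_finite M Z"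
  shows "(\<integral>\<omega>. (norm (Z \<omega> - c))^2 \<partial>M) = (norm ((\<integral>\<omega>. Z \<omega> \<partial>M) - c))^2 + trace (covariance_matrix M Z)"
proof -
  define m where "m i = (\<integral>\<omega>. Z \<omega> $ i \<partial>M)" for i
  have int: "integrable M (\<lambda>\<omega>. Z \<omega> $ i)" "integrable M (\<lambda>\<omega>. (Z \<omega> $ i - m i)^2)" for i
    using fin by (auto simp: covariance_finite_def m_def power2_eq_square)
  have "integrable M Z"
  proof -
    have "integrable M (\<lambda>\<omega>. \<Sum>i\<in>UNIV. Z \<omega> $ i *\<^sub>R axis i (1::real))"
      using int(1) by auto
    moreover have "(\<Sum>i\<in>UNIV. Z \<omega> $ i *\<^sub>R axis i (1::real)) = Z \<omega>" for \<omega>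
      using basis_expansion[of "Z \<omega>"] by (simp only: scalar_mult_eq_scaleR)
    ultimately show ?thesis by simp
  qed
  then have m: "(\<integral>\<omega>. Z \<omega> \<partial>M) $ i = m i" for i
    unfolding m_def by (rule integral_bounded_linear[OF bounded_linear_vec_nth, symmetric])
  have expand: "(Z \<omega> $ i - c $ i)^2 = (Z \<omega> $ i - m i)^2 + 2 * (m i - c $ i) * (Z \<omega> $ i - m i) + (m i - c $ i)^2"
    for \<omega> i by (simp add: power2_eq_square algebra_simps)
  have ii: "integrable M (\<lambda>\<omega>. (Z \<omega> $ i - c $ i)^2)" for i
    unfolding expand using int by auto
  have "(\<integral>\<omega>. (norm (Z \<omega> - c))^2 \<partial>M) = (\<Sum>i\<in>UNIV. \<integral>\<omega>. (Z \<omega> $ i - c $ i)^2 \<partial>M)"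
    by (simp add: norm_power2_vec ii)
  also have "\<dots> = (\<Sum>i\<in>UNIV. (m i - c $ i)^2 + (\<integral>\<omega>. (Z \<omega> $ i - m i)^2 \<partial>M))"
    unfolding expand using int by (intro sum.cong) (simp_all add: prob_space m_def[symmetric])
  finally show ?thesis
    by (simp add: norm_power2_vec m sum.distrib trace_def covariance_matrix_def m_def[symmetric]
        power2_eq_square[of "_ $ _ - m _"])
qed

section \<open>White noise and squared prediction errors\<close>

lemma borel_measurable_matrix_vector_mult [measurable (raw)]:
  fixes A :: "'a \<Rightarrow> real^'n^'m"
  assumes "A \<in> borel_measurable N" "v \<in> borel_measurable N"
  shows "(\<lambda>x. A x *v v x) \<in> borel_measurable N"
proof (rule borel_measurable_continuous_Pair[OF assms])
  show "continuous_on UNIV (\<lambda>x :: (real^'n^'m) \<times> (real^'n). fst x *v snd x)"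
    unfolding matrix_vector_mult_def by (intro continuous_intros continuous_on_vec_lambda)
qed

lemma borel_measurable_vec_mat [measurable (raw)]:
  assumes "A \<in> borel_measurable N"
  shows "(\<lambda>x. vec_mat (A x)) \<in> borel_measurable N"
  using assms
  by (rule measurable_compose)
    (auto simp: vec_mat_def intro!: borel_measurable_continuous_onI continuous_intros continuous_on_vec_lambda)

lemma borel_measurable_outer [measurable (raw)]:
  assumes "y \<in> borel_measurable N"
  shows "(\<lambda>x. outer (y x)) \<in> borel_measurable N"
  using assms
  by (rule measurable_compose)
    (auto simp: outer_def intro!: borel_measurable_continuous_onI continuous_intros continuous_on_vec_lambda)

lemma borel_measurable_matrix_square [measurable (raw)]:
  fixes A :: "'a \<Rightarrow> real^'n^'n"
  assumes "A \<in> borel_measurable N"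
  shows "(\<lambda>x. A x ** A x) \<in> borel_measurable N"
  using assms
  by (rule measurable_compose) (intro borel_measurable_continuous_onI continuous_on_matrix_square)

text \<open>Laws whose matrix of second moments is the identity. The fourth moment makes the products of two
  coordinates square integrable.\<close>

definition white_noise :: "(real^'p) measure \<Rightarrow> bool" where
  "white_noise P \<longleftrightarrow> prob_space P \<and> sets P = sets borel \<and> integrable P (\<lambda>e. norm e ^ 4) \<and>
     (\<forall>a b. (\<integral>e. e $ a * e $ b \<partial>P) = (if a = b then 1 else 0))"

text \<open>For symmetric \<open>S\<close> and white noise \<open>e\<close> this is the deviation of \<open>vec(Y Y\<^sup>T)\<close>, \<open>Y = S e\<close>, from its mean.\<close>

definition outer_dev :: "real^'p^'p \<Rightarrow> real^'p \<Rightarrow> real^('p \<times> 'p)" where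
  "outer_dev S e = vec_mat (outer (S *v e)) - vec_mat (S ** S)"

definition noise_var :: "(real^'p) measure \<Rightarrow> real^('p \<times> 'p)^('p \<times> 'p) \<Rightarrow> real^'p^'p \<Rightarrow> real" where
  "noise_var P R S = (\<integral>e. (norm (R *v outer_dev S e))^2 \<partial>P)"

lemma borel_measurable_outer_dev [measurable (raw)]:
  assumes [measurable]: "S \<in> borel_measurable N" "e \<in> borel_measurable N"
  shows "(\<lambda>x. outer_dev (S x) (e x)) \<in> borel_measurable N"
  unfolding outer_dev_def by measurable

lemma white_noise_integrable_bound:
  fixes f :: "real^'p \<Rightarrow> real"
  assumes P: "white_noise P" and f: "f \<in> borel_measurable borel"
    and bound: "\<And>e. \<bar>f e\<bar> \<le> K * (1 + norm e ^ 4)"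
  shows "integrable P f"
proof -
  interpret prob_space P using P by (simp add: white_noise_def)
  have [measurable_cong]: "sets P = sets borel" using P by (simp add: white_noise_def)
  have "integrable P (\<lambda>e. K * (1 + norm e ^ 4))"
    using P by (simp add: white_noise_def)
  then show ?thesis
    by (rule Bochner_Integration.integrable_bound) (use f bound in \<open>auto intro: order_trans[OF _ abs_ge_self]\<close>)
qed

lemma norm_vec_mat_outer: "norm (vec_mat (outer y)) = (norm y)^2"
proof -
  have "(norm (vec_mat (outer y)))^2 = (\<Sum>k\<in>UNIV. (y $ fst k)^2 * (y $ snd k)^2)"
    by (simp add: norm_power2_vec vec_mat_def outer_def power_mult_distrib)
  also have "\<dots> = (\<Sum>i\<in>UNIV. \<Sum>j\<in>UNIV. (y $ i)^2 * (y $ j)^2)"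
    by (simp add: sum.cartesian_product split_def)
  also have "\<dots> = ((norm y)^2)^2"
    by (simp add: norm_power2_vec power2_eq_square[of "sum _ _"] sum_product)
  finally show ?thesis by (rule power2_eq_imp_eq) simp_all
qed

lemma norm_outer_dev_le:
  obtains K where "0 \<le> K" "\<And>e. norm (outer_dev S e) \<le> K * (1 + (norm e)^2)"
proof -
  obtain L where L: "\<And>e. norm (S *v e) \<le> norm e * L"
    using bounded_linear.bounded[OF matrix_vector_mul_bounded_linear[of S]] by blast
  define K where "K = L^2 + norm (vec_mat (S ** S))"
  show thesis
  proof
    show "0 \<le> K" by (simp add: K_def)
    fix e
    have "norm (outer_dev S e) \<le> (norm (S *v e))^2 + norm (vec_mat (S ** S))"
      unfolding outer_dev_def using norm_triangle_ineq4 norm_vec_mat_outer by metis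
    also have "(norm (S *v e))^2 \<le> (norm e * L)^2" by (intro power_mono L) simp
    also have "(norm e * L)^2 + norm (vec_mat (S ** S)) \<le> K * (1 + (norm e)^2)"
      by (simp add: K_def algebra_simps power_mult_distrib)
    finally show "norm (outer_dev S e) \<le> K * (1 + (norm e)^2)" by simp
  qed
qed

lemma sq_le_one_plus_fourth: "(1 + x^2)^2 \<le> 2 * (1 + x^4)" for x :: real
proof -
  have "0 \<le> (1 - x^2)^2" by simp
  then show ?thesis by (simp add: power2_eq_square power4_eq_xxxx algebra_simps)
qed

lemma integrable_outer_dev_norm_square:
  assumes P: "white_noise P"
  shows "integrable P (\<lambda>e. (norm (outer_dev S e))^2)"
proof -
  obtain K where K: "0 \<le> K" "\<And>e. norm (outer_dev S e) \<le> K * (1 + (norm e)^2)"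
    using norm_outer_dev_le[of S] by blast
  show ?thesis
  proof (rule white_noise_integrable_bound[OF P])
    fix e
    have "(norm (outer_dev S e))^2 \<le> (K * (1 + (norm e)^2))^2" by (intro power_mono K) simp
    also have "\<dots> \<le> K^2 * (2 * (1 + norm e ^ 4))"
      unfolding power_mult_distrib by (intro mult_left_mono sq_le_one_plus_fourth) simp
    finally show "\<bar>(norm (outer_dev S e))^2\<bar> \<le> (2 * K^2) * (1 + norm e ^ 4)" by (simp add: algebra_simps)
  qed measurable
qed

lemma integrable_outer_dev_mult:
  fixes S :: "real^'p^'p"
  assumes P: "white_noise P"
  shows "integrable P (\<lambda>e. outer_dev S e $ k * outer_dev S e $ l)"
proof (rule Bochner_Integration.integrable_bound[OF integrable_outer_dev_norm_square[OF P, of S]])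
  have [measurable_cong]: "sets P = sets borel" using P by (simp add: white_noise_def)
  show "(\<lambda>e. outer_dev S e $ k * outer_dev S e $ l) \<in> borel_measurable P" by measurable
  have "\<bar>v $ k * v $ l\<bar> \<le> (norm v)^2" for v :: "real^('p \<times> 'p)"
    unfolding abs_mult power2_eq_square by (intro mult_mono component_le_norm_cart) auto
  then show "AE e in P. norm (outer_dev S e $ k * outer_dev S e $ l) \<le> norm ((norm (outer_dev S e))\<^sup>2)"
    by simp
qed

lemma integrable_outer_dev_nth:
  assumes P: "white_noise P"
  shows "integrable P (\<lambda>e. outer_dev S e $ k)"
proof -
  interpret prob_space P using P by (simp add: white_noise_def)
  have [measurable_cong]: "sets P = sets borel" using P by (simp add: white_noise_def)
  show ?thesis
    by (rule square_integrable_imp_integrable)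
      (use integrable_outer_dev_mult[OF P, of S k k] in \<open>auto simp: power2_eq_square\<close>)
qed

lemma integrable_outer_nth:
  fixes S :: "real^'p^'p"
  assumes P: "white_noise P"
  shows "integrable P (\<lambda>e. vec_mat (outer (S *v e)) $ k)"
proof -
  interpret prob_space P using P by (simp add: white_noise_def)
  have "vec_mat (outer (S *v e)) $ k = outer_dev S e $ k + vec_mat (S ** S) $ k" for e
    by (simp add: outer_dev_def)
  then show ?thesis using integrable_outer_dev_nth[OF P] by simp
qed

lemma integral_outer_nth:
  fixes S :: "real^'p^'p"
  assumes P: "white_noise P" and S: "transpose S = S"
  shows "(\<integral>e. vec_mat (outer (S *v e)) $ k \<partial>P) = vec_mat (S ** S) $ k"
proof -
  have [measurable_cong]: "sets P = sets borel" using P by (simp add: white_noise_def)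
  obtain i j where k: "k = (i, j)" by (cases k)
  have ab: "integrable P (\<lambda>e. e $ a * e $ b)" for a b
  proof (rule white_noise_integrable_bound[OF P, where K = 1])
    fix e :: "real^'p"
    have "\<bar>e $ a * e $ b\<bar> \<le> (norm e)^2"
      unfolding abs_mult power2_eq_square by (intro mult_mono component_le_norm_cart) auto
    also have "\<dots> \<le> 1 + norm e ^ 4"
    proof -
      have "0 \<le> (1 - (norm e)^2)^2" "0 \<le> (norm e)^2" by (rule zero_le_power2)+
      moreover have "(1 - (norm e)^2)^2 = 1 - 2 * (norm e)^2 + norm e ^ 4"
        by (simp add: power2_eq_square power4_eq_xxxx algebra_simps)
      ultimately show ?thesis by linarith
    qed
    finally show "\<bar>e $ a * e $ b\<bar> \<le> 1 * (1 + norm e ^ 4)" by simp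
  qed measurable
  have "(\<integral>e. vec_mat (outer (S *v e)) $ k \<partial>P) =
      (\<integral>e. (\<Sum>a\<in>UNIV. \<Sum>b\<in>UNIV. S $ i $ a * S $ j $ b * (e $ a * e $ b)) \<partial>P)"
    by (simp add: k vec_mat_def outer_def matrix_vector_mult_def sum_product mult_ac)
  also have "\<dots> = (\<Sum>a\<in>UNIV. \<Sum>b\<in>UNIV. S $ i $ a * S $ j $ b * (if a = b then 1 else 0))"
    using ab P by (simp add: white_noise_def)
  also have "\<dots> = (\<Sum>a\<in>UNIV. S $ i $ a * S $ j $ a)"
    by (simp add: if_distrib[of "(*) _"] cong: if_cong)
  also have "\<dots> = (\<Sum>a\<in>UNIV. S $ i $ a * S $ a $ j)"
  proof -
    have "S $ j $ a = S $ a $ j" for a using S by (metis (no_types, lifting) transpose_def vec_lambda_beta)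
    then show ?thesis by simp
  qed
  finally show ?thesis by (simp add: k vec_mat_def matrix_matrix_mult_def)
qed

lemma integral_outer_dev_nth:
  assumes P: "white_noise P" and S: "transpose S = S"
  shows "(\<integral>e. outer_dev S e $ k \<partial>P) = 0"
proof -
  interpret prob_space P using P by (simp add: white_noise_def)
  show ?thesis
    unfolding outer_dev_def vector_minus_component
    using integral_outer_nth[OF P S, of k]
    by (subst Bochner_Integration.integral_diff[OF integrable_outer_nth[OF P]]) (simp_all add: prob_space)
qed

lemma integrable_noise_var:
  assumes P: "white_noise P"
  shows "integrable P (\<lambda>e. (norm (R *v outer_dev S e))^2)"
proof -
  have [measurable_cong]: "sets P = sets borel" using P by (simp add: white_noise_def)
  obtain L where L: "\<And>v. norm (R *v v) \<le> norm v * L"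
    using bounded_linear.bounded[OF matrix_vector_mul_bounded_linear[of R]] by blast
  have "(norm (R *v v))^2 \<le> L^2 * (norm v)^2" for v
    using power_mono[OF L[of v], of 2] by (simp add: power_mult_distrib mult_ac)
  then show ?thesis
    by (intro Bochner_Integration.integrable_bound[OF integrable_mult_right[OF integrable_outer_dev_norm_square[OF P, of S], of "L^2"]])
      auto
qed

text \<open>The cross term is linear in \<open>outer_dev S e\<close>, whose mean is zero.\<close>

lemma noise_pythagoras:
  assumes P: "white_noise P" and S: "transpose S = S"
  shows "(\<integral>\<^sup>+e. ennreal ((norm (R *v outer_dev S e + z))^2) \<partial>P) =
    ennreal (noise_var P R S) + ennreal ((norm z)^2)"
proof -
  interpret prob_space P using P by (simp add: white_noise_def)
  define cross where "cross e = (\<Sum>k\<in>UNIV. (transpose R *v z) $ k * outer_dev S e $ k)" for e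
  have expand: "(norm (R *v outer_dev S e + z))^2 =
      (norm (R *v outer_dev S e))^2 + (2 * cross e + (norm z)^2)" for e
  proof -
    have "(R *v outer_dev S e) \<bullet> z = (transpose R *v z) \<bullet> outer_dev S e"
      by (simp add: transpose_matrix_vector dot_lmul_matrix inner_commute)
    then have "(R *v outer_dev S e) \<bullet> z = cross e"
      unfolding cross_def by (simp add: inner_vec_def)
    then show ?thesis
      by (simp add: power2_norm_eq_inner inner_add_left inner_add_right inner_commute)
  qed
  have cross: "integrable P cross" "(\<integral>e. cross e \<partial>P) = 0"
    unfolding cross_def using integrable_outer_dev_nth[OF P] integral_outer_dev_nth[OF P S] by simp_all
  have int: "integrable P (\<lambda>e. 2 * cross e + (norm z)^2)"
    "integrable P (\<lambda>e. (norm (R *v outer_dev S e + z))^2)"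
    unfolding expand
    by (intro Bochner_Integration.integrable_add integrable_mult_right integrable_const cross(1)
        integrable_noise_var[OF P])+
  have "(\<integral>e. (norm (R *v outer_dev S e + z))^2 \<partial>P) = noise_var P R S + (\<integral>e. 2 * cross e + (norm z)^2 \<partial>P)"
    unfolding expand noise_var_def
    by (rule Bochner_Integration.integral_add[OF integrable_noise_var[OF P] int(1)])
  also have "(\<integral>e. 2 * cross e + (norm z)^2 \<partial>P) = (norm z)^2"
    using cross by (simp add: prob_space)
  finally have "(\<integral>e. (norm (R *v outer_dev S e + z))^2 \<partial>P) = noise_var P R S + (norm z)^2" .
  moreover have "0 \<le> noise_var P R S" by (simp add: noise_var_def)
  ultimately show ?thesis
    by (subst nn_integral_eq_integral[OF int(2)]) (simp_all add: ennreal_plus)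
qed

text \<open>Expands \<open>tr(W Cov q) = E (q \<bullet> W q)\<close> for the centred vector \<open>q = outer_dev S e\<close>.\<close>

lemma trace_noise_cov:
  assumes P: "white_noise P" and W: "possemidef_matrix W"
  shows "trace (W ** (\<chi> k l. \<integral>e. outer_dev S e $ k * outer_dev S e $ l \<partial>P)) = noise_var P (matrix_sqrt W) S"
proof -
  have "noise_var P (matrix_sqrt W) S = (\<integral>e. outer_dev S e \<bullet> (W *v outer_dev S e) \<partial>P)"
    by (simp add: noise_var_def quadratic_form_eq_norm_matrix_sqrt[OF W])
  also have "\<dots> = (\<integral>e. (\<Sum>k\<in>UNIV. \<Sum>l\<in>UNIV. W $ k $ l * (outer_dev S e $ l * outer_dev S e $ k)) \<partial>P)"
    by (simp add: inner_vec_def matrix_vector_mult_def sum_distrib_left mult_ac)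
  also have "\<dots> = (\<Sum>k\<in>UNIV. \<Sum>l\<in>UNIV. W $ k $ l * (\<integral>e. outer_dev S e $ l * outer_dev S e $ k \<partial>P))"
    using integrable_outer_dev_mult[OF P, of S] by simp
  finally show ?thesis by (simp add: trace_def matrix_matrix_mult_def)
qed

text \<open>Given \<open>T\<close>, the response \<open>Y\<close> has the law of \<open>S(T) e\<close> with \<open>e\<close> drawn from \<open>P\<close>. Integrating
  test functions against the joint law expresses this without a regular conditional distribution.\<close>

definition resampled_response ::
  "'a measure \<Rightarrow> (real^'p) measure \<Rightarrow> 't measure \<Rightarrow> ('a \<Rightarrow> 't) \<Rightarrow> ('t \<Rightarrow> real^'p^'p) \<Rightarrow> ('a \<Rightarrow> real^'p) \<Rightarrow> bool"
  where "resampled_response M P N T S Y \<longleftrightarrow> T \<in> M \<rightarrow>\<^sub>M N \<and> Y \<in> borel_measurable M \<and>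
    (\<forall>f\<in>borel_measurable (N \<Otimes>\<^sub>M borel).
       (\<integral>\<^sup>+\<omega>. f (T \<omega>, Y \<omega>) \<partial>M) = (\<integral>\<^sup>+\<omega>. \<integral>\<^sup>+e. f (T \<omega>, S (T \<omega>) *v e) \<partial>P \<partial>M))"

lemma borel_measurable_noise_var:
  assumes P: "white_noise P" and [measurable]: "R \<in> borel_measurable N" "S \<in> borel_measurable N"
  shows "(\<lambda>t. noise_var P (R t) (S t)) \<in> borel_measurable N"
proof -
  interpret prob_space P using P by (simp add: white_noise_def)
  have [measurable_cong]: "sets P = sets borel" using P by (simp add: white_noise_def)
  show ?thesis unfolding noise_var_def by measurable
qed

lemma resampled_prediction_error:
  assumes res: "resampled_response M P N T S Y" and P: "white_noise P"
    and [measurable]: "R \<in> borel_measurable N" "S \<in> borel_measurable N" "z \<in> borel_measurable N"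
    and S: "\<And>t. transpose (S t) = S t"
  shows "(\<integral>\<^sup>+\<omega>. ennreal ((norm (R (T \<omega>) *v vec_mat (outer (Y \<omega>)) - z (T \<omega>)))^2) \<partial>M) =
    (\<integral>\<^sup>+\<omega>. ennreal (noise_var P (R (T \<omega>)) (S (T \<omega>))) \<partial>M) +
    (\<integral>\<^sup>+\<omega>. ennreal ((norm (z (T \<omega>) - R (T \<omega>) *v vec_mat (S (T \<omega>) ** S (T \<omega>))))^2) \<partial>M)"
proof -
  have [measurable]: "T \<in> M \<rightarrow>\<^sub>M N" using res by (simp add: resampled_response_def)
  have [measurable]: "(\<lambda>t. noise_var P (R t) (S t)) \<in> borel_measurable N"
    by (rule borel_measurable_noise_var[OF P]) measurable
  define f where "f = (\<lambda>(t, y). ennreal ((norm (R t *v vec_mat (outer y) - z t))^2))"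
  have f: "f \<in> borel_measurable (N \<Otimes>\<^sub>M borel)" unfolding f_def by measurable
  have split: "R t *v vec_mat (outer (S t *v e)) - z t =
      R t *v outer_dev (S t) e + (R t *v vec_mat (S t ** S t) - z t)" for t e
    by (simp add: outer_dev_def matrix_vector_mult_diff_distrib)
  have "(\<integral>\<^sup>+\<omega>. f (T \<omega>, Y \<omega>) \<partial>M) = (\<integral>\<^sup>+\<omega>. \<integral>\<^sup>+e. f (T \<omega>, S (T \<omega>) *v e) \<partial>P \<partial>M)"
    using res f by (auto simp: resampled_response_def)
  also have "\<dots> = (\<integral>\<^sup>+\<omega>. ennreal (noise_var P (R (T \<omega>)) (S (T \<omega>))) +
      ennreal ((norm (R (T \<omega>) *v vec_mat (S (T \<omega>) ** S (T \<omega>)) - z (T \<omega>)))^2) \<partial>M)"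
    by (simp add: f_def split noise_pythagoras[OF P S])
  also have "\<dots> = (\<integral>\<^sup>+\<omega>. ennreal (noise_var P (R (T \<omega>)) (S (T \<omega>))) \<partial>M) +
    (\<integral>\<^sup>+\<omega>. ennreal ((norm (R (T \<omega>) *v vec_mat (S (T \<omega>) ** S (T \<omega>)) - z (T \<omega>)))^2) \<partial>M)"
    by (rule nn_integral_add) auto
  finally show ?thesis by (simp add: f_def norm_minus_commute)
qed

section \<open>Moments of the responses under the data-generating assumption\<close>

text \<open>Any injective selection from an i.i.d. family has the same product law. With different selections this
  shows that all noise vectors have the same law, and that a training sample may be renumbered.\<close>

lemma (in prob_space) iid_distr_reindex:
  fixes Z :: "'i \<Rightarrow> 'a \<Rightarrow> 'b::topological_space"
  assumes iid: "iid M K Z" and f: "inj_on f I" "f \<in> I \<rightarrow> K" and k0: "k0 \<in> K"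
  shows "distr M (Pi\<^sub>M I (\<lambda>_. borel)) (\<lambda>\<omega>. \<lambda>i\<in>I. Z (f i) \<omega>) = Pi\<^sub>M I (\<lambda>_. distr M borel (Z k0))"
proof -
  let ?\<nu> = "distr M borel (Z k0)"
  have meas: "Z k \<in> borel_measurable M" if "k \<in> K" for k
    using iid that by (auto simp: iid_def indep_vars_def)
  have "distr M (Pi\<^sub>M K (\<lambda>_. borel)) (\<lambda>\<omega>. \<lambda>k\<in>K. Z k \<omega>) = Pi\<^sub>M K (\<lambda>k. distr M borel (Z k))"
  proof (rule iffD1[OF indep_vars_iff_distr_eq_PiM'])
    show "K \<noteq> {}" using k0 by blast
    show "indep_vars (\<lambda>_. borel) Z K" using iid by (simp add: iid_def)
  qed (rule meas)
  also have "\<dots> = Pi\<^sub>M K (\<lambda>_. ?\<nu>)"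
    using iid k0 unfolding iid_def by (intro PiM_cong) blast+
  finally have K: "distr M (Pi\<^sub>M K (\<lambda>_. borel)) (\<lambda>\<omega>. \<lambda>k\<in>K. Z k \<omega>) = Pi\<^sub>M K (\<lambda>_. ?\<nu>)" .
  have sets: "sets (Pi\<^sub>M I (\<lambda>_. ?\<nu>)) = sets (Pi\<^sub>M I (\<lambda>_. borel))" for I :: "'k set"
    by (intro sets_PiM_cong) auto
  have fm: "(\<lambda>g. \<lambda>i\<in>I. g (f i)) \<in> Pi\<^sub>M K (\<lambda>_. borel) \<rightarrow>\<^sub>M Pi\<^sub>M I (\<lambda>_. borel)"
    using f by (intro measurable_restrict measurable_component_singleton) auto
  have "Pi\<^sub>M I (\<lambda>_. ?\<nu>) = distr (Pi\<^sub>M K (\<lambda>_. ?\<nu>)) (Pi\<^sub>M I (\<lambda>_. ?\<nu>)) (\<lambda>g. \<lambda>i\<in>I. g (f i))"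
    using meas[OF k0] by (intro distr_PiM_reindex[symmetric] f prob_space_distr) auto
  also have "\<dots> = distr (Pi\<^sub>M K (\<lambda>_. ?\<nu>)) (Pi\<^sub>M I (\<lambda>_. borel)) (\<lambda>g. \<lambda>i\<in>I. g (f i))"
    by (rule distr_cong) (auto simp: sets)
  also have "\<dots> = distr M (Pi\<^sub>M I (\<lambda>_. borel)) (\<lambda>\<omega>. \<lambda>i\<in>I. (\<lambda>k\<in>K. Z k \<omega>) (f i))"
    unfolding K[symmetric] by (subst distr_distr[OF fm]) (auto intro!: measurable_restrict meas simp: comp_def)
  also have "(\<lambda>\<omega>. \<lambda>i\<in>I. (\<lambda>k\<in>K. Z k \<omega>) (f i)) = (\<lambda>\<omega>. \<lambda>i\<in>I. Z (f i) \<omega>)"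
    using f(2) by (intro ext) (auto simp: restrict_def)
  finally show ?thesis by (rule sym)
qed

lemma borel_measurable_vec_lambda:
  fixes f :: "'a \<Rightarrow> real^'d"
  assumes "\<And>j. (\<lambda>\<omega>. f \<omega> $ j) \<in> borel_measurable N"
  shows "f \<in> borel_measurable N"
proof (subst borel_measurable_euclidean_space, rule ballI)
  fix b :: "real^'d" assume "b \<in> Basis"
  then obtain j where "b = axis j 1" by (auto simp: Basis_vec_def)
  then show "(\<lambda>\<omega>. f \<omega> \<bullet> b) \<in> borel_measurable N" using assms by (simp add: inner_axis)
qed

lemma abs_power4_le_powr:
  assumes "0 < \<eta>"
  shows "(x::real) ^ 4 \<le> 1 + \<bar>x\<bar> powr (4 + \<eta>)"
proof (cases "\<bar>x\<bar> \<le> 1")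
  case True
  then have "\<bar>x\<bar> ^ 4 \<le> 1" by (intro power_le_one) auto
  then show ?thesis by (simp add: add_increasing2)
next
  case False
  then have "\<bar>x\<bar> powr 4 \<le> \<bar>x\<bar> powr (4 + \<eta>)" using assms by (intro powr_mono) auto
  then show ?thesis using False powr_realpow[of "\<bar>x\<bar>" 4] by simp
qed

lemma norm_power4_le: "norm (e :: real^'p) ^ 4 \<le> real CARD('p) * (\<Sum>j\<in>UNIV. (e $ j) ^ 4)"
proof -
  have "norm e ^ 4 = (\<Sum>j\<in>UNIV. (e $ j)^2)^2"
    by (simp flip: norm_power2_vec)
  also have "\<dots> \<le> real CARD('p) * (\<Sum>j\<in>UNIV. ((e $ j)^2)^2)"
    using sum_squared_le_sum_of_squares[of "\<lambda>j. (e $ j)^2" UNIV] by (simp add: mult.commute)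
  finally show ?thesis by simp
qed

locale covariance_regression = prob_space M for M :: "'a measure" +
  fixes n :: nat and C :: "'x::euclidean_space \<Rightarrow> real^'p^'p" and X :: "obs \<Rightarrow> 'a \<Rightarrow> 'x"
    and Y \<E> :: "obs \<Rightarrow> 'a \<Rightarrow> real^'p" and \<mu>4 :: real
  assumes n: "n \<ge> 1" and tm: "true_model M n C X Y" and dg: "data_generating M n C X Y \<E> \<mu>4"
begin

lemma noise_indep_vars: "indep_vars (\<lambda>_. borel) (\<lambda>(\<alpha>, j) \<omega>. \<E> \<alpha> \<omega> $ j) (obs_set n \<times> UNIV)"
  using dg by (simp add: data_generating_def iid_def)

lemma noise_measurable:
  assumes "\<alpha> \<in> obs_set n"
  shows "\<E> \<alpha> \<in> borel_measurable M"
proof (rule borel_measurable_vec_lambda)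
  fix j
  show "(\<lambda>\<omega>. \<E> \<alpha> \<omega> $ j) \<in> borel_measurable M"
    using assms noise_indep_vars by (auto simp: indep_vars_def)
qed

lemma covariates_measurable: "\<alpha> \<in> obs_set n \<Longrightarrow> X \<alpha> \<in> borel_measurable M"
  and responses_measurable: "\<alpha> \<in> obs_set n \<Longrightarrow> Y \<alpha> \<in> borel_measurable M"
  using tm by (auto simp: true_model_def)

lemma true_cov_psd: "possemidef_matrix (C x)"
  using tm by (auto simp: true_model_def intro: posdef_imp_possemidef)

lemma sqrt_true_cov_measurable: "(\<lambda>x. matrix_sqrt (C x)) \<in> borel_measurable borel"
  using tm true_cov_psd by (intro matrix_sqrt_measurable) (auto simp: true_model_def)

lemma sqrt_true_cov:
  "matrix_sqrt (C x) ** matrix_sqrt (C x) = C x" "transpose (matrix_sqrt (C x)) = matrix_sqrt (C x)"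
  using matrix_sqrt_square[OF true_cov_psd] possemidef_matrix_sqrt[OF true_cov_psd]
  by (auto simp: possemidef_matrix_def)

lemma response_eq: "\<alpha> \<in> obs_set n \<Longrightarrow> \<omega> \<in> space M \<Longrightarrow> Y \<alpha> \<omega> = matrix_sqrt (C (X \<alpha> \<omega>)) *v \<E> \<alpha> \<omega>"
  using dg by (simp add: data_generating_def)

lemma noise_distr_eq:
  assumes "\<alpha> \<in> obs_set n" "\<beta> \<in> obs_set n"
  shows "distr M borel (\<E> \<alpha>) = distr M borel (\<E> \<beta>)"
proof -
  have iid: "iid M (obs_set n \<times> UNIV) (\<lambda>(\<alpha>, j) \<omega>. \<E> \<alpha> \<omega> $ j)"
    using dg by (simp add: data_generating_def)
  let ?\<nu> = "distr M borel (\<lambda>\<omega>. \<E> \<alpha> \<omega> $ undefined)"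
  have "distr M borel (\<E> \<gamma>) = distr (Pi\<^sub>M UNIV (\<lambda>_. ?\<nu>)) borel (\<lambda>g. \<chi> j. g j)" if \<gamma>: "\<gamma> \<in> obs_set n" for \<gamma>
  proof -
    have law: "distr M (Pi\<^sub>M UNIV (\<lambda>_. borel)) (\<lambda>\<omega>. \<lambda>j\<in>UNIV. \<E> \<gamma> \<omega> $ j) = Pi\<^sub>M UNIV (\<lambda>_. ?\<nu>)"
      using iid_distr_reindex[OF iid, of "\<lambda>j. (\<gamma>, j)" UNIV "(\<alpha>, undefined)"] \<gamma> assms
      by (auto simp: inj_on_def)
    have m: "(\<lambda>g. (\<chi> j. g j) :: real^'p) \<in> Pi\<^sub>M UNIV (\<lambda>_. borel) \<rightarrow>\<^sub>M borel"
      by (rule borel_measurable_vec_lambda) (auto intro!: measurable_component_singleton)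
    have "(\<lambda>\<omega>. \<lambda>j\<in>UNIV. \<E> \<gamma> \<omega> $ j) \<in> M \<rightarrow>\<^sub>M Pi\<^sub>M UNIV (\<lambda>_. borel)"
      using noise_measurable[OF \<gamma>] by (intro measurable_restrict) measurable
    then show ?thesis
      unfolding law[symmetric] by (subst distr_distr[OF m]) (simp_all add: comp_def restrict_UNIV)
  qed
  then show ?thesis using assms by simp
qed

text \<open>The moment of order \<open>4 + \<eta>\<close> bounds all moments up to the fourth, and independence of the coordinates
  makes the mixed second moments vanish.\<close>

lemma noise_white:
  assumes \<alpha>: "\<alpha> \<in> obs_set n"
  shows "white_noise (distr M borel (\<E> \<alpha>))"
proof -
  note [measurable] = noise_measurable[OF \<alpha>]
  obtain \<eta> where \<eta>: "0 < \<eta>" "\<And>j. integrable M (\<lambda>\<omega>. \<bar>\<E> \<alpha> \<omega> $ j\<bar> powr (4 + \<eta>))"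
    using dg \<alpha> by (auto simp: data_generating_def)
  have mom: "(\<integral>\<omega>. \<E> \<alpha> \<omega> $ j \<partial>M) = 0" "(\<integral>\<omega>. (\<E> \<alpha> \<omega> $ j)^2 \<partial>M) = 1" for j
    using dg \<alpha> by (auto simp: data_generating_def)
  have int4: "integrable M (\<lambda>\<omega>. (\<E> \<alpha> \<omega> $ j) ^ 4)" for j
  proof (rule Bochner_Integration.integrable_bound)
    show "integrable M (\<lambda>\<omega>. 1 + \<bar>\<E> \<alpha> \<omega> $ j\<bar> powr (4 + \<eta>))" using \<eta>(2) by simp
    show "AE \<omega> in M. norm ((\<E> \<alpha> \<omega> $ j) ^ 4) \<le> norm (1 + \<bar>\<E> \<alpha> \<omega> $ j\<bar> powr (4 + \<eta>))"
      using abs_power4_le_powr[OF \<eta>(1)] by (simp add: add_nonneg_nonneg)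
  qed measurable
  have int_norm: "integrable M (\<lambda>\<omega>. norm (\<E> \<alpha> \<omega>) ^ 4)"
  proof (rule Bochner_Integration.integrable_bound)
    show "integrable M (\<lambda>\<omega>. real CARD('p) * (\<Sum>j\<in>UNIV. (\<E> \<alpha> \<omega> $ j) ^ 4))" using int4 by simp
    show "AE \<omega> in M. norm (norm (\<E> \<alpha> \<omega>) ^ 4) \<le> norm (real CARD('p) * (\<Sum>j\<in>UNIV. (\<E> \<alpha> \<omega> $ j) ^ 4))"
      using norm_power4_le by (auto intro: order_trans[OF _ abs_ge_self])
  qed measurable
  have int1: "integrable M (\<lambda>\<omega>. \<E> \<alpha> \<omega> $ j)" for j
  proof (rule Bochner_Integration.integrable_bound)
    show "integrable M (\<lambda>\<omega>. 1 + (\<E> \<alpha> \<omega> $ j) ^ 4)" using int4 by simp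
    have "\<bar>x\<bar> \<le> 1 + x ^ 4" for x :: real
    proof (cases "\<bar>x\<bar> \<le> 1")
      case False
      then have "\<bar>x\<bar> ^ 1 \<le> \<bar>x\<bar> ^ 4" by (intro power_increasing) auto
      then show ?thesis by simp
    qed (simp add: add_increasing2)
    then show "AE \<omega> in M. norm (\<E> \<alpha> \<omega> $ j) \<le> norm (1 + (\<E> \<alpha> \<omega> $ j) ^ 4)"
      by (auto intro: order_trans[OF _ abs_ge_self])
  qed measurable
  have cov: "(\<integral>\<omega>. \<E> \<alpha> \<omega> $ a * \<E> \<alpha> \<omega> $ b \<partial>M) = (if a = b then 1 else 0)" for a b
  proof (cases "a = b")
    case True
    then show ?thesis using mom(2)[of b] by (simp add: power2_eq_square)
  next
    case False
    have "indep_vars (\<lambda>_. borel) (\<lambda>(\<alpha>, j) \<omega>. \<E> \<alpha> \<omega> $ j) {(\<alpha>, a), (\<alpha>, b)}"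
      by (rule indep_vars_subset[OF noise_indep_vars]) (use \<alpha> in auto)
    from indep_vars_lebesgue_integral[OF _ this] int1 mom(1) False
    show ?thesis by auto
  qed
  show ?thesis
    unfolding white_noise_def using int_norm cov
    by (auto simp: prob_space_distr integrable_distr_eq integral_distr)
qed

lemma covariate_noise_indep:
  assumes \<alpha>: "\<alpha> \<in> obs_set n" and \<beta>: "\<beta> \<in> obs_set n"
  shows "indep_elements borel (X \<beta>) borel (\<E> \<alpha>)"
  unfolding indep_elements_def
proof (intro conjI ballI)
  show "X \<beta> \<in> borel_measurable M" "\<E> \<alpha> \<in> borel_measurable M"
    using covariates_measurable[OF \<beta>] noise_measurable[OF \<alpha>] .
  fix A :: "'x set" and B :: "(real^'p) set" assume A: "A \<in> sets borel" and B: "B \<in> sets borel"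
  have "X \<beta> -` A \<inter> space M \<in> sets (generated M (obs_set n) X)"
    using measurable_sets[OF measurable_generated[OF \<beta>, of X M] A] by simp
  moreover have "\<E> \<alpha> -` B \<inter> space M \<in> sets (generated M {\<alpha>} \<E>)"
    using measurable_sets[OF measurable_generated[of \<alpha> "{\<alpha>}" \<E> M] B] by simp
  moreover have "indep_set (sets (generated M {\<alpha>} \<E>)) (sets (generated M (obs_set n) X))"
    using dg \<alpha> by (simp add: data_generating_def)
  ultimately have "prob ((\<E> \<alpha> -` B \<inter> space M) \<inter> (X \<beta> -` A \<inter> space M)) =
      prob (\<E> \<alpha> -` B \<inter> space M) * prob (X \<beta> -` A \<inter> space M)"
    by (intro indep_setD)
  then show "prob ((X \<beta> -` A \<inter> space M) \<inter> (\<E> \<alpha> -` B \<inter> space M)) =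
      prob (X \<beta> -` A \<inter> space M) * prob (\<E> \<alpha> -` B \<inter> space M)"
    by (simp add: Int_commute mult.commute)
qed

text \<open>By independence of \<open>X \<alpha>\<close> and the noise, the conditional mean and the conditional covariance of
  \<open>vec(Y Y\<^sup>T)\<close> given \<open>X \<alpha>\<close> are integrals over the noise law with \<open>X \<alpha>\<close> held fixed.\<close>

lemma nu2_eq_noise_var:
  fixes W V :: "'x \<Rightarrow> real^('p \<times> 'p)^('p \<times> 'p)"
  assumes \<alpha>: "\<alpha> \<in> obs_set n" and V: "cond_cov_function M n X Y V" and W: "\<And>x. possemidef_matrix (W x)"
  shows "AE \<omega> in M. nu2 W V (X \<alpha> \<omega>) =
    noise_var (distr M borel (\<E> \<alpha>)) (matrix_sqrt (W (X \<alpha> \<omega>))) (matrix_sqrt (C (X \<alpha> \<omega>)))"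
proof -
  let ?F = "generated M {\<alpha>} X" and ?P = "distr M borel (\<E> \<alpha>)"
  define Q where "Q \<omega> = vec_mat (outer (Y \<alpha> \<omega>))" for \<omega>
  define m where "m = cond_mean M ?F Q"
  define S where "S x = matrix_sqrt (C x)" for x
  note [measurable] = covariates_measurable[OF \<alpha>] responses_measurable[OF \<alpha>] noise_measurable[OF \<alpha>]
  have [measurable]: "S \<in> borel_measurable borel" unfolding S_def by (rule sqrt_true_cov_measurable)
  have Q_meas[measurable]: "Q \<in> borel_measurable M" unfolding Q_def by measurable
  have white: "white_noise ?P" by (rule noise_white[OF \<alpha>])
  note indep = covariate_noise_indep[OF \<alpha> \<alpha>]
  interpret sigma_finite_subalgebra M ?F
    by (intro sigma_finite_subalgebraI subalgebra_generated) simp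
  have YE: "AE \<omega> in M. Y \<alpha> \<omega> = S (X \<alpha> \<omega>) *v \<E> \<alpha> \<omega>"
    using response_eq[OF \<alpha>] by (auto simp: S_def)
  have m_eq: "AE \<omega> in M. m \<omega> $ k = vec_mat (S (X \<alpha> \<omega>) ** S (X \<alpha> \<omega>)) $ k" for k
  proof -
    define h where "h = (\<lambda>(x, e). vec_mat (outer (S x *v e)) $ k)"
    have [measurable]: "h \<in> borel_measurable (borel \<Otimes>\<^sub>M borel)" unfolding h_def by measurable
    have "AE \<omega> in M. real_cond_exp M ?F (\<lambda>\<omega>. Q \<omega> $ k) \<omega> = real_cond_exp M ?F (\<lambda>\<omega>. h (X \<alpha> \<omega>, \<E> \<alpha> \<omega>)) \<omega>"
      using YE by (intro real_cond_exp_cong) (auto simp: Q_def h_def)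
    moreover have "AE \<omega> in M. real_cond_exp M ?F (\<lambda>\<omega>. h (X \<alpha> \<omega>, \<E> \<alpha> \<omega>)) \<omega> = (\<integral>e. h (X \<alpha> \<omega>, e) \<partial>?P)"
      by (rule real_cond_exp_generated_indep[where X = X and \<alpha> = \<alpha>, OF indep])
        (simp_all add: h_def integrable_outer_nth[OF white])
    ultimately show ?thesis
      by eventually_elim
        (simp add: m_def cond_mean_def h_def integral_outer_nth[OF white] S_def sqrt_true_cov)
  qed
  have V_eq: "AE \<omega> in M. V (X \<alpha> \<omega>) $ k $ l =
      (\<integral>e. outer_dev (S (X \<alpha> \<omega>)) e $ k * outer_dev (S (X \<alpha> \<omega>)) e $ l \<partial>?P)" for k l
  proof -
    define h where "h = (\<lambda>(x, e). outer_dev (S x) e $ k * outer_dev (S x) e $ l)"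
    have [measurable]: "h \<in> borel_measurable (borel \<Otimes>\<^sub>M borel)" unfolding h_def by measurable
    have m_meas[measurable]: "(\<lambda>\<omega>. m \<omega> $ k) \<in> borel_measurable M" for k
      unfolding m_def cond_mean_def by simp
    have "AE \<omega> in M. (Q \<omega> $ k - m \<omega> $ k) * (Q \<omega> $ l - m \<omega> $ l) = h (X \<alpha> \<omega>, \<E> \<alpha> \<omega>)"
      using YE m_eq[of k] m_eq[of l] by eventually_elim (simp add: Q_def h_def outer_dev_def)
    then have "AE \<omega> in M. real_cond_exp M ?F (\<lambda>\<omega>. (Q \<omega> $ k - m \<omega> $ k) * (Q \<omega> $ l - m \<omega> $ l)) \<omega> =
        real_cond_exp M ?F (\<lambda>\<omega>. h (X \<alpha> \<omega>, \<E> \<alpha> \<omega>)) \<omega>"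
      by (rule real_cond_exp_cong) measurable
    moreover have "AE \<omega> in M. real_cond_exp M ?F (\<lambda>\<omega>. h (X \<alpha> \<omega>, \<E> \<alpha> \<omega>)) \<omega> = (\<integral>e. h (X \<alpha> \<omega>, e) \<partial>?P)"
      by (rule real_cond_exp_generated_indep[where X = X and \<alpha> = \<alpha>, OF indep])
        (simp_all add: h_def integrable_outer_dev_mult[OF white])
    moreover have "AE \<omega> in M. V (X \<alpha> \<omega>) = cond_cov M ?F Q \<omega>"
      using V \<alpha> unfolding cond_cov_function_def Q_def by blast
    ultimately show ?thesis
      by eventually_elim (simp add: h_def cond_cov_def m_def)
  qed
  have "AE \<omega> in M. \<forall>k l. V (X \<alpha> \<omega>) $ k $ l =
      (\<integral>e. outer_dev (S (X \<alpha> \<omega>)) e $ k * outer_dev (S (X \<alpha> \<omega>)) e $ l \<partial>?P)"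
    using V_eq by (simp add: AE_all_countable)
  then show ?thesis
  proof eventually_elim
    case (elim \<omega>)
    then have "V (X \<alpha> \<omega>) =
      (\<chi> k l. \<integral>e. outer_dev (S (X \<alpha> \<omega>)) e $ k * outer_dev (S (X \<alpha> \<omega>)) e $ l \<partial>?P)"
      by (simp add: vec_eq_iff)
    then show ?case by (simp add: nu2_def trace_noise_cov[OF white W] S_def)
  qed
qed

end

section \<open>Test responses drawn afresh given the covariates\<close>

context covariance_regression
begin

definition noise_law :: "(real^'p) measure" where
  "noise_law = distr M borel (\<E> (Train 1))"

definition train_space :: "(nat \<Rightarrow> 'x \<times> (real^'p)) measure" where
  "train_space = Pi\<^sub>M {1..n} (\<lambda>_. borel)"

text \<open>The one property of the three settings on which the decomposition of the error rests.
  \<open>X (Test i)\<close> is listed beside the training data because in the Random-\<open>X\<close> setting it is not a function of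
  them.\<close>

definition resampled_test :: "nat \<Rightarrow> bool" where
  "resampled_test i \<longleftrightarrow> resampled_response M noise_law (train_space \<Otimes>\<^sub>M borel)
     (\<lambda>\<omega>. (train_data n X Y \<omega>, X (Test i) \<omega>)) (\<lambda>(d, x). matrix_sqrt (C x)) (Y (Test i))"

lemma obs_set_I: "i \<in> {1..n} \<Longrightarrow> Train i \<in> obs_set n" "i \<in> {1..n} \<Longrightarrow> Test i \<in> obs_set n"
  "Train (Suc 0) \<in> obs_set n" "Test (Suc 0) \<in> obs_set n"
  using n by (auto simp: obs_set_def)

lemma noise_law: "\<alpha> \<in> obs_set n \<Longrightarrow> distr M borel (\<E> \<alpha>) = noise_law"
  unfolding noise_law_def by (rule noise_distr_eq) (auto simp: obs_set_I)

lemma white_noise_law: "white_noise noise_law"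
  unfolding noise_law_def by (rule noise_white) (auto simp: obs_set_I)

lemma sets_noise_law [measurable_cong]: "sets noise_law = sets borel"
  by (simp add: noise_law_def)

lemma prob_space_noise_law: "prob_space noise_law"
  using white_noise_law by (simp add: white_noise_def)

lemma pair_measurable: "\<alpha> \<in> obs_set n \<Longrightarrow> (\<lambda>\<omega>. (X \<alpha> \<omega>, Y \<alpha> \<omega>)) \<in> borel_measurable M"
  using covariates_measurable responses_measurable by (intro borel_measurable_Pair)

lemma train_data_measurable: "train_data n X Y \<in> M \<rightarrow>\<^sub>M train_space"
  unfolding train_data_def[abs_def] train_space_def
  by (intro measurable_restrict pair_measurable obs_set_I)

lemma resampled_test_if_noise_indep:
  assumes i: "i \<in> {1..n}"
    and indep: "indep_elements (train_space \<Otimes>\<^sub>M borel) T borel (\<E> (Test i))"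
    and T: "\<And>\<omega>. \<omega> \<in> space M \<Longrightarrow> T \<omega> = (train_data n X Y \<omega>, X (Test i) \<omega>)"
  shows "resampled_test i"
  unfolding resampled_test_def resampled_response_def
proof (intro conjI ballI)
  note [measurable] = train_data_measurable covariates_measurable[OF obs_set_I(2)[OF i]]
    sqrt_true_cov_measurable
  interpret P: prob_space noise_law by (rule prob_space_noise_law)
  show "(\<lambda>\<omega>. (train_data n X Y \<omega>, X (Test i) \<omega>)) \<in> M \<rightarrow>\<^sub>M train_space \<Otimes>\<^sub>M borel" by measurable
  show "Y (Test i) \<in> borel_measurable M" by (rule responses_measurable[OF obs_set_I(2)[OF i]])
  fix f :: "((nat \<Rightarrow> 'x \<times> (real^'p)) \<times> 'x) \<times> (real^'p) \<Rightarrow> ennreal" assume [measurable]: "f \<in> borel_measurable ((train_space \<Otimes>\<^sub>M borel) \<Otimes>\<^sub>M borel)"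
  define g where "g = (\<lambda>(t, e). f (t, matrix_sqrt (C (snd t)) *v e))"
  have g: "g \<in> borel_measurable ((train_space \<Otimes>\<^sub>M borel) \<Otimes>\<^sub>M borel)" unfolding g_def by measurable
  have "(\<integral>\<^sup>+\<omega>. f ((train_data n X Y \<omega>, X (Test i) \<omega>), Y (Test i) \<omega>) \<partial>M) = (\<integral>\<^sup>+\<omega>. g (T \<omega>, \<E> (Test i) \<omega>) \<partial>M)"
    by (intro nn_integral_cong) (simp add: g_def T response_eq[OF obs_set_I(2)[OF i]])
  also have "\<dots> = (\<integral>\<^sup>+\<omega>. \<integral>\<^sup>+e. g (T \<omega>, e) \<partial>noise_law \<partial>M)"
    using indep_elements_nn_integral[OF indep g] noise_law[OF obs_set_I(2)[OF i]] by simp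
  also have "\<dots> = (\<integral>\<^sup>+\<omega>. \<integral>\<^sup>+e. f ((train_data n X Y \<omega>, X (Test i) \<omega>),
      (case (train_data n X Y \<omega>, X (Test i) \<omega>) of (d, x) \<Rightarrow> matrix_sqrt (C x)) *v e) \<partial>noise_law \<partial>M)"
    by (intro nn_integral_cong) (simp add: g_def T)
  finally show "(\<integral>\<^sup>+\<omega>. f ((train_data n X Y \<omega>, X (Test i) \<omega>), Y (Test i) \<omega>) \<partial>M) = \<dots>" .
qed

text \<open>The training data are a function of the training noise, which is independent of the test noise.\<close>

lemma resampled_test_fixed:
  assumes i: "i \<in> {1..n}" and fixed: "fixed_X M n x X"
  shows "resampled_test i"
proof (rule resampled_test_if_noise_indep[OF i])
  let ?A = "Train ` {1..n} \<times> (UNIV :: 'p set)" and ?B = "{Test i} \<times> (UNIV :: 'p set)"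
  let ?Z = "\<lambda>(\<alpha>, j) \<omega>. \<E> \<alpha> \<omega> $ j"
  note [measurable] = sqrt_true_cov_measurable
  define G where "G g = ((\<lambda>j\<in>{1..n}. (x j, matrix_sqrt (C (x j)) *v (\<chi> k. g (Train j, k)))), x i)"
    for g :: "obs \<times> 'p \<Rightarrow> real"
  have "indep_var (Pi\<^sub>M ?A (\<lambda>_. borel)) (\<lambda>\<omega>. \<lambda>k\<in>?A. ?Z k \<omega>) (Pi\<^sub>M ?B (\<lambda>_. borel)) (\<lambda>\<omega>. \<lambda>k\<in>?B. ?Z k \<omega>)"
    by (rule indep_var_restrict[OF noise_indep_vars]) (use i in \<open>auto simp: obs_set_def\<close>)
  then have "indep_elements (Pi\<^sub>M ?A (\<lambda>_. borel)) (\<lambda>\<omega>. \<lambda>k\<in>?A. ?Z k \<omega>)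
      (Pi\<^sub>M ?B (\<lambda>_. borel)) (\<lambda>\<omega>. \<lambda>k\<in>?B. ?Z k \<omega>)"
    by (rule indep_elements_if_indep_var)
  moreover have "G \<in> Pi\<^sub>M ?A (\<lambda>_. borel) \<rightarrow>\<^sub>M train_space \<Otimes>\<^sub>M borel"
  proof -
    have "(\<lambda>g. \<chi> k. g (Train j, k)) \<in> Pi\<^sub>M ?A (\<lambda>_. borel) \<rightarrow>\<^sub>M (borel :: (real^'p) measure)" if "j \<in> {1..n}" for j
      by (rule borel_measurable_vec_lambda) (use that in \<open>auto intro!: measurable_component_singleton\<close>)
    then show ?thesis
      unfolding G_def[abs_def] train_space_def
      by (intro measurable_Pair measurable_restrict borel_measurable_Pair borel_measurable_matrix_vector_mult) auto
  qed
  moreover have "(\<lambda>g. (\<chi> k. g (Test i, k)) :: real^'p) \<in> Pi\<^sub>M ?B (\<lambda>_. borel) \<rightarrow>\<^sub>M borel"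
    by (rule borel_measurable_vec_lambda) (auto intro!: measurable_component_singleton)
  ultimately have "indep_elements (train_space \<Otimes>\<^sub>M borel) (\<lambda>\<omega>. G (\<lambda>k\<in>?A. ?Z k \<omega>))
      borel (\<lambda>\<omega>. \<chi> k. (\<lambda>k\<in>?B. ?Z k \<omega>) (Test i, k))"
    by (rule indep_elements_compose)
  then show "indep_elements (train_space \<Otimes>\<^sub>M borel) (\<lambda>\<omega>. G (\<lambda>k\<in>?A. ?Z k \<omega>)) borel (\<E> (Test i))"
    by simp
  fix \<omega> assume \<omega>: "\<omega> \<in> space M"
  then have X: "X (Train j) \<omega> = x j" "X (Test j) \<omega> = x j" if "j \<in> {1..n}" for j
    using fixed that by (auto simp: fixed_X_def)
  show "G (\<lambda>k\<in>?A. ?Z k \<omega>) = (train_data n X Y \<omega>, X (Test i) \<omega>)"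
    unfolding G_def train_data_def using X i \<omega> response_eq[OF obs_set_I(1) \<omega>]
    by (auto intro!: restrict_ext)
qed

lemma random_X_indep:
  assumes i: "i \<in> {1..n}" and random: "random_X M n X Y"
  shows "indep_elements train_space (train_data n X Y) borel (\<lambda>\<omega>. (X (Test i) \<omega>, Y (Test i) \<omega>))"
proof -
  let ?A = "Train ` {1..n}" and ?B = "{Test i}" and ?Z = "\<lambda>\<alpha> \<omega>. (X \<alpha> \<omega>, Y \<alpha> \<omega>)"
  have "indep_vars (\<lambda>_. borel) ?Z (obs_set n)" using random by (simp add: random_X_def iid_def)
  then have "indep_var (Pi\<^sub>M ?A (\<lambda>_. borel)) (\<lambda>\<omega>. \<lambda>k\<in>?A. ?Z k \<omega>) (Pi\<^sub>M ?B (\<lambda>_. borel)) (\<lambda>\<omega>. \<lambda>k\<in>?B. ?Z k \<omega>)"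
    by (rule indep_var_restrict) (use i in \<open>auto simp: obs_set_def\<close>)
  then have "indep_elements (Pi\<^sub>M ?A (\<lambda>_. borel)) (\<lambda>\<omega>. \<lambda>k\<in>?A. ?Z k \<omega>)
      (Pi\<^sub>M ?B (\<lambda>_. borel)) (\<lambda>\<omega>. \<lambda>k\<in>?B. ?Z k \<omega>)"
    by (rule indep_elements_if_indep_var)
  moreover have "(\<lambda>g. \<lambda>j\<in>{1..n}. g (Train j)) \<in> Pi\<^sub>M ?A (\<lambda>_. borel) \<rightarrow>\<^sub>M train_space"
    unfolding train_space_def by (intro measurable_restrict measurable_component_singleton) auto
  moreover have "(\<lambda>g. g (Test i)) \<in> Pi\<^sub>M ?B (\<lambda>_. borel) \<rightarrow>\<^sub>M borel"
    by (intro measurable_component_singleton) auto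
  ultimately have "indep_elements train_space (\<lambda>\<omega>. \<lambda>j\<in>{1..n}. (\<lambda>k\<in>?A. ?Z k \<omega>) (Train j))
      borel (\<lambda>\<omega>. (\<lambda>k\<in>?B. ?Z k \<omega>) (Test i))"
    by (rule indep_elements_compose)
  moreover have "(\<lambda>\<omega>. \<lambda>j\<in>{1..n}. (\<lambda>k\<in>?A. ?Z k \<omega>) (Train j)) = train_data n X Y"
    by (intro ext) (auto simp: train_data_def restrict_def)
  ultimately show ?thesis by simp
qed

text \<open>Two independences combine: the training data are independent of the test pair, and within the
  test pair the covariate is independent of the noise. The integral is taken first over the noise,
  then over the test covariate, then over the training data.\<close>

lemma resampled_test_random:
  assumes i: "i \<in> {1..n}" and random: "random_X M n X Y"
  shows "resampled_test i"
  unfolding resampled_test_def resampled_response_def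
proof (intro conjI ballI)
  note test_i = obs_set_I(2)[OF i]
  note [measurable] = train_data_measurable covariates_measurable[OF test_i]
    responses_measurable[OF test_i] sqrt_true_cov_measurable
  let ?D = "train_data n X Y" and ?X = "X (Test i)" and ?Y = "Y (Test i)"
  interpret P: prob_space noise_law by (rule prob_space_noise_law)
  show "(\<lambda>\<omega>. (?D \<omega>, ?X \<omega>)) \<in> M \<rightarrow>\<^sub>M train_space \<Otimes>\<^sub>M borel" by measurable
  show "?Y \<in> borel_measurable M" by measurable
  fix f :: "((nat \<Rightarrow> 'x \<times> (real^'p)) \<times> 'x) \<times> (real^'p) \<Rightarrow> ennreal" assume [measurable]: "f \<in> borel_measurable ((train_space \<Otimes>\<^sub>M borel) \<Otimes>\<^sub>M borel)"
  define f' where "f' = (\<lambda>(d, z). f ((d, fst z), snd z))"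
  define g where "g = (\<lambda>(d, x). \<integral>\<^sup>+e. f ((d, x), matrix_sqrt (C x) *v e) \<partial>noise_law)"
  have [measurable]: "f' \<in> borel_measurable (train_space \<Otimes>\<^sub>M borel)"
    unfolding f'_def borel_prod[symmetric] by measurable
  have [measurable]: "g \<in> borel_measurable (train_space \<Otimes>\<^sub>M borel)"
    unfolding g_def by measurable
  note indep = random_X_indep[OF i random]
  have indepX: "indep_elements train_space ?D borel ?X"
    using indep_elements_compose[OF indep measurable_ident, of fst borel]
    by (simp add: borel_prod[symmetric])
  have inner: "(\<integral>\<^sup>+\<omega>. f ((d, ?X \<omega>), ?Y \<omega>) \<partial>M) = (\<integral>\<^sup>+\<omega>. g (d, ?X \<omega>) \<partial>M)" if "d \<in> space train_space" for d
  proof -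
    define h where "h = (\<lambda>(x, e). f ((d, x), matrix_sqrt (C x) *v e))"
    have h: "h \<in> borel_measurable (borel \<Otimes>\<^sub>M borel)" unfolding h_def using that by measurable
    have "(\<integral>\<^sup>+\<omega>. f ((d, ?X \<omega>), ?Y \<omega>) \<partial>M) = (\<integral>\<^sup>+\<omega>. h (?X \<omega>, \<E> (Test i) \<omega>) \<partial>M)"
      by (intro nn_integral_cong) (simp add: h_def response_eq[OF test_i])
    also have "\<dots> = (\<integral>\<^sup>+\<omega>. \<integral>\<^sup>+e. h (?X \<omega>, e) \<partial>noise_law \<partial>M)"
      using indep_elements_nn_integral[OF covariate_noise_indep[OF test_i test_i] h] noise_law[OF test_i] by simp
    finally show ?thesis by (simp add: h_def g_def)
  qed
  have "(\<integral>\<^sup>+\<omega>. f ((?D \<omega>, ?X \<omega>), ?Y \<omega>) \<partial>M) = (\<integral>\<^sup>+\<omega>. f' (?D \<omega>, (?X \<omega>, ?Y \<omega>)) \<partial>M)"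
    by (simp add: f'_def)
  also have "\<dots> = (\<integral>\<^sup>+\<omega>. \<integral>\<^sup>+z. f' (?D \<omega>, z) \<partial>distr M borel (\<lambda>\<omega>. (?X \<omega>, ?Y \<omega>)) \<partial>M)"
    by (rule indep_elements_nn_integral[OF indep]) measurable
  also have "\<dots> = (\<integral>\<^sup>+\<omega>. \<integral>\<^sup>+\<omega>'. f ((?D \<omega>, ?X \<omega>'), ?Y \<omega>') \<partial>M \<partial>M)"
  proof (intro nn_integral_cong)
    fix \<omega> assume "\<omega> \<in> space M"
    then have [simp]: "?D \<omega> \<in> space train_space" using measurable_space[OF train_data_measurable] by blast
    show "(\<integral>\<^sup>+z. f' (?D \<omega>, z) \<partial>distr M borel (\<lambda>\<omega>. (?X \<omega>, ?Y \<omega>))) = (\<integral>\<^sup>+\<omega>'. f ((?D \<omega>, ?X \<omega>'), ?Y \<omega>') \<partial>M)"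
    proof -
      have "(\<lambda>z. f' (?D \<omega>, z)) \<in> borel_measurable borel" by measurable
      then show ?thesis
        by (subst nn_integral_distr[OF pair_measurable[OF test_i]]) (simp_all add: f'_def)
    qed
  qed
  also have "\<dots> = (\<integral>\<^sup>+\<omega>. \<integral>\<^sup>+\<omega>'. g (?D \<omega>, ?X \<omega>') \<partial>M \<partial>M)"
    by (rule nn_integral_cong, rule inner, rule measurable_space[OF train_data_measurable])
  also have "\<dots> = (\<integral>\<^sup>+\<omega>. \<integral>\<^sup>+x. g (?D \<omega>, x) \<partial>distr M borel ?X \<partial>M)"
  proof (intro nn_integral_cong)
    fix \<omega> assume "\<omega> \<in> space M"
    then have [simp]: "?D \<omega> \<in> space train_space" using measurable_space[OF train_data_measurable] by blast
    show "(\<integral>\<^sup>+\<omega>'. g (?D \<omega>, ?X \<omega>') \<partial>M) = (\<integral>\<^sup>+x. g (?D \<omega>, x) \<partial>distr M borel ?X)"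
      by (subst nn_integral_distr) auto
  qed
  also have "\<dots> = (\<integral>\<^sup>+\<omega>. g (?D \<omega>, ?X \<omega>) \<partial>M)"
    by (rule indep_elements_nn_integral[OF indepX, symmetric]) measurable
  finally show "(\<integral>\<^sup>+\<omega>. f ((?D \<omega>, ?X \<omega>), ?Y \<omega>) \<partial>M) = (\<integral>\<^sup>+\<omega>. \<integral>\<^sup>+e. f ((?D \<omega>, ?X \<omega>),
      (case (?D \<omega>, ?X \<omega>) of (d, x) \<Rightarrow> matrix_sqrt (C x)) *v e) \<partial>noise_law \<partial>M)"
    by (simp add: g_def)
qed

text \<open>Choosing all but one of the sets in the definition of the Same-\<open>X\<close> setting to be the whole space
  isolates the conditional law of a single test response, and this is the conditional law of
  \<open>Y (Train i) = S(X (Train i)) e\<close> given \<open>X (Train i)\<close>.\<close>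

lemma same_X_cond_prob:
  assumes i: "i \<in> {1..n}" and same: "same_X M n X Y" and B[measurable]: "B \<in> sets borel"
  shows "AE \<omega> in M.
    real_cond_exp M (generated M (Train ` {1..n}) (\<lambda>\<alpha> \<omega>. (X \<alpha> \<omega>, Y \<alpha> \<omega>)))
      (\<lambda>\<omega>. indicator B (Y (Test i) \<omega>)) \<omega> =
    (\<integral>e. indicator B (matrix_sqrt (C (X (Train i) \<omega>)) *v e) \<partial>noise_law)"
proof -
  let ?G = "generated M (Train ` {1..n}) (\<lambda>\<alpha> \<omega>. (X \<alpha> \<omega>, Y \<alpha> \<omega>))"
  note train_i = obs_set_I(1)[OF i]
  note [measurable] = sqrt_true_cov_measurable responses_measurable[OF train_i]
    covariates_measurable[OF train_i] noise_measurable[OF train_i]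
  interpret P: prob_space noise_law by (rule prob_space_noise_law)
  define A where "A j = (if j = i then B else UNIV)" for j
  have "\<forall>j\<in>{1..n}. A j \<in> sets borel" by (simp add: A_def)
  then have cond: "AE \<omega> in M. real_cond_exp M ?G (\<lambda>\<omega>'. \<Prod>j=1..n. indicator (A j) (Y (Test j) \<omega>')) \<omega> =
      (\<Prod>j=1..n. real_cond_exp M (generated M {Train j} X) (\<lambda>\<omega>'. indicator (A j) (Y (Train j) \<omega>')) \<omega>)"
    using same by (simp add: same_X_def)
  have lhs: "(\<lambda>\<omega>'. \<Prod>j=1..n. indicator (A j) (Y (Test j) \<omega>')) = (\<lambda>\<omega>'. indicator B (Y (Test i) \<omega>') :: real)"
  proof
    fix \<omega>'
    have "(\<Prod>j=1..n. indicator (A j) (Y (Test j) \<omega>') :: real) =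
        (\<Prod>j=1..n. if j = i then indicator B (Y (Test i) \<omega>') else 1)"
      by (intro prod.cong) (auto simp: A_def)
    then show "(\<Prod>j=1..n. indicator (A j) (Y (Test j) \<omega>')) = (indicator B (Y (Test i) \<omega>') :: real)"
      using i by simp
  qed
  have "AE \<omega> in M. real_cond_exp M (generated M {Train j} X) (\<lambda>\<omega>'. indicator (A j) (Y (Train j) \<omega>')) \<omega> =
      (if j = i then real_cond_exp M (generated M {Train i} X) (\<lambda>\<omega>'. indicator B (Y (Train i) \<omega>')) \<omega> else 1)"
    if j: "j \<in> {1..n}" for j
  proof (cases "j = i")
    case False
    interpret F: sigma_finite_subalgebra M "generated M {Train j} X"
      using covariates_measurable[OF obs_set_I(1)[OF j]]
      by (intro sigma_finite_subalgebraI subalgebra_generated) simp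
    have "AE \<omega> in M. real_cond_exp M (generated M {Train j} X) (\<lambda>\<omega>'. 1) \<omega> = 1"
      by (rule F.real_cond_exp_F_meas) auto
    with False show ?thesis by (simp add: A_def)
  qed (simp add: A_def)
  then have "AE \<omega> in M. \<forall>j\<in>{1..n}. real_cond_exp M (generated M {Train j} X) (\<lambda>\<omega>'. indicator (A j) (Y (Train j) \<omega>')) \<omega> =
      (if j = i then real_cond_exp M (generated M {Train i} X) (\<lambda>\<omega>'. indicator B (Y (Train i) \<omega>')) \<omega> else 1)"
    by (intro AE_finite_allI) auto
  moreover have "AE \<omega> in M. real_cond_exp M (generated M {Train i} X) (\<lambda>\<omega>'. indicator B (Y (Train i) \<omega>')) \<omega> =
      (\<integral>e. indicator B (matrix_sqrt (C (X (Train i) \<omega>)) *v e) \<partial>noise_law)"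
  proof -
    define h where "h = (\<lambda>(x, e). indicator B (matrix_sqrt (C x) *v e) :: real)"
    have [measurable]: "h \<in> borel_measurable (borel \<Otimes>\<^sub>M borel)" unfolding h_def by measurable
    interpret F: sigma_finite_subalgebra M "generated M {Train i} X"
      by (intro sigma_finite_subalgebraI subalgebra_generated) simp
    have "AE \<omega> in M. real_cond_exp M (generated M {Train i} X) (\<lambda>\<omega>'. indicator B (Y (Train i) \<omega>')) \<omega> =
        real_cond_exp M (generated M {Train i} X) (\<lambda>\<omega>. h (X (Train i) \<omega>, \<E> (Train i) \<omega>)) \<omega>"
      by (rule F.real_cond_exp_cong) (auto simp: h_def response_eq[OF train_i])
    moreover have "AE \<omega> in M. real_cond_exp M (generated M {Train i} X) (\<lambda>\<omega>. h (X (Train i) \<omega>, \<E> (Train i) \<omega>)) \<omega>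
        = (\<integral>e. h (X (Train i) \<omega>, e) \<partial>distr M borel (\<E> (Train i)))"
    proof (rule real_cond_exp_generated_indep[where X = X and \<alpha> = "Train i", OF covariate_noise_indep[OF train_i train_i]])
      show "integrable (distr M borel (\<E> (Train i))) (\<lambda>e. h (x, e))" for x
        unfolding noise_law[OF train_i]
        by (rule P.integrable_const_bound[where B = 1]) (auto simp: h_def)
    qed measurable
    ultimately show ?thesis by eventually_elim (simp add: h_def noise_law[OF train_i])
  qed
  ultimately show ?thesis
    using cond unfolding lhs
  proof eventually_elim
    case (elim \<omega>)
    have "(\<Prod>j=1..n. real_cond_exp M (generated M {Train j} X) (\<lambda>\<omega>'. indicator (A j) (Y (Train j) \<omega>')) \<omega>) =
      (\<Prod>j=1..n. if j = i then real_cond_exp M (generated M {Train i} X) (\<lambda>\<omega>'. indicator B (Y (Train i) \<omega>')) \<omega> else 1)"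
      using elim(1) by (intro prod.cong) auto
    also have "\<dots> = real_cond_exp M (generated M {Train i} X) (\<lambda>\<omega>'. indicator B (Y (Train i) \<omega>')) \<omega>"
      using i by simp
    finally show ?case using elim(2,3) by simp
  qed
qed

text \<open>The conditional probabilities of \<open>same_X_cond_prob\<close> determine the joint law of the training data and
  the test response on rectangles, hence everywhere.\<close>

lemma resampled_test_same:
  assumes i: "i \<in> {1..n}" and same: "same_X M n X Y"
  shows "resampled_test i"
  unfolding resampled_test_def resampled_response_def
proof (intro conjI ballI)
  let ?G = "generated M (Train ` {1..n}) (\<lambda>\<alpha> \<omega>. (X \<alpha> \<omega>, Y \<alpha> \<omega>))"
  let ?N = "train_space \<Otimes>\<^sub>M (borel :: 'x measure)"
  note train_i = obs_set_I(1)[OF i] and test_i = obs_set_I(2)[OF i]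
  note [measurable] = train_data_measurable covariates_measurable[OF test_i] covariates_measurable[OF train_i]
    responses_measurable[OF test_i] sqrt_true_cov_measurable
  interpret P: prob_space noise_law by (rule prob_space_noise_law)
  interpret G: sigma_finite_subalgebra M ?G
    by (intro sigma_finite_subalgebraI subalgebra_generated) (auto intro!: pair_measurable obs_set_I)
  define T where "T \<omega> = (train_data n X Y \<omega>, X (Train i) \<omega>)" for \<omega>
  have T_eq: "(train_data n X Y \<omega>, X (Test i) \<omega>) = T \<omega>" if "\<omega> \<in> space M" for \<omega>
    using same i that by (auto simp: same_X_def T_def)
  have TG: "T \<in> ?G \<rightarrow>\<^sub>M ?N"
  proof -
    have pair: "(\<lambda>\<omega>. (X (Train j) \<omega>, Y (Train j) \<omega>)) \<in> borel_measurable ?G" if "j \<in> {1..n}" for j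
      using measurable_generated[of "Train j" "Train ` {1..n}" "\<lambda>\<alpha> \<omega>. (X \<alpha> \<omega>, Y \<alpha> \<omega>)" M] that by auto
    then have "X (Train i) \<in> borel_measurable ?G"
      using measurable_compose[OF pair[OF i], of fst borel] by (simp add: borel_prod[symmetric])
    then show ?thesis
      unfolding T_def train_data_def train_space_def
      by (intro measurable_Pair measurable_restrict pair) auto
  qed
  have TM[measurable]: "T \<in> M \<rightarrow>\<^sub>M ?N" using measurable_from_subalg[OF G.subalg TG] .
  define S where "S t = matrix_sqrt (C (snd t))" for t :: "(nat \<Rightarrow> 'x \<times> (real^'p)) \<times> 'x"
  have [measurable]: "S \<in> borel_measurable ?N" unfolding S_def by measurable
  \<comment> \<open>The joint laws of the training data with the actual test response and with one built from fresh noise.\<close>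
  define L1 where "L1 = distr M (?N \<Otimes>\<^sub>M borel) (\<lambda>\<omega>. (T \<omega>, Y (Test i) \<omega>))"
  define L2 where "L2 = distr (M \<Otimes>\<^sub>M noise_law) (?N \<Otimes>\<^sub>M borel) (\<lambda>(\<omega>, e). (T \<omega>, S (T \<omega>) *v e))"
  have rect: "emeasure L1 (A \<times> B) = emeasure L2 (A \<times> B)" if [measurable]: "A \<in> sets ?N" "B \<in> sets borel" for A B
  proof -
    define \<kappa> :: "'a \<Rightarrow> real" where "\<kappa> \<omega> = (\<integral>e. indicator B (S (T \<omega>) *v e) \<partial>noise_law)" for \<omega>
    have [measurable]: "\<kappa> \<in> borel_measurable M" unfolding \<kappa>_def by measurable
    have \<kappa>_nn: "(\<integral>\<^sup>+e. indicator B (S (T \<omega>) *v e) \<partial>noise_law) = ennreal (\<kappa> \<omega>)" if "\<omega> \<in> space M" for \<omega>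
    proof -
      have [measurable]: "(\<lambda>e. indicator B (S (T \<omega>) *v e) :: real) \<in> borel_measurable noise_law" by measurable
      have "integrable noise_law (\<lambda>e. indicator B (S (T \<omega>) *v e) :: real)"
        by (rule P.integrable_const_bound[where B = 1]) auto
      from nn_integral_eq_integral[OF this] show ?thesis by (simp add: \<kappa>_def ennreal_indicator)
    qed
    have \<kappa>_le: "0 \<le> \<kappa> \<omega>" "\<kappa> \<omega> \<le> 1" for \<omega>
      unfolding \<kappa>_def by (auto intro!: P.integral_le_const P.integrable_const_bound[where B = 1] split: split_indicator)
    have cond: "AE \<omega> in M. real_cond_exp M ?G (\<lambda>\<omega>. indicator B (Y (Test i) \<omega>)) \<omega> = \<kappa> \<omega>"
      using same_X_cond_prob[OF i same, of B] by (simp add: \<kappa>_def S_def T_def)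
    have int: "integrable M (\<lambda>\<omega>. indicator A (T \<omega>) * indicator B (Y (Test i) \<omega>) :: real)"
      by (rule integrable_const_bound[where B = 1]) (auto split: split_indicator)
    have int': "integrable M (\<lambda>\<omega>. indicator A (T \<omega>) * \<kappa> \<omega>)"
      using \<kappa>_le by (intro integrable_const_bound[where B = 1]) (auto split: split_indicator)
    have "emeasure L1 (A \<times> B) = (\<integral>\<^sup>+\<omega>. indicator (A \<times> B) (T \<omega>, Y (Test i) \<omega>) \<partial>M)"
      unfolding L1_def by (subst nn_integral_indicator[symmetric], simp, subst nn_integral_distr) auto
    also have "\<dots> = (\<integral>\<^sup>+\<omega>. ennreal (indicator A (T \<omega>) * indicator B (Y (Test i) \<omega>)) \<partial>M)"
      by (intro nn_integral_cong) (auto split: split_indicator)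
    also have "\<dots> = ennreal (\<integral>\<omega>. indicator A (T \<omega>) * indicator B (Y (Test i) \<omega>) \<partial>M)"
      by (rule nn_integral_eq_integral[OF int]) auto
    also have "(\<integral>\<omega>. indicator A (T \<omega>) * indicator B (Y (Test i) \<omega>) \<partial>M) =
        (\<integral>\<omega>. indicator A (T \<omega>) * real_cond_exp M ?G (\<lambda>\<omega>. indicator B (Y (Test i) \<omega>)) \<omega> \<partial>M)"
    proof (rule G.real_cond_exp_intg(2)[OF int, symmetric])
      show "(\<lambda>\<omega>. indicator A (T \<omega>) :: real) \<in> borel_measurable ?G"
        by (rule measurable_compose[OF TG]) simp
    qed measurable
    also have "\<dots> = (\<integral>\<omega>. indicator A (T \<omega>) * \<kappa> \<omega> \<partial>M)"
      using cond by (intro integral_cong_AE) auto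
    also have "ennreal \<dots> = (\<integral>\<^sup>+\<omega>. ennreal (indicator A (T \<omega>) * \<kappa> \<omega>) \<partial>M)"
      using \<kappa>_le by (intro nn_integral_eq_integral[symmetric] int') auto
    also have "\<dots> = (\<integral>\<^sup>+\<omega>. \<integral>\<^sup>+e. indicator (A \<times> B) (T \<omega>, S (T \<omega>) *v e) \<partial>noise_law \<partial>M)"
    proof (rule nn_integral_cong)
      fix \<omega> assume "\<omega> \<in> space M"
      then show "ennreal (indicator A (T \<omega>) * \<kappa> \<omega>) =
          (\<integral>\<^sup>+e. indicator (A \<times> B) (T \<omega>, S (T \<omega>) *v e) \<partial>noise_law)"
        by (cases "T \<omega> \<in> A") (simp_all add: \<kappa>_nn[symmetric] indicator_times)
    qed
    also have "\<dots> = emeasure L2 (A \<times> B)"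
      unfolding L2_def
      by (subst nn_integral_indicator[symmetric], simp, subst nn_integral_distr, simp, simp,
          subst P.nn_integral_fst[symmetric]) auto
    finally show ?thesis .
  qed
  have L: "L1 = L2"
  proof (rule measure_eqI_generator_eq)
    let ?E = "{a \<times> b |a b. a \<in> sets ?N \<and> b \<in> sets (borel :: (real^'p) measure)}"
    show "Int_stable ?E" by (rule Int_stable_pair_measure_generator)
    show "?E \<subseteq> Pow (space ?N \<times> space (borel :: (real^'p) measure))"
      by (rule pair_measure_closed)
    show "sets L1 = sigma_sets (space ?N \<times> space (borel :: (real^'p) measure)) ?E"
      "sets L2 = sigma_sets (space ?N \<times> space (borel :: (real^'p) measure)) ?E"
      by (simp_all add: L1_def L2_def sets_pair_measure)
    show "emeasure L1 R = emeasure L2 R" if "R \<in> ?E" for R using that rect by auto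
    show "range (\<lambda>_::nat. space ?N \<times> space (borel :: (real^'p) measure)) \<subseteq> ?E" by blast
    interpret L1: prob_space L1 unfolding L1_def by (rule prob_space_distr) simp
    show "emeasure L1 (space ?N \<times> space borel) \<noteq> \<infinity>" by simp
  qed simp
  show "(\<lambda>\<omega>. (train_data n X Y \<omega>, X (Test i) \<omega>)) \<in> M \<rightarrow>\<^sub>M ?N" by measurable
  show "Y (Test i) \<in> borel_measurable M" by measurable
  fix f :: "((nat \<Rightarrow> 'x \<times> (real^'p)) \<times> 'x) \<times> (real^'p) \<Rightarrow> ennreal"
  assume [measurable]: "f \<in> borel_measurable (?N \<Otimes>\<^sub>M borel)"
  have "(\<integral>\<^sup>+\<omega>. f ((train_data n X Y \<omega>, X (Test i) \<omega>), Y (Test i) \<omega>) \<partial>M) = (\<integral>\<^sup>+z. f z \<partial>L1)"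
    unfolding L1_def by (subst nn_integral_distr) (auto intro!: nn_integral_cong simp: T_eq)
  also have "\<dots> = (\<integral>\<^sup>+\<omega>. \<integral>\<^sup>+e. f (T \<omega>, S (T \<omega>) *v e) \<partial>noise_law \<partial>M)"
    unfolding L L2_def
    by (subst nn_integral_distr, simp, simp, subst P.nn_integral_fst[symmetric]) auto
  also have "\<dots> = (\<integral>\<^sup>+\<omega>. \<integral>\<^sup>+e. f ((train_data n X Y \<omega>, X (Test i) \<omega>),
      (case (train_data n X Y \<omega>, X (Test i) \<omega>) of (d, x) \<Rightarrow> matrix_sqrt (C x)) *v e) \<partial>noise_law \<partial>M)"
    by (intro nn_integral_cong) (simp only: T_eq S_def split_beta)
  finally show "(\<integral>\<^sup>+\<omega>. f ((train_data n X Y \<omega>, X (Test i) \<omega>), Y (Test i) \<omega>) \<partial>M) = \<dots>" .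
qed

lemma iid_covariate_distr:
  assumes "iid M K (\<lambda>\<alpha> \<omega>. (X \<alpha> \<omega>, Y \<alpha> \<omega>))" and "\<alpha> \<in> K" "\<beta> \<in> K" "K \<subseteq> obs_set n"
  shows "distr M borel (X \<alpha>) = distr M borel (X \<beta>)"
proof -
  have fst: "fst \<in> (borel :: ('x \<times> (real^'p)) measure) \<rightarrow>\<^sub>M borel" by (simp add: borel_prod[symmetric])
  have "distr M borel (X \<gamma>) = distr (distr M borel (\<lambda>\<omega>. (X \<gamma> \<omega>, Y \<gamma> \<omega>))) borel fst" if "\<gamma> \<in> K" for \<gamma>
    using pair_measurable[of \<gamma>] that assms(4) by (subst distr_distr[OF fst]) (auto simp: comp_def)
  moreover have "distr M borel (\<lambda>\<omega>. (X \<alpha> \<omega>, Y \<alpha> \<omega>)) = distr M borel (\<lambda>\<omega>. (X \<beta> \<omega>, Y \<beta> \<omega>))"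
    using assms unfolding iid_def by blast
  ultimately show ?thesis using assms by simp
qed

lemma random_X_exchange:
  assumes i: "i \<in> {1..n}" and random: "random_X M n X Y"
    and \<Phi>[measurable]: "\<Phi> \<in> borel_measurable (train_space \<Otimes>\<^sub>M borel)"
  shows "(\<integral>\<^sup>+\<omega>. \<Phi> (train_data n X Y \<omega>, X (Test i) \<omega>) \<partial>M) = (\<integral>\<^sup>+\<omega>. \<Phi> (train_data n X Y \<omega>, X (Test 1) \<omega>) \<partial>M)"
proof -
  have one: "1 \<in> {1..n}" using n by simp
  have eq: "(\<integral>\<^sup>+\<omega>. \<Phi> (train_data n X Y \<omega>, X (Test j) \<omega>) \<partial>M) =
      (\<integral>\<^sup>+\<omega>. \<integral>\<^sup>+x. \<Phi> (train_data n X Y \<omega>, x) \<partial>distr M borel (X (Test j)) \<partial>M)" if j: "j \<in> {1..n}" for j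
  proof (rule indep_elements_nn_integral[OF _ \<Phi>])
    show "indep_elements train_space (train_data n X Y) borel (X (Test j))"
      using indep_elements_compose[OF random_X_indep[OF j random] measurable_ident, of fst borel]
      by (simp add: borel_prod[symmetric])
  qed
  have "distr M borel (X (Test i)) = distr M borel (X (Test 1))"
    using random i one by (intro iid_covariate_distr[of "obs_set n"]) (auto simp: random_X_def intro: obs_set_I)
  then show ?thesis by (simp only: eq[OF i] eq[OF one])
qed

text \<open>Swapping the observations \<open>1\<close> and \<open>i\<close> preserves the law of the training sample and the value of the
  estimator, and carries \<open>X (Train 1)\<close> to \<open>X (Train i)\<close>.\<close>

lemma same_X_exchange:
  fixes bhat :: "(nat \<Rightarrow> 'x \<times> (real^'p)) \<Rightarrow> real^'k"
  assumes i: "i \<in> {1..n}" and same: "same_X M n X Y"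
    and inv: "numbering_invariant M n bhat X Y" and bhat[measurable]: "bhat \<in> borel_measurable train_space"
    and \<Phi>[measurable]: "\<Phi> \<in> borel_measurable (borel \<Otimes>\<^sub>M borel)"
  shows "(\<integral>\<^sup>+\<omega>. \<Phi> (bhat (train_data n X Y \<omega>), X (Test i) \<omega>) \<partial>M) =
    (\<integral>\<^sup>+\<omega>. \<Phi> (bhat (train_data n X Y \<omega>), X (Test 1) \<omega>) \<partial>M)"
proof -
  let ?D = "train_data n X Y" and ?\<pi> = "Transposition.transpose 1 i"
  have one: "1 \<in> {1..n}" using n by simp
  have \<pi>: "?\<pi> permutes {1..n}" using i one by (rule permutes_swap_id[rotated])
  define D' where "D' \<omega> = (\<lambda>j\<in>{1..n}. ?D \<omega> (?\<pi> j))" for \<omega>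
  have iid: "iid M (Train ` {1..n}) (\<lambda>\<alpha> \<omega>. (X \<alpha> \<omega>, Y \<alpha> \<omega>))" using same by (simp add: same_X_def)
  note [measurable] = train_data_measurable
  have in_range: "?\<pi> j \<in> {1..n}" if "j \<in> {1..n}" for j using permutes_in_image[OF \<pi>] that by blast
  have D'_eq: "D' \<omega> = (\<lambda>j\<in>{1..n}. (X (Train (?\<pi> j)) \<omega>, Y (Train (?\<pi> j)) \<omega>))" for \<omega>
    unfolding D'_def train_data_def using in_range by (intro restrict_ext) simp
  have D'_meas[measurable]: "D' \<in> M \<rightarrow>\<^sub>M train_space"
    unfolding D'_eq[abs_def] train_space_def
    by (intro measurable_restrict pair_measurable obs_set_I in_range)
  have perm_law: "distr M train_space (\<lambda>\<omega>. \<lambda>j\<in>{1..n}. (X (Train (\<sigma> j)) \<omega>, Y (Train (\<sigma> j)) \<omega>)) =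
      Pi\<^sub>M {1..n} (\<lambda>_. distr M borel (\<lambda>\<omega>. (X (Train 1) \<omega>, Y (Train 1) \<omega>)))"
    if "inj_on \<sigma> {1..n}" "\<And>j. j \<in> {1..n} \<Longrightarrow> \<sigma> j \<in> {1..n}" for \<sigma>
    unfolding train_space_def
  proof (rule iid_distr_reindex[OF iid])
    show "inj_on (\<lambda>j. Train (\<sigma> j)) {1..n}" by (rule inj_onI, rule inj_onD[OF that(1)]) simp_all
    show "(\<lambda>j. Train (\<sigma> j)) \<in> {1..n} \<rightarrow> Train ` {1..n}" using that(2) by blast
    show "Train 1 \<in> Train ` {1..n}" using one by blast
  qed
  have law: "distr M train_space D' = distr M train_space ?D"
    unfolding D'_eq[abs_def] train_data_def[abs_def]
    by (rule trans[OF perm_law perm_law[of "\<lambda>j. j", symmetric]])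
      (use in_range permutes_inj_on[OF \<pi>] in auto)
  have ev[measurable]: "(\<lambda>d. fst (d 1)) \<in> borel_measurable train_space"
  proof -
    have "(\<lambda>d. d 1) \<in> train_space \<rightarrow>\<^sub>M (borel :: ('x \<times> (real^'p)) measure)"
      unfolding train_space_def by (rule measurable_component_singleton[OF one])
    moreover have "fst \<in> (borel :: ('x \<times> (real^'p)) measure) \<rightarrow>\<^sub>M borel"
      by (simp add: borel_prod[symmetric])
    ultimately show ?thesis by (rule measurable_compose)
  qed
  define F where "F d = \<Phi> (bhat d, fst (d 1))" for d
  have [measurable]: "F \<in> borel_measurable train_space" unfolding F_def by measurable
  have X1: "X (Test 1) \<omega> = fst (?D \<omega> 1)" and Xi: "X (Test i) \<omega> = fst (D' \<omega> 1)" if "\<omega> \<in> space M" for \<omega>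
    using same that i one by (auto simp: same_X_def train_data_def D'_eq)
  have "(\<integral>\<^sup>+\<omega>. \<Phi> (bhat (?D \<omega>), X (Test 1) \<omega>) \<partial>M) = (\<integral>\<^sup>+d. F d \<partial>distr M train_space ?D)"
    by (subst nn_integral_distr) (auto simp: F_def X1[unfolded One_nat_def] intro!: nn_integral_cong)
  also have "\<dots> = (\<integral>\<^sup>+\<omega>. F (D' \<omega>) \<partial>M)"
    unfolding law[symmetric] by (subst nn_integral_distr) auto
  also have "\<dots> = (\<integral>\<^sup>+\<omega>. \<Phi> (bhat (?D \<omega>), X (Test i) \<omega>) \<partial>M)"
  proof (rule nn_integral_cong_AE)
    have "AE \<omega> in M. bhat (D' \<omega>) = bhat (?D \<omega>)"
      using inv unfolding numbering_invariant_def D'_def by (rule eventually_mono) (use \<pi> in blast)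
    with AE_space show "AE \<omega> in M. F (D' \<omega>) = \<Phi> (bhat (?D \<omega>), X (Test i) \<omega>)"
      by eventually_elim (simp add: F_def Xi)
  qed
  finally show ?thesis by simp
qed

end

section \<open>Decomposition of the expected test error\<close>

locale fitted_covariance_regression = covariance_regression M n C X Y \<E> \<mu>4
  for M :: "'a measure" and n and C :: "'x::euclidean_space \<Rightarrow> real^'p^'p" and X Y \<E> \<mu>4 +
  fixes W V :: "'x \<Rightarrow> real^('p \<times> 'p)^('p \<times> 'p)" and Cm :: "real^'k \<Rightarrow> 'x \<Rightarrow> real^'p^'p"
    and bhat :: "(nat \<Rightarrow> 'x \<times> (real^'p)) \<Rightarrow> real^'k"
  assumes fit: "fitted_model M n W Cm bhat X Y" and V: "cond_cov_function M n X Y V"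
    and integrable_Te: "integrable M (Te n W Cm bhat X Y)"
begin

definition weighted_fit :: "real^'k \<Rightarrow> 'x \<Rightarrow> real^('p \<times> 'p)" where
  "weighted_fit \<beta> x = matrix_sqrt (W x) *v vec_mat (Cm \<beta> x)"

text \<open>The function \<open>\<nu>\<^sup>2\<close>, computed from the law of the noise instead of the conditional covariance \<open>V\<close>,
  whose values are determined only up to null sets of the covariates.\<close>

definition noise_level :: "'x \<Rightarrow> real" where
  "noise_level x = noise_var noise_law (matrix_sqrt (W x)) (matrix_sqrt (C x))"

definition fit_error :: "real^'k \<Rightarrow> 'x \<Rightarrow> real" where
  "fit_error \<beta> x = (norm (weighted_fit \<beta> x - C_weighted W C x))^2"

lemma weight_psd: "possemidef_matrix (W x)"
  using fit by (simp add: fitted_model_def)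

lemma sqrt_weight_measurable [measurable]: "(\<lambda>x. matrix_sqrt (W x)) \<in> borel_measurable borel"
  using fit by (intro matrix_sqrt_measurable weight_psd) (simp add: fitted_model_def)

lemma true_cov_measurable [measurable]: "C \<in> borel_measurable borel"
  using tm by (simp add: true_model_def)

lemma bhat_measurable [measurable]: "bhat \<in> borel_measurable train_space"
  using fit by (simp add: fitted_model_def train_space_def)

lemma weighted_fit_measurable [measurable]:
  "(\<lambda>(\<beta>, x). weighted_fit \<beta> x) \<in> borel_measurable (borel \<Otimes>\<^sub>M borel)"
proof -
  have [measurable]: "(\<lambda>z. Cm (fst z) (snd z)) \<in> borel_measurable (borel \<Otimes>\<^sub>M borel)"
    using fit by (simp add: fitted_model_def split_beta')
  show ?thesis unfolding weighted_fit_def split_beta' by measurable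
qed

lemma C_weighted_measurable [measurable]: "C_weighted W C \<in> borel_measurable borel"
  unfolding C_weighted_def[abs_def] by measurable

lemma fit_error_measurable [measurable]:
  "(\<lambda>(\<beta>, x). fit_error \<beta> x) \<in> borel_measurable (borel \<Otimes>\<^sub>M borel)"
  using weighted_fit_measurable unfolding fit_error_def split_beta' by measurable

lemma noise_level_measurable [measurable]: "noise_level \<in> borel_measurable borel"
  unfolding noise_level_def[abs_def]
  by (intro borel_measurable_noise_var white_noise_law sqrt_weight_measurable sqrt_true_cov_measurable)

lemma noise_level_nonneg: "0 \<le> noise_level x"
  by (simp add: noise_level_def noise_var_def)

lemma C_hat_weighted_eq: "C_hat_weighted n W Cm bhat X Y \<omega> x = weighted_fit (bhat (train_data n X Y \<omega>)) x"
  by (simp add: C_hat_weighted_def weighted_fit_def)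

definition pred_error :: "nat \<Rightarrow> 'a \<Rightarrow> real" where
  "pred_error i \<omega> = (norm (matrix_sqrt (W (X (Test i) \<omega>)) *v vec_mat (outer (Y (Test i) \<omega>)) -
     weighted_fit (bhat (train_data n X Y \<omega>)) (X (Test i) \<omega>)))^2"

lemma Te_eq: "Te n W Cm bhat X Y \<omega> = 1 / real n * (\<Sum>i=1..n. pred_error i \<omega>)"
  unfolding Te_def test_error_def
  by (intro arg_cong2[where f = "(*)"] sum.cong refl)
    (simp add: Let_def test_data_def pred_error_def weighted_fit_def
      quadratic_form_eq_norm_matrix_sqrt[OF weight_psd] matrix_vector_mult_diff_distrib)

lemma fitted_value_measurable:
  assumes "\<alpha> \<in> obs_set n"
  shows "(\<lambda>\<omega>. weighted_fit (bhat (train_data n X Y \<omega>)) (X \<alpha> \<omega>)) \<in> borel_measurable M"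
proof -
  note [measurable] = train_data_measurable covariates_measurable[OF assms]
  have "(\<lambda>\<omega>. (bhat (train_data n X Y \<omega>), X \<alpha> \<omega>)) \<in> M \<rightarrow>\<^sub>M borel \<Otimes>\<^sub>M borel" by measurable
  from measurable_compose[OF this weighted_fit_measurable] show ?thesis by simp
qed

lemma pred_error_measurable: "i \<in> {1..n} \<Longrightarrow> pred_error i \<in> borel_measurable M"
  using fitted_value_measurable[OF obs_set_I(2)] covariates_measurable[OF obs_set_I(2)]
    responses_measurable[OF obs_set_I(2)] sqrt_weight_measurable
  unfolding pred_error_def[abs_def] by measurable

lemma pred_error_integrable:
  assumes i: "i \<in> {1..n}"
  shows "integrable M (pred_error i)"
proof (rule Bochner_Integration.integrable_bound)
  show "integrable M (\<lambda>\<omega>. real n * Te n W Cm bhat X Y \<omega>)" using integrable_Te by simp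
  show "AE \<omega> in M. norm (pred_error i \<omega>) \<le> norm (real n * Te n W Cm bhat X Y \<omega>)"
  proof (rule AE_I2)
    fix \<omega>
    have "pred_error i \<omega> \<le> (\<Sum>j=1..n. pred_error j \<omega>)"
      by (rule member_le_sum[OF i]) (auto simp: pred_error_def)
    also have "\<dots> = real n * Te n W Cm bhat X Y \<omega>" using n by (simp add: Te_eq)
    finally show "norm (pred_error i \<omega>) \<le> norm (real n * Te n W Cm bhat X Y \<omega>)"
      by (simp add: pred_error_def)
  qed
qed (rule pred_error_measurable[OF i])

text \<open>The two parts add up in \<open>[0, \<infinity>]\<close> before their finiteness is known; finiteness of the sum then
  makes both integrable.\<close>

lemma pred_error_decomposition:
  assumes i: "i \<in> {1..n}" and res: "resampled_test i"
  shows "integrable M (\<lambda>\<omega>. noise_level (X (Test i) \<omega>))"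
    and "integrable M (\<lambda>\<omega>. fit_error (bhat (train_data n X Y \<omega>)) (X (Test i) \<omega>))"
    and "(\<integral>\<omega>. pred_error i \<omega> \<partial>M) = (\<integral>\<omega>. noise_level (X (Test i) \<omega>) \<partial>M) +
      (\<integral>\<omega>. fit_error (bhat (train_data n X Y \<omega>)) (X (Test i) \<omega>) \<partial>M)"
proof -
  let ?D = "train_data n X Y" and ?X = "X (Test i)"
  note test_i = obs_set_I(2)[OF i]
  note [measurable] = sqrt_true_cov_measurable covariates_measurable[OF test_i] train_data_measurable
    fitted_value_measurable[OF test_i]
  have fm[measurable]: "(\<lambda>\<omega>. fit_error (bhat (?D \<omega>)) (?X \<omega>)) \<in> borel_measurable M"
    unfolding fit_error_def by measurable
  have zm: "(\<lambda>(d, x). weighted_fit (bhat d) x) \<in> borel_measurable (train_space \<Otimes>\<^sub>M borel)"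
  proof -
    have "(\<lambda>(d, x). (bhat d, x)) \<in> train_space \<Otimes>\<^sub>M borel \<rightarrow>\<^sub>M borel \<Otimes>\<^sub>M (borel :: 'x measure)" by measurable
    from measurable_compose[OF this weighted_fit_measurable] show ?thesis by (simp add: split_beta')
  qed
  have "(\<integral>\<^sup>+\<omega>. ennreal (pred_error i \<omega>) \<partial>M) = (\<integral>\<^sup>+\<omega>. ennreal (noise_level (?X \<omega>)) \<partial>M) +
      (\<integral>\<^sup>+\<omega>. ennreal (fit_error (bhat (?D \<omega>)) (?X \<omega>)) \<partial>M)"
    using resampled_prediction_error[OF res[unfolded resampled_test_def] white_noise_law, of
        "\<lambda>(d, x). matrix_sqrt (W x)" "\<lambda>(d, x). weighted_fit (bhat d) x"] zm sqrt_true_cov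
    by (simp add: pred_error_def noise_level_def fit_error_def C_weighted_def split_beta')
  moreover have "(\<integral>\<^sup>+\<omega>. ennreal (pred_error i \<omega>) \<partial>M) = ennreal (\<integral>\<omega>. pred_error i \<omega> \<partial>M)"
    by (rule nn_integral_eq_integral[OF pred_error_integrable[OF i]]) (simp add: pred_error_def)
  ultimately have eq: "(\<integral>\<^sup>+\<omega>. ennreal (noise_level (?X \<omega>)) \<partial>M) +
      (\<integral>\<^sup>+\<omega>. ennreal (fit_error (bhat (?D \<omega>)) (?X \<omega>)) \<partial>M) = ennreal (\<integral>\<omega>. pred_error i \<omega> \<partial>M)"
    by simp
  then have "(\<integral>\<^sup>+\<omega>. ennreal (noise_level (?X \<omega>)) \<partial>M) +
      (\<integral>\<^sup>+\<omega>. ennreal (fit_error (bhat (?D \<omega>)) (?X \<omega>)) \<partial>M) < \<infinity>"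
    by simp
  then have fin: "(\<integral>\<^sup>+\<omega>. ennreal (noise_level (?X \<omega>)) \<partial>M) < \<infinity>"
      "(\<integral>\<^sup>+\<omega>. ennreal (fit_error (bhat (?D \<omega>)) (?X \<omega>)) \<partial>M) < \<infinity>"
    by (simp_all add: ennreal_add_less_top)
  show int1: "integrable M (\<lambda>\<omega>. noise_level (?X \<omega>))"
    by (rule integrableI_nonneg) (use fin noise_level_nonneg in auto)
  show int2: "integrable M (\<lambda>\<omega>. fit_error (bhat (?D \<omega>)) (?X \<omega>))"
    by (rule integrableI_nonneg) (use fin in \<open>auto simp: fit_error_def[of "bhat _"]\<close>)
  have nonneg: "0 \<le> (\<integral>\<omega>. noise_level (?X \<omega>) \<partial>M)" "0 \<le> (\<integral>\<omega>. fit_error (bhat (?D \<omega>)) (?X \<omega>) \<partial>M)"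
    "0 \<le> (\<integral>\<omega>. pred_error i \<omega> \<partial>M)"
    by (auto intro!: integral_nonneg_AE simp: noise_level_nonneg fit_error_def pred_error_def)
  have "ennreal (\<integral>\<omega>. pred_error i \<omega> \<partial>M) = ennreal ((\<integral>\<omega>. noise_level (?X \<omega>) \<partial>M) +
      (\<integral>\<omega>. fit_error (bhat (?D \<omega>)) (?X \<omega>) \<partial>M))"
    using nonneg unfolding eq[symmetric]
    by (subst nn_integral_eq_integral[OF int1], simp add: noise_level_nonneg,
        subst nn_integral_eq_integral[OF int2], simp add: fit_error_def) (simp add: ennreal_plus)
  then show "(\<integral>\<omega>. pred_error i \<omega> \<partial>M) = (\<integral>\<omega>. noise_level (?X \<omega>) \<partial>M) +
      (\<integral>\<omega>. fit_error (bhat (?D \<omega>)) (?X \<omega>) \<partial>M)"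
    using nonneg by (subst (asm) ennreal_inj) auto
qed

lemma Err_decomposition:
  assumes res: "\<And>i. i \<in> {1..n} \<Longrightarrow> resampled_test i"
  shows "Err M n W Cm bhat X Y = 1 / real n * (\<Sum>i=1..n. \<integral>\<omega>. noise_level (X (Test i) \<omega>) \<partial>M) +
    1 / real n * (\<Sum>i=1..n. \<integral>\<omega>. fit_error (bhat (train_data n X Y \<omega>)) (X (Test i) \<omega>) \<partial>M)"
proof -
  have "Err M n W Cm bhat X Y = 1 / real n * (\<integral>\<omega>. (\<Sum>i=1..n. pred_error i \<omega>) \<partial>M)"
    unfolding Err_def Te_eq by (rule integral_mult_right_zero)
  also have "(\<integral>\<omega>. (\<Sum>i=1..n. pred_error i \<omega>) \<partial>M) = (\<Sum>i=1..n. \<integral>\<omega>. pred_error i \<omega> \<partial>M)"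
    by (rule Bochner_Integration.integral_sum) (rule pred_error_integrable)
  also have "\<dots> = (\<Sum>i=1..n. (\<integral>\<omega>. noise_level (X (Test i) \<omega>) \<partial>M) +
      (\<integral>\<omega>. fit_error (bhat (train_data n X Y \<omega>)) (X (Test i) \<omega>) \<partial>M))"
    by (intro sum.cong refl pred_error_decomposition(3) res)
  finally show ?thesis by (simp only: sum.distrib distrib_left)
qed

text \<open>Equal contributions of all test labels turn the averages over \<open>i\<close> into single expectations. The
  noise part depends on the law of the covariate only, so it may be evaluated at \<open>X (Train 1)\<close>.\<close>

lemma Err_exchangeable:
  assumes res: "\<And>i. i \<in> {1..n} \<Longrightarrow> resampled_test i"
    and law: "\<And>i. i \<in> {1..n} \<Longrightarrow> distr M borel (X (Test i)) = distr M borel (X (Train 1))"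
    and exch: "\<And>i. i \<in> {1..n} \<Longrightarrow>
      (\<integral>\<^sup>+\<omega>. ennreal (fit_error (bhat (train_data n X Y \<omega>)) (X (Test i) \<omega>)) \<partial>M) =
      (\<integral>\<^sup>+\<omega>. ennreal (fit_error (bhat (train_data n X Y \<omega>)) (X (Test 1) \<omega>)) \<partial>M)"
  shows "Err M n W Cm bhat X Y = (\<integral>\<omega>. nu2 W V (X (Train 1) \<omega>) \<partial>M) +
    (\<integral>\<omega>. fit_error (bhat (train_data n X Y \<omega>)) (X (Test 1) \<omega>) \<partial>M)"
proof -
  have one: "1 \<in> {1..n}" using n by simp
  note train_1 = obs_set_I(1)[OF one]
  note [measurable] = covariates_measurable[OF train_1]
  have noise: "(\<integral>\<omega>. noise_level (X (Test i) \<omega>) \<partial>M) = (\<integral>\<omega>. nu2 W V (X (Train 1) \<omega>) \<partial>M)"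
    if i: "i \<in> {1..n}" for i
  proof -
    note [measurable] = covariates_measurable[OF obs_set_I(2)[OF i]]
    have "(\<integral>\<omega>. noise_level (X (Test i) \<omega>) \<partial>M) = (\<integral>x. noise_level x \<partial>distr M borel (X (Test i)))"
      by (rule integral_distr[symmetric]) measurable
    also have "\<dots> = (\<integral>\<omega>. noise_level (X (Train 1) \<omega>) \<partial>M)"
      unfolding law[OF i] by (rule integral_distr) measurable
    also have "\<dots> = (\<integral>\<omega>. nu2 W V (X (Train 1) \<omega>) \<partial>M)"
    proof (rule integral_cong_AE)
      have [measurable]: "V \<in> borel_measurable borel" "W \<in> borel_measurable borel"
        using V fit by (simp_all add: cond_cov_function_def fitted_model_def)
      show "(\<lambda>\<omega>. nu2 W V (X (Train 1) \<omega>)) \<in> borel_measurable M"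
        unfolding nu2_def trace_def matrix_matrix_mult_def vec_lambda_beta by measurable
      show "AE \<omega> in M. noise_level (X (Train 1) \<omega>) = nu2 W V (X (Train 1) \<omega>)"
        using nu2_eq_noise_var[where W = W, OF train_1 V weight_psd]
        by eventually_elim (simp only: noise_law[OF train_1] noise_level_def)
    qed measurable
    finally show ?thesis .
  qed
  have fit_err: "(\<integral>\<omega>. fit_error (bhat (train_data n X Y \<omega>)) (X (Test i) \<omega>) \<partial>M) =
      (\<integral>\<omega>. fit_error (bhat (train_data n X Y \<omega>)) (X (Test 1) \<omega>) \<partial>M)" if i: "i \<in> {1..n}" for i
    using exch[OF i] pred_error_decomposition(2)[OF i res[OF i]] pred_error_decomposition(2)[OF one res[OF one]]
    by (simp add: integral_eq_nn_integral fit_error_def borel_measurable_integrable)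
  have "Err M n W Cm bhat X Y = 1 / real n * (\<Sum>i=1..n. \<integral>\<omega>. nu2 W V (X (Train 1) \<omega>) \<partial>M) +
    1 / real n * (\<Sum>i=1..n. \<integral>\<omega>. fit_error (bhat (train_data n X Y \<omega>)) (X (Test 1) \<omega>) \<partial>M)"
    by (rule trans[OF Err_decomposition], erule res)
      (intro arg_cong2[where f = "(+)"] arg_cong2[where f = "(*)"] sum.cong refl noise fit_err)
  then show ?thesis using n by simp
qed

lemma fit_error_bias_variance:
  assumes \<alpha>: "\<alpha> \<in> obs_set n" and F: "subalgebra M F" and XF: "X \<alpha> \<in> borel_measurable F"
    and int: "integrable M (\<lambda>\<omega>. fit_error (bhat (train_data n X Y \<omega>)) (X \<alpha> \<omega>))"
  defines "Z \<equiv> \<lambda>\<omega>. C_hat_weighted n W Cm bhat X Y \<omega> (X \<alpha> \<omega>)"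
  shows "(\<integral>\<omega>. fit_error (bhat (train_data n X Y \<omega>)) (X \<alpha> \<omega>) \<partial>M) =
    (\<integral>\<omega>. (norm (cond_mean M F Z \<omega> - C_weighted W C (X \<alpha> \<omega>)))^2 \<partial>M) +
    (\<integral>\<omega>. trace (cond_cov M F Z \<omega>) \<partial>M)"
  using bias_variance_given_subalgebra[OF F measurable_compose[OF XF C_weighted_measurable]
      fitted_value_measurable[OF \<alpha>]] int
  by (simp add: fit_error_def Z_def C_hat_weighted_eq)

text \<open>Constant covariates turn the almost sure identity for \<open>\<nu>\<^sup>2(X)\<close> into an identity at each design point,
  and the error of the fit at \<open>x i\<close> splits by the unconditional bias-variance identity.\<close>

proposition Err_fixed:
  assumes fixed: "fixed_X M n x X"
    and fin: "\<And>i. i \<in> {1..n} \<Longrightarrow> covariance_finite M (\<lambda>\<omega>. C_hat_weighted n W Cm bhat X Y \<omega> (x i))"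
  shows "Err M n W Cm bhat X Y =
    1 / real n * (\<Sum>i=1..n. nu2 W V (x i)) +
    1 / real n * (\<Sum>i=1..n.
      (norm ((\<integral>\<omega>. C_hat_weighted n W Cm bhat X Y \<omega> (x i) \<partial>M) - C_weighted W C (x i)))^2) +
    1 / real n * (\<Sum>i=1..n. trace (covariance_matrix M (\<lambda>\<omega>. C_hat_weighted n W Cm bhat X Y \<omega> (x i))))"
proof -
  have X: "X (Test i) \<omega> = x i" if "i \<in> {1..n}" "\<omega> \<in> space M" for i \<omega>
    using fixed that by (auto simp: fixed_X_def)
  have res: "resampled_test i" if "i \<in> {1..n}" for i
    using that fixed by (rule resampled_test_fixed)
  have noise: "(\<integral>\<omega>. noise_level (X (Test i) \<omega>) \<partial>M) = nu2 W V (x i)" if i: "i \<in> {1..n}" for i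
  proof -
    note test_i = obs_set_I(2)[OF i]
    have "AE \<omega> in M. nu2 W V (x i) = noise_level (x i)"
      using nu2_eq_noise_var[where W = W, OF test_i V weight_psd] AE_space
      by eventually_elim (simp add: noise_law[OF test_i] noise_level_def X[OF i])
    then have "nu2 W V (x i) = noise_level (x i)" by (simp add: AE_const)
    moreover have "(\<integral>\<omega>. noise_level (X (Test i) \<omega>) \<partial>M) = (\<integral>\<omega>. noise_level (x i) \<partial>M)"
      by (rule Bochner_Integration.integral_cong) (simp_all add: X[OF i])
    ultimately show ?thesis by (simp add: prob_space)
  qed
  have fit_err: "(\<integral>\<omega>. fit_error (bhat (train_data n X Y \<omega>)) (X (Test i) \<omega>) \<partial>M) =
      (norm ((\<integral>\<omega>. C_hat_weighted n W Cm bhat X Y \<omega> (x i) \<partial>M) - C_weighted W C (x i)))^2 +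
      trace (covariance_matrix M (\<lambda>\<omega>. C_hat_weighted n W Cm bhat X Y \<omega> (x i)))" if i: "i \<in> {1..n}" for i
  proof -
    have "(\<integral>\<omega>. fit_error (bhat (train_data n X Y \<omega>)) (X (Test i) \<omega>) \<partial>M) =
      (\<integral>\<omega>. (norm (C_hat_weighted n W Cm bhat X Y \<omega> (x i) - C_weighted W C (x i)))^2 \<partial>M)"
      by (rule Bochner_Integration.integral_cong) (simp_all add: X[OF i] fit_error_def C_hat_weighted_eq)
    then show ?thesis using bias_variance[OF fin[OF i]] by simp
  qed
  have "Err M n W Cm bhat X Y = 1 / real n * (\<Sum>i=1..n. nu2 W V (x i)) +
    1 / real n * (\<Sum>i=1..n. (norm ((\<integral>\<omega>. C_hat_weighted n W Cm bhat X Y \<omega> (x i) \<partial>M) - C_weighted W C (x i)))^2 +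
      trace (covariance_matrix M (\<lambda>\<omega>. C_hat_weighted n W Cm bhat X Y \<omega> (x i))))"
    by (rule trans[OF Err_decomposition], erule res)
      (intro arg_cong2[where f = "(+)"] arg_cong2[where f = "(*)"] sum.cong refl noise fit_err)
  then show ?thesis by (simp only: sum.distrib distrib_left add.assoc)
qed

proposition Err_random:
  assumes random: "random_X M n X Y"
  defines "F \<equiv> generated M (Train ` {1..n} \<union> {Test 1}) X"
    and "Z \<equiv> \<lambda>\<omega>. C_hat_weighted n W Cm bhat X Y \<omega> (X (Test 1) \<omega>)"
  shows "Err M n W Cm bhat X Y = (\<integral>\<omega>. nu2 W V (X (Train 1) \<omega>) \<partial>M) +
    (\<integral>\<omega>. (norm (cond_mean M F Z \<omega> - C_weighted W C (X (Test 1) \<omega>)))^2 \<partial>M) +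
    (\<integral>\<omega>. trace (cond_cov M F Z \<omega>) \<partial>M)"
proof -
  have one: "1 \<in> {1..n}" using n by simp
  note res = resampled_test_random[OF _ random]
  have "Err M n W Cm bhat X Y = (\<integral>\<omega>. nu2 W V (X (Train 1) \<omega>) \<partial>M) +
    (\<integral>\<omega>. fit_error (bhat (train_data n X Y \<omega>)) (X (Test 1) \<omega>) \<partial>M)"
  proof (rule Err_exchangeable[OF res])
    fix i assume i: "i \<in> {1..n}"
    show "distr M borel (X (Test i)) = distr M borel (X (Train 1))"
      using random i one
      by (intro iid_covariate_distr[of "obs_set n"]) (auto simp: random_X_def intro: obs_set_I)
    have "(\<lambda>(d, x). ennreal (fit_error (bhat d) x)) \<in> borel_measurable (train_space \<Otimes>\<^sub>M borel)"
    proof -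
      have "(\<lambda>(d, x). (bhat d, x)) \<in> train_space \<Otimes>\<^sub>M borel \<rightarrow>\<^sub>M borel \<Otimes>\<^sub>M (borel :: 'x measure)" by measurable
      from measurable_compose[OF this fit_error_measurable] show ?thesis by (simp add: split_beta')
    qed
    from random_X_exchange[OF i random this]
    show "(\<integral>\<^sup>+\<omega>. ennreal (fit_error (bhat (train_data n X Y \<omega>)) (X (Test i) \<omega>)) \<partial>M) =
      (\<integral>\<^sup>+\<omega>. ennreal (fit_error (bhat (train_data n X Y \<omega>)) (X (Test 1) \<omega>)) \<partial>M)"
      by simp
  qed
  moreover have "subalgebra M F"
    unfolding F_def using one by (intro subalgebra_generated covariates_measurable) (auto intro: obs_set_I)
  moreover have "X (Test 1) \<in> borel_measurable F"
    unfolding F_def by (rule measurable_generated) simp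
  ultimately show ?thesis
    using fit_error_bias_variance[OF obs_set_I(2)[OF one], of F] pred_error_decomposition(2)[OF one res[OF one]]
    by (simp add: Z_def)
qed

proposition Err_same:
  assumes same: "same_X M n X Y" and inv: "numbering_invariant M n bhat X Y"
  defines "F \<equiv> generated M (Train ` {1..n}) X"
    and "Z \<equiv> \<lambda>\<omega>. C_hat_weighted n W Cm bhat X Y \<omega> (X (Train 1) \<omega>)"
  shows "Err M n W Cm bhat X Y = (\<integral>\<omega>. nu2 W V (X (Train 1) \<omega>) \<partial>M) +
    (\<integral>\<omega>. (norm (cond_mean M F Z \<omega> - C_weighted W C (X (Train 1) \<omega>)))^2 \<partial>M) +
    (\<integral>\<omega>. trace (cond_cov M F Z \<omega>) \<partial>M)"
proof -
  have one: "1 \<in> {1..n}" using n by simp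
  note res = resampled_test_same[OF _ same]
  have X: "X (Test i) \<omega> = X (Train i) \<omega>" if "i \<in> {1..n}" "\<omega> \<in> space M" for i \<omega>
    using same that by (auto simp: same_X_def)
  have "Err M n W Cm bhat X Y = (\<integral>\<omega>. nu2 W V (X (Train 1) \<omega>) \<partial>M) +
    (\<integral>\<omega>. fit_error (bhat (train_data n X Y \<omega>)) (X (Test 1) \<omega>) \<partial>M)"
  proof (rule Err_exchangeable[OF res])
    fix i assume i: "i \<in> {1..n}"
    have "distr M borel (X (Test i)) = distr M borel (X (Train i))"
      by (rule distr_cong) (simp_all add: X[OF i])
    also have "\<dots> = distr M borel (X (Train 1))"
      using same i one
      by (intro iid_covariate_distr[of "Train ` {1..n}"]) (auto simp: same_X_def intro: obs_set_I)
    finally show "distr M borel (X (Test i)) = distr M borel (X (Train 1))" .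
    have "(\<lambda>(\<beta>, x). ennreal (fit_error \<beta> x)) \<in> borel_measurable (borel \<Otimes>\<^sub>M borel)"
      using fit_error_measurable by (simp add: split_beta')
    from same_X_exchange[OF i same inv bhat_measurable this]
    show "(\<integral>\<^sup>+\<omega>. ennreal (fit_error (bhat (train_data n X Y \<omega>)) (X (Test i) \<omega>)) \<partial>M) =
      (\<integral>\<^sup>+\<omega>. ennreal (fit_error (bhat (train_data n X Y \<omega>)) (X (Test 1) \<omega>)) \<partial>M)"
      by simp
  qed
  also have "(\<integral>\<omega>. fit_error (bhat (train_data n X Y \<omega>)) (X (Test 1) \<omega>) \<partial>M) =
      (\<integral>\<omega>. fit_error (bhat (train_data n X Y \<omega>)) (X (Train 1) \<omega>) \<partial>M)"
    by (rule Bochner_Integration.integral_cong) (simp_all only: X[OF one])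
  also have "\<dots> = (\<integral>\<omega>. (norm (cond_mean M F Z \<omega> - C_weighted W C (X (Train 1) \<omega>)))^2 \<partial>M) +
      (\<integral>\<omega>. trace (cond_cov M F Z \<omega>) \<partial>M)"
    unfolding Z_def
  proof (rule fit_error_bias_variance[OF obs_set_I(1)[OF one]])
    show "subalgebra M F"
      unfolding F_def by (intro subalgebra_generated covariates_measurable) (auto intro: obs_set_I)
    show "X (Train 1) \<in> borel_measurable F"
      unfolding F_def by (rule measurable_generated) (use one in blast)
    have "integrable M (\<lambda>\<omega>. fit_error (bhat (train_data n X Y \<omega>)) (X (Test 1) \<omega>)) \<longleftrightarrow>
        integrable M (\<lambda>\<omega>. fit_error (bhat (train_data n X Y \<omega>)) (X (Train 1) \<omega>))"
      by (rule Bochner_Integration.integrable_cong) (simp_all only: X[OF one])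
    then show "integrable M (\<lambda>\<omega>. fit_error (bhat (train_data n X Y \<omega>)) (X (Train 1) \<omega>))"
      using pred_error_decomposition(2)[OF one res[OF one]] by blast
  qed
  finally show ?thesis by (simp only: add.assoc)
qed

end

theorem theorem5:
  fixes M :: "'a measure" and n :: nat
    and X :: "obs \<Rightarrow> 'a \<Rightarrow> 'x::euclidean_space"
    and Y \<E> :: "obs \<Rightarrow> 'a \<Rightarrow> real^'p"
    and C :: "'x \<Rightarrow> real^'p^'p" and \<mu>4 :: real
    and W V :: "'x \<Rightarrow> real^('p \<times> 'p)^('p \<times> 'p)"
    and Cm :: "real^'k \<Rightarrow> 'x \<Rightarrow> real^'p^'p"
    and bhat :: "(nat \<Rightarrow> 'x \<times> (real^'p)) \<Rightarrow> real^'k"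
  assumes "prob_space M" and "n \<ge> 1"
    and "true_model M n C X Y"
    and "data_generating M n C X Y \<E> \<mu>4"
    and "fitted_model M n W Cm bhat X Y"
    and "cond_cov_function M n X Y V"
    and "integrable M (Te n W Cm bhat X Y)"
  shows
    "(\<forall>x. fixed_X M n x X \<and>
        (\<forall>i\<in>{1..n}. covariance_finite M (\<lambda>\<omega>. C_hat_weighted n W Cm bhat X Y \<omega> (x i)))
      \<longrightarrow> Err M n W Cm bhat X Y =
            1 / real n * (\<Sum>i=1..n. nu2 W V (x i)) +
            1 / real n * (\<Sum>i=1..n.
              (norm ((\<integral>\<omega>. C_hat_weighted n W Cm bhat X Y \<omega> (x i) \<partial>M) - C_weighted W C (x i)))^2) +
            1 / real n * (\<Sum>i=1..n.
              trace (covariance_matrix M (\<lambda>\<omega>. C_hat_weighted n W Cm bhat X Y \<omega> (x i)))))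
     \<and>
     (let F = generated M (Train ` {1..n} \<union> {Test 1}) X;
          Z = (\<lambda>\<omega>. C_hat_weighted n W Cm bhat X Y \<omega> (X (Test 1) \<omega>))
      in random_X M n X Y \<and>
         cond_cov_finite M F Z \<and>
         integrable M (\<lambda>\<omega>. nu2 W V (X (Train 1) \<omega>)) \<and>
         integrable M (\<lambda>\<omega>. (norm (cond_mean M F Z \<omega> - C_weighted W C (X (Test 1) \<omega>)))^2) \<and>
         integrable M (\<lambda>\<omega>. trace (cond_cov M F Z \<omega>))
      \<longrightarrow> Err M n W Cm bhat X Y =
            (\<integral>\<omega>. nu2 W V (X (Train 1) \<omega>) \<partial>M) +
            (\<integral>\<omega>. (norm (cond_mean M F Z \<omega> - C_weighted W C (X (Test 1) \<omega>)))^2 \<partial>M) +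
            (\<integral>\<omega>. trace (cond_cov M F Z \<omega>) \<partial>M))
     \<and>
     (let F = generated M (Train ` {1..n}) X;
          Z = (\<lambda>\<omega>. C_hat_weighted n W Cm bhat X Y \<omega> (X (Train 1) \<omega>))
      in same_X M n X Y \<and>
         numbering_invariant M n bhat X Y \<and>
         cond_cov_finite M F Z \<and>
         integrable M (\<lambda>\<omega>. nu2 W V (X (Train 1) \<omega>)) \<and>
         integrable M (\<lambda>\<omega>. (norm (cond_mean M F Z \<omega> - C_weighted W C (X (Train 1) \<omega>)))^2) \<and>
         integrable M (\<lambda>\<omega>. trace (cond_cov M F Z \<omega>))
      \<longrightarrow> Err M n W Cm bhat X Y =
            (\<integral>\<omega>. nu2 W V (X (Train 1) \<omega>) \<partial>M) +
            (\<integral>\<omega>. (norm (cond_mean M F Z \<omega> - C_weighted W C (X (Train 1) \<omega>)))^2 \<partial>M) +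
            (\<integral>\<omega>. trace (cond_cov M F Z \<omega>) \<partial>M))"
proof -
  interpret fitted_covariance_regression M n C X Y \<E> \<mu>4 W V Cm bhat
    using assms by (intro fitted_covariance_regression.intro covariance_regression.intro
        covariance_regression_axioms.intro fitted_covariance_regression_axioms.intro)
  show ?thesis
    unfolding Let_def by (intro conjI allI impI; elim conjE) (rule Err_fixed Err_random Err_same; blast)+
qed

end
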